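(* Let $\alpha,\beta>0$ and let $\phi\in\mathcal{A}$ be a stable generator for $V_{1/\beta}(\phi)$. If $0<\alpha<\dfrac{1}{2\sqrt{M_{\phi,1/\beta}}}$, then $\mathcal{G}(\phi,\alpha,\beta)$ forms a frame for $L^2(\mathbb{R})$ with frame bounds $$A(\alpha,\beta)=\tfrac{1}{\alpha}\left(1-2\alpha\sqrt{M_{\phi,1/\beta}}\right)^2\operatorname*{ess\,inf}_{\xi\in[0,\beta]}\sum_{k\in\mathbb{Z}}|\widehat{\phi}(\xi+\beta k)|^2$$ and $$B(\alpha,\beta)=\tfrac{1}{\alpha}\left(1+2\alpha\sqrt{M_{\phi,1/\beta}}\right)^2\operatorname*{ess\,sup}_{\xi\in[0,\beta]}\sum_{k\in\mathbb{Z}}|\widehat{\phi}(\xi+\beta k)|^2 .$$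
   Context: The Fourier transform is $\widehat f(w)=\int_{-\infty}^{\infty}f(x)e^{-2\pi i wx}\,dx$. For $\phi\in L^2(\mathbb{R})$ and $\alpha,\beta>0$, the Gabor system is $\mathcal{G}(\phi,\alpha,\beta)=\{e^{2\pi i\beta m\cdot}\phi(\cdot-\alpha k):k,m\in\mathbb{Z}\}$; it is a frame for $L^2(\mathbb{R})$ with frame bounds $A,B>0$ if $A\|f\|^2\le\sum_{k,m\in\mathbb{Z}}|\langle f,e^{2\pi i\beta m\cdot}\phi(\cdot-\alpha k)\rangle|^2\le B\|f\|^2$ for all $f\in L^2(\mathbb{R})$. For $h>0$, $V_h(\phi)=\{f\in L^2(\mathbb{R}): f=\sum_{k\in\mathbb{Z}}d_k\phi(\cdot-hk)\text{ for some }(d_k)\in\ell^2(\mathbb{Z})\}$; $\phi$ is a stable generator for $V_h(\phi)$ if $\{\phi(\cdot-hk):k\in\mathbb{Z}\}$ is a Riesz basis for $V_h(\phi)$. $\mathcal{A}$ is the class of real-valued continuous functions $\phi$ on $\mathbb{R}$ such that: (i) $\phi$ is differentiable except at a finite number of points; (ii) for some $\epsilon>0$, $\phi^{(s)}(x)=\mathcal{O}(|x|^{-0.5-\epsilon})$ as $x\to\pm\infty$ for $s=0,1$; (iii) for all $h>0$, $\operatorname*{ess\,sup}_{w\in[0,1/h]}\sum_{l\in\mathbb{Z}}(w+\tfrac{l}{h})^2|\widehat\phi(w+\tfrac{l}{h})|^2<\infty$. For $h>0$, $$B_{\phi,h}(w):=\frac{\sum_{l\in\mathbb{Z}}(w+\frac{l}{h})^2|\widehat\phi(w+\frac{l}{h})|^2}{\sum_{l\in\mathbb{Z}}|\widehat\phi(w+\frac{l}{h})|^2},\qquad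 M_{\phi,h}:=\operatorname*{ess\,sup}_{w\in[0,1/h]}B_{\phi,h}(w).$$ *)

theory Defs
  imports
    "HOL-Analysis.Analysis"
    "HOL-Library.Landau_Symbols"
    "HOL-Probability.Essential_Supremum"
begin

section \<open>Square-integrable functions on the real line\<close>

text \<open>
  Elements of \<open>L\<^sup>2(\<real>)\<close> are represented by Borel functions; every class of Lebesgue measurable
  functions modulo null sets has such a representative. All notions below depend only on the
  class. The squared norm takes values in \<^typ>\<open>ennreal\<close>, so that it is infinite, and not \<open>0\<close>,
  when the integral diverges.
\<close>

definition L2_norm_sq :: "(real \<Rightarrow> complex) \<Rightarrow> ennreal" where
  "L2_norm_sq f = (\<integral>\<^sup>+ x. ennreal ((cmod (f x))\<^sup>2) \<partial>lborel)"

definition L2_space :: "(real \<Rightarrow> complex) set" where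
  "L2_space = {f. f \<in> borel_measurable lborel \<and> L2_norm_sq f < \<infinity>}"

definition L2_inner :: "(real \<Rightarrow> complex) \<Rightarrow> (real \<Rightarrow> complex) \<Rightarrow> complex" where
  "L2_inner f g = (\<integral>x. f x * cnj (g x) \<partial>lborel)"

definition L2_tendsto ::
    "('i \<Rightarrow> real \<Rightarrow> complex) \<Rightarrow> (real \<Rightarrow> complex) \<Rightarrow> 'i filter \<Rightarrow> bool" where
  "L2_tendsto s f F \<longleftrightarrow> ((\<lambda>i. L2_norm_sq (\<lambda>x. s i x - f x)) \<longlongrightarrow> 0) F"


section \<open>The Fourier transform\<close>

text \<open>
  Functions in the class \<open>\<A>\<close> below are square-integrable but need not be integrable. For integrable
  functions the Fourier transform is given by the integral; for the other functions in
  \<open>L\<^sup>2(\<real>)\<close> it is the Plancherel extension, i.e. the \<open>L\<^sup>2\<close>-limit of the transforms of the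
  truncations to \<open>[-n, n]\<close>, which is unique up to null sets.
\<close>

definition fourier :: "(real \<Rightarrow> complex) \<Rightarrow> real \<Rightarrow> complex" where
  "fourier f =
    (if integrable lborel f then (\<lambda>w. \<integral>x. f x * cis (- (2 * pi * w * x)) \<partial>lborel)
     else (SOME g. g \<in> L2_space \<and>
             L2_tendsto (\<lambda>n::nat. \<lambda>w. \<integral>x\<in>{- real n..real n}. f x * cis (- (2 * pi * w * x)) \<partial>lborel)
               g sequentially))"


section \<open>Frames, Riesz bases and Gabor systems\<close>

definition frame_with_bounds :: "('i \<Rightarrow> real \<Rightarrow> complex) \<Rightarrow> real \<Rightarrow> real \<Rightarrow> bool" where
  "frame_with_bounds e A B \<longleftrightarrow>
     range e \<subseteq> L2_space \<and> 0 < A \<and> 0 < B \<and>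
     (\<forall>f\<in>L2_space.
        ennreal A * L2_norm_sq f \<le> (\<Sum>\<^sub>\<infinity>i. ennreal ((cmod (L2_inner f (e i)))\<^sup>2)) \<and>
        (\<Sum>\<^sub>\<infinity>i. ennreal ((cmod (L2_inner f (e i)))\<^sup>2)) \<le> ennreal B * L2_norm_sq f)"

definition gabor_system ::
    "(real \<Rightarrow> complex) \<Rightarrow> real \<Rightarrow> real \<Rightarrow> int \<times> int \<Rightarrow> real \<Rightarrow> complex" where
  "gabor_system \<phi> \<alpha> \<beta> = (\<lambda>(k, m) x. cis (2 * pi * \<beta> * of_int m * x) * \<phi> (x - \<alpha> * of_int k))"

definition closed_span_L2 :: "('i \<Rightarrow> real \<Rightarrow> complex) \<Rightarrow> (real \<Rightarrow> complex) set" where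
  "closed_span_L2 e =
     {f \<in> L2_space. \<forall>\<epsilon>>0. \<exists>F c. finite F \<and> L2_norm_sq (\<lambda>x. f x - (\<Sum>i\<in>F. c i * e i x)) < ennreal \<epsilon>}"

definition riesz_basis_L2 ::
    "('i \<Rightarrow> real \<Rightarrow> complex) \<Rightarrow> (real \<Rightarrow> complex) set \<Rightarrow> bool" where
  "riesz_basis_L2 e V \<longleftrightarrow>
     range e \<subseteq> L2_space \<and> closed_span_L2 e = V \<and>
     (\<exists>a b. 0 < a \<and> 0 < b \<and>
        (\<forall>F c. finite F \<longrightarrow>
           ennreal (a * (\<Sum>i\<in>F. (cmod (c i))\<^sup>2)) \<le> L2_norm_sq (\<lambda>x. \<Sum>i\<in>F. c i * e i x) \<and>
           L2_norm_sq (\<lambda>x. \<Sum>i\<in>F. c i * e i x) \<le> ennreal (b * (\<Sum>i\<in>F. (cmod (c i))\<^sup>2))))"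

definition shift_system :: "real \<Rightarrow> (real \<Rightarrow> complex) \<Rightarrow> int \<Rightarrow> real \<Rightarrow> complex" where
  "shift_system h \<phi> = (\<lambda>k x. \<phi> (x - h * of_int k))"

definition V_space :: "real \<Rightarrow> (real \<Rightarrow> complex) \<Rightarrow> (real \<Rightarrow> complex) set" where
  "V_space h \<phi> =
     {f \<in> L2_space. \<exists>d::int \<Rightarrow> complex. (\<lambda>k. (cmod (d k))\<^sup>2) summable_on UNIV \<and>
        L2_tendsto (\<lambda>F x. \<Sum>k\<in>F. d k * shift_system h \<phi> k x) f (finite_subsets_at_top UNIV)}"

definition stable_generator :: "real \<Rightarrow> (real \<Rightarrow> complex) \<Rightarrow> bool" where
  "stable_generator h \<phi> \<longleftrightarrow> riesz_basis_L2 (shift_system h \<phi>) (V_space h \<phi>)"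


section \<open>The class \<open>\<A>\<close> and the constant \<open>M\<^bsub>\<phi>,h\<^esub>\<close>\<close>

text \<open>Dual to \<^const>\<open>esssup\<close> from the library.\<close>

definition essinf :: "'a measure \<Rightarrow> ('a \<Rightarrow> ennreal) \<Rightarrow> ennreal" where
  "essinf M f = (if f \<in> borel_measurable M then Liminf (ae_filter M) f else 0)"

definition fourier_periodization :: "(real \<Rightarrow> complex) \<Rightarrow> real \<Rightarrow> real \<Rightarrow> ennreal" where
  "fourier_periodization \<phi> p w = (\<Sum>\<^sub>\<infinity>l::int. ennreal ((cmod (fourier \<phi> (w + p * of_int l)))\<^sup>2))"

definition weighted_periodization :: "(real \<Rightarrow> complex) \<Rightarrow> real \<Rightarrow> real \<Rightarrow> ennreal" where
  "weighted_periodization \<phi> p w =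
     (\<Sum>\<^sub>\<infinity>l::int. ennreal ((w + p * of_int l)\<^sup>2 * (cmod (fourier \<phi> (w + p * of_int l)))\<^sup>2))"

definition class_A :: "(real \<Rightarrow> complex) set" where
  "class_A = {\<phi>. range \<phi> \<subseteq> \<real> \<and> continuous_on UNIV \<phi> \<and>
     finite {x. \<not> \<phi> differentiable (at x)} \<and>
     (\<exists>\<epsilon>>0. \<forall>F\<in>{at_top, at_bot}.
        (\<lambda>x. norm (\<phi> x)) \<in> O[F](\<lambda>x. \<bar>x\<bar> powr (- 0.5 - \<epsilon>)) \<and>
        (\<lambda>x. norm (vector_derivative \<phi> (at x))) \<in> O[F](\<lambda>x. \<bar>x\<bar> powr (- 0.5 - \<epsilon>))) \<and>
     (\<forall>h>0. esssup (restrict_space lborel {0..1 / h}) (weighted_periodization \<phi> (1 / h)) < \<infinity>)}"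

definition B_ratio :: "(real \<Rightarrow> complex) \<Rightarrow> real \<Rightarrow> real \<Rightarrow> ennreal" where
  "B_ratio \<phi> h w = weighted_periodization \<phi> (1 / h) w / fourier_periodization \<phi> (1 / h) w"

text \<open>
  For a stable generator in \<open>\<A>\<close> the essential supremum is positive and finite, so that the
  conversion to a real number loses nothing.
\<close>

definition M_const :: "(real \<Rightarrow> complex) \<Rightarrow> real \<Rightarrow> real" where
  "M_const \<phi> h = enn2real (esssup (restrict_space lborel {0..1 / h}) (B_ratio \<phi> h))"

end

theory Submission
  imports Defs "HOL-Probability.Characteristic_Functions"
begin

text \<open>
  Write \<open>h = 1 / \<beta>\<close>. For fixed \<open>x\<close> let \<open>g\<^sub>x (t) = \<Sum>\<^sub>l cnj (f (x + l h)) \<phi> (t + l h)\<close>. The coefficient of \<open>f\<close>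
  at \<open>(k, m)\<close> is the \<open>m\<close>-th Fourier coefficient over \<open>[0, h]\<close> of \<open>x \<mapsto> cnj (g\<^sub>x (x - \<alpha> k))\<close>, so Parseval in \<open>m\<close>
  turns the sum of all squared coefficients into \<open>h \<integral>\<^bsub>[0,h]\<^esub> \<Sum>\<^sub>k \<bar>g\<^sub>x (x - \<alpha> k)\<bar>\<^sup>2 dx\<close>. The theorem thus
  reduces to comparing, for each finite combination \<open>g\<close> of shifts of \<open>\<phi>\<close>, the samples of \<open>g\<close> on a
  translate of \<open>\<alpha> \<int>\<close> with the norm of \<open>g\<close>, and the norm of \<open>g\<close> with its coefficients.

  Both comparisons are made in the Fourier domain. There \<open>g\<close> becomes \<open>m \<cdot> fourier \<phi>\<close> with a
  \<open>\<beta>\<close>-periodic trigonometric polynomial \<open>m\<close>, and the Plancherel theorem, folded onto \<open>[0, \<beta>]\<close>, shows that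
  the squared norm of \<open>g\<close> is \<open>\<integral> \<bar>m\<bar>\<^sup>2 G\<close> with \<open>G = fourier_periodization \<phi> \<beta>\<close>
  (\<open>L2_norm_sq_shift_combination\<close>). The essential bounds of \<open>G\<close> therefore compare the norm of \<open>g\<close> with its
  coefficients. For the translates, \<open>\<bar>cis (2 \<pi> s w) - 1\<bar> \<le> 2 \<pi> \<bar>s w\<bar>\<close> gives the Bernstein-type inequality
  \<open>\<parallel>g (\<cdot> + s) - g\<parallel> \<le> 2 \<pi> s \<surd>M \<parallel>g\<parallel>\<close> (\<open>L2_norm_sq_shift_combination_difference\<close>), because the weighted
  periodization is at most \<open>M G\<close>.

  Such a bound on translates suffices for sampling (\<open>sampling_inequality\<close>): by Wirtinger's inequality
  on cells of length \<open>\<alpha>\<close> around the sample points, the step function of the samples differs from \<open>g\<close> in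
  norm by at most \<open>(\<alpha> / \<pi>) 2 \<pi> \<surd>M \<parallel>g\<parallel> = \<theta> \<parallel>g\<parallel>\<close> with \<open>\<theta> = 2 \<alpha> \<surd>M < 1\<close>. This is the origin of the factors
  \<open>(1 \<plusminus> \<theta>)\<^sup>2\<close>.

  The bounds are positive and finite because the Riesz basis inequalities say that \<open>\<integral> \<bar>m\<bar>\<^sup>2 G\<close> is
  comparable to \<open>\<integral> \<bar>m\<bar>\<^sup>2\<close> for every trigonometric polynomial \<open>m\<close>; such polynomials approximate indicator
  functions, so \<open>G\<close> is essentially bounded above and below (\<open>weight_bounds_of_trig_poly\<close>). All this is
  carried out for continuous \<open>f\<close> of compact support, where the sums over \<open>l\<close> are finite, and extended
  by density (\<open>frame_inequality_dense\<close>).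
\<close>


abbreviation sq_mod :: "complex \<Rightarrow> ennreal" where
  "sq_mod z \<equiv> ennreal ((cmod z)\<^sup>2)"

abbreviation L2_dist_sq :: "(real \<Rightarrow> complex) \<Rightarrow> (real \<Rightarrow> complex) \<Rightarrow> ennreal" where
  "L2_dist_sq f g \<equiv> L2_norm_sq (\<lambda>x. f x - g x)"

abbreviation trig_sum :: "int set \<Rightarrow> (int \<Rightarrow> complex) \<Rightarrow> real \<Rightarrow> real \<Rightarrow> complex" where
  "trig_sum F d L x \<equiv> \<Sum>m\<in>F. d m * cis (2 * pi * of_int m * x / L)"

section \<open>Sums over countable index sets and periodization\<close>

lemma nn_integral_count_space_suminf:
  fixes f :: "'a::countable \<Rightarrow> ennreal"
  shows "(\<integral>\<^sup>+i. f i \<partial>count_space UNIV) = (\<Sum>n. f (from_nat n) * indicator (range (to_nat :: 'a \<Rightarrow> nat)) n)"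
proof -
  let ?R = "range (to_nat :: 'a \<Rightarrow> nat)"
  have "(\<integral>\<^sup>+i. f i \<partial>count_space UNIV) = (\<integral>\<^sup>+n. f (from_nat n) \<partial>count_space ?R)"
    by (subst nn_integral_bij_count_space[where g=to_nat and A=UNIV, symmetric])
       (auto simp: bij_betw_def)
  also have "\<dots> = (\<integral>\<^sup>+n. f (from_nat n) * indicator ?R n \<partial>count_space UNIV)"
    by (simp add: nn_integral_count_space_indicator)
  also have "\<dots> = (\<Sum>n. f (from_nat n) * indicator ?R n)"
    by (rule nn_integral_count_space_nat)
  finally show ?thesis .
qed

lemma borel_measurable_nn_integral_count_space [measurable (raw)]:
  fixes f :: "'a \<Rightarrow> 'i::countable \<Rightarrow> ennreal"
  assumes [measurable]: "\<And>i. (\<lambda>t. f t i) \<in> borel_measurable M"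
  shows "(\<lambda>t. \<integral>\<^sup>+i. f t i \<partial>count_space UNIV) \<in> borel_measurable M"
  unfolding nn_integral_count_space_suminf by measurable

text \<open>
  Rewriting unordered sums as integrals over a counting measure makes the Tonelli theorem available
  for exchanging sums with integrals.
\<close>

lemma infsum_ennreal_eq_nn_integral:
  fixes f :: "'a::countable \<Rightarrow> ennreal"
  shows "(\<Sum>\<^sub>\<infinity>i. f i) = (\<integral>\<^sup>+i. f i \<partial>count_space UNIV)"
proof (rule antisym)
  show "(\<Sum>\<^sub>\<infinity>i. f i) \<le> (\<integral>\<^sup>+i. f i \<partial>count_space UNIV)"
  proof (subst nonneg_infsum_complete, simp, rule SUP_least)
    fix F :: "'a set" assume "F \<in> {F. finite F \<and> F \<subseteq> UNIV}"
    then have "finite F" by simp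
    then have "sum f F = (\<integral>\<^sup>+i. f i * indicator F i \<partial>count_space UNIV)"
      by (subst nn_integral_count_space'[where A=F]) auto
    also have "\<dots> \<le> (\<integral>\<^sup>+i. f i \<partial>count_space UNIV)"
      by (intro nn_integral_mono) (auto simp: indicator_def)
    finally show "sum f F \<le> (\<integral>\<^sup>+i. f i \<partial>count_space UNIV)" .
  qed
  let ?R = "range (to_nat :: 'a \<Rightarrow> nat)"
  have "(\<integral>\<^sup>+i. f i \<partial>count_space UNIV) = (\<Sum>n. f (from_nat n) * indicator ?R n)"
    by (rule nn_integral_count_space_suminf)
  also have "\<dots> \<le> (\<Sum>\<^sub>\<infinity>i. f i)"
  proof (rule suminf_le_const)
    fix N
    have "(\<Sum>n<N. f (from_nat n) * indicator ?R n) = (\<Sum>n\<in>{..<N} \<inter> ?R. (f \<circ> from_nat) n)"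
      by (simp add: sum.inter_restrict indicator_def if_distrib cong: if_cong)
    also have "\<dots> = sum f (from_nat ` ({..<N} \<inter> ?R))"
      by (rule sum.reindex[symmetric]) (auto intro!: inj_onI)
    also have "\<dots> \<le> (\<Sum>\<^sub>\<infinity>i. f i)"
      by (subst nonneg_infsum_complete) (auto intro!: SUP_upper)
    finally show "(\<Sum>n<N. f (from_nat n) * indicator ?R n) \<le> (\<Sum>\<^sub>\<infinity>i. f i)" .
  qed auto
  finally show "(\<integral>\<^sup>+i. f i \<partial>count_space UNIV) \<le> (\<Sum>\<^sub>\<infinity>i. f i)" .
qed

lemma nn_integral_lborel_shift:
  fixes u :: "real \<Rightarrow> ennreal"
  assumes [measurable]: "u \<in> borel_measurable borel"
  shows "(\<integral>\<^sup>+x. u (x + c) \<partial>lborel) = (\<integral>\<^sup>+x. u x \<partial>lborel)"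
  using nn_integral_real_affine[of u 1 c] by (simp add: add.commute)

text \<open>
  The half-open translates of \<open>[a, a + p)\<close> tile the line; closing the interval changes a null set only.
\<close>

lemma nn_integral_periodization:
  fixes u :: "real \<Rightarrow> ennreal"
  assumes [measurable]: "u \<in> borel_measurable borel" and p: "p > 0"
  shows "(\<integral>\<^sup>+x. u x \<partial>lborel) =
    (\<integral>\<^sup>+x\<in>{a..a + p}. (\<integral>\<^sup>+l. u (x + p * of_int l) \<partial>count_space UNIV) \<partial>lborel)"
proof -
  define J where "J l = {a + p * of_int l ..< a + p * of_int l + p}" for l :: int
  have [measurable]: "J l \<in> sets borel" for l by (simp add: J_def)
  have J: "x \<in> J l \<longleftrightarrow> l = \<lfloor>(x - a) / p\<rfloor>" for x l
  proof -
    have "x \<in> J l \<longleftrightarrow> of_int l \<le> (x - a) / p \<and> (x - a) / p < of_int l + 1"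
      using p by (auto simp: J_def field_simps)
    then show ?thesis by linarith
  qed
  have decomp: "u x = (\<integral>\<^sup>+l. u x * indicator (J l) x \<partial>count_space UNIV)" for x
  proof -
    have "(\<integral>\<^sup>+l. u x * indicator (J l) x \<partial>count_space UNIV)
        = (\<integral>\<^sup>+l\<in>{\<lfloor>(x - a) / p\<rfloor>}. u x \<partial>count_space UNIV)"
      by (intro nn_integral_cong) (simp add: indicator_def J)
    then show ?thesis
      by simp
  qed
  have "(\<integral>\<^sup>+x. u x \<partial>lborel) = (\<integral>\<^sup>+x. (\<integral>\<^sup>+l. u x * indicator (J l) x \<partial>count_space UNIV) \<partial>lborel)"
    by (subst decomp) simp
  also have "\<dots> = (\<integral>\<^sup>+l. (\<integral>\<^sup>+x\<in>(J l). u x \<partial>lborel) \<partial>count_space UNIV)"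
    by (rule nn_integral_count_space_nn_integral) auto
  also have "\<dots> = (\<integral>\<^sup>+l. (\<integral>\<^sup>+x\<in>{a..<a+p}. u (x + p * of_int l) \<partial>lborel) \<partial>count_space UNIV)"
  proof (rule nn_integral_cong)
    fix l :: int
    have "(\<integral>\<^sup>+x\<in>(J l). u x \<partial>lborel) = (\<integral>\<^sup>+x. u (x + p * of_int l) * indicator (J l) (x + p * of_int l) \<partial>lborel)"
      by (rule nn_integral_lborel_shift[symmetric]) auto
    also have "\<dots> = (\<integral>\<^sup>+x\<in>{a..<a+p}. u (x + p * of_int l) \<partial>lborel)"
      by (intro nn_integral_cong) (auto simp: J_def indicator_def)
    finally show "(\<integral>\<^sup>+x\<in>(J l). u x \<partial>lborel) = (\<integral>\<^sup>+x\<in>{a..<a+p}. u (x + p * of_int l) \<partial>lborel)" .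
  qed
  also have "\<dots> = (\<integral>\<^sup>+x. (\<integral>\<^sup>+l. u (x + p * of_int l) * indicator {a..<a+p} x \<partial>count_space UNIV) \<partial>lborel)"
    by (rule nn_integral_count_space_nn_integral[symmetric]) auto
  also have "\<dots> = (\<integral>\<^sup>+x\<in>{a..<a+p}. (\<integral>\<^sup>+l. u (x + p * of_int l) \<partial>count_space UNIV) \<partial>lborel)"
    by (intro nn_integral_cong) (simp add: nn_integral_multc)
  also have "\<dots> = (\<integral>\<^sup>+x\<in>{a..a + p}. (\<integral>\<^sup>+l. u (x + p * of_int l) \<partial>count_space UNIV) \<partial>lborel)"
  proof (rule nn_integral_cong_AE)
    show "AE x in lborel. (\<integral>\<^sup>+l. u (x + p * of_int l) \<partial>count_space UNIV) * indicator {a..<a+p} x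
      = (\<integral>\<^sup>+l. u (x + p * of_int l) \<partial>count_space UNIV) * indicator {a..a + p} x"
      using AE_lborel_singleton[of "a+p"] by eventually_elim (auto simp: indicator_def)
  qed
  finally show ?thesis .
qed

text \<open>
  Young's inequality with a free parameter. Optimising \<open>\<eta>\<close> at the end recovers what Minkowski's
  inequality would give, without taking square roots of quantities that may be infinite.
\<close>

lemma norm_add_sq_le:
  fixes x y :: "'a::real_normed_vector"
  assumes "\<eta> > 0"
  shows "(norm (x + y))\<^sup>2 \<le> (1 + \<eta>) * (norm x)\<^sup>2 + (1 + 1 / \<eta>) * (norm y)\<^sup>2"
proof -
  have "(norm (x + y))\<^sup>2 \<le> (norm x + norm y)\<^sup>2"
    by (intro power_mono norm_triangle_ineq) auto
  also have "\<dots> \<le> (1 + \<eta>) * (norm x)\<^sup>2 + (1 + 1 / \<eta>) * (norm y)\<^sup>2"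
  proof -
    have "(1 + \<eta>) * (norm x)\<^sup>2 + (1 + 1 / \<eta>) * (norm y)\<^sup>2 - (norm x + norm y)\<^sup>2 = (\<eta> * norm x - norm y)\<^sup>2 / \<eta>"
      using assms by (simp add: field_simps power2_eq_square)
    also have "\<dots> \<ge> 0" using assms by simp
    finally show ?thesis by simp
  qed
  finally show ?thesis .
qed

lemma nn_integral_norm_sq_le:
  fixes u v :: "'a \<Rightarrow> complex"
  assumes [measurable]: "u \<in> borel_measurable M" "v \<in> borel_measurable M" and "\<eta> > 0"
  shows "(\<integral>\<^sup>+x. sq_mod (u x) \<partial>M) \<le>
    ennreal (1 + \<eta>) * (\<integral>\<^sup>+x. sq_mod (v x) \<partial>M)
    + ennreal (1 + 1 / \<eta>) * (\<integral>\<^sup>+x. sq_mod (u x - v x) \<partial>M)"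
proof -
  have "(\<integral>\<^sup>+x. sq_mod (u x) \<partial>M) \<le>
    (\<integral>\<^sup>+x. ennreal (1 + \<eta>) * sq_mod (v x) + ennreal (1 + 1 / \<eta>) * sq_mod (u x - v x) \<partial>M)"
  proof (rule nn_integral_mono)
    fix x
    have "(cmod (u x))\<^sup>2 \<le> (1 + \<eta>) * (cmod (v x))\<^sup>2 + (1 + 1 / \<eta>) * (cmod (u x - v x))\<^sup>2"
      using norm_add_sq_le[OF \<open>\<eta> > 0\<close>, of "v x" "u x - v x"] by simp
    then show "sq_mod (u x) \<le> ennreal (1 + \<eta>) * sq_mod (v x) + ennreal (1 + 1 / \<eta>) * sq_mod (u x - v x)"
      using \<open>\<eta> > 0\<close> by (simp add: ennreal_mult[symmetric] ennreal_plus[symmetric] del: ennreal_plus)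
  qed
  also have "\<dots> = ennreal (1 + \<eta>) * (\<integral>\<^sup>+x. sq_mod (v x) \<partial>M)
    + ennreal (1 + 1 / \<eta>) * (\<integral>\<^sup>+x. sq_mod (u x - v x) \<partial>M)"
    by (simp add: nn_integral_add nn_integral_cmult)
  finally show ?thesis .
qed

lemma ennreal_le_of_slack:
  fixes X Y :: ennreal
  assumes le: "\<And>\<eta>. \<eta> > 0 \<Longrightarrow> X \<le> ennreal (1 + \<eta>) * Y"
  shows "X \<le> Y"
proof (cases "Y = top")
  case False
  show ?thesis
  proof (rule LIMSEQ_le_const)
    have i: "(\<lambda>n. 1 / real (Suc n)) \<longlonglongrightarrow> 0"
      using LIMSEQ_inverse_real_of_nat by (simp add: inverse_eq_divide)
    have "(\<lambda>n. ennreal (1 + 1 / real (Suc n)) * Y) \<longlonglongrightarrow> ennreal (1 + 0) * Y"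
      using False by (intro tendsto_mult_ennreal tendsto_ennrealI tendsto_add tendsto_const i) auto
    then show "(\<lambda>n. ennreal (1 + 1 / real (Suc n)) * Y) \<longlonglongrightarrow> Y" by simp
    show "\<exists>N. \<forall>n\<ge>N. X \<le> ennreal (1 + 1 / real (Suc n)) * Y"
      using le[of "1 / real (Suc n)" for n] by auto
  qed
qed auto

section \<open>Sampling of functions with Lipschitz translations in the mean\<close>

text \<open>
  Links gauge integrals, in which the fundamental theorem of calculus and Fourier coefficients are
  handled below, with the Lebesgue integrals in the definition of the norm.
\<close>

lemma nn_integral_Icc_continuous:
  fixes f :: "real \<Rightarrow> real"
  assumes f: "continuous_on {a..b} f" and nn: "\<And>x. x \<in> {a..b} \<Longrightarrow> 0 \<le> f x"
  shows "(\<integral>\<^sup>+x\<in>{a..b}. ennreal (f x) \<partial>lborel) = ennreal (integral {a..b} f)"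
proof -
  have int: "set_integrable lborel {a..b} f"
    by (rule borel_integrable_atLeastAtMost'[OF f])
  have "(\<integral>\<^sup>+x\<in>{a..b}. ennreal (f x) \<partial>lborel) = (\<integral>\<^sup>+x. ennreal (indicator {a..b} x *\<^sub>R f x) \<partial>lborel)"
    by (intro nn_integral_cong) (auto simp: indicator_def)
  also have "\<dots> = ennreal (LINT x:{a..b}|lborel. f x)"
    using int nn unfolding set_integrable_def set_lebesgue_integral_def
    by (intro nn_integral_eq_integral) (auto simp: indicator_def)
  also have "(LINT x:{a..b}|lborel. f x) = integral {a..b} f"
    by (rule set_borel_integral_eq_integral(2)[OF int])
  finally show ?thesis .
qed

text \<open>
  The function \<open>h t = - \<kappa> tan (\<kappa> (t - d))\<close> solves the Riccati equation \<open>h' = - \<kappa>\<^sup>2 - h\<^sup>2\<close>, whence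
  \<open>(h \<bar>u\<bar>\<^sup>2)' = \<bar>u'\<bar>\<^sup>2 - \<kappa>\<^sup>2 \<bar>u\<bar>\<^sup>2 - \<bar>u' - h u\<bar>\<^sup>2\<close>. The boundary terms vanish, since \<open>h\<close> is zero at \<open>d\<close> and \<open>u\<close> at
  the other endpoint. A frequency \<open>\<kappa>\<close> below the critical one keeps \<open>h\<close> finite on the closed interval.
\<close>

lemma wirtinger_tan:
  fixes u u' :: "real \<Rightarrow> complex"
  assumes ab: "a \<le> b" and der: "\<And>t. t \<in> {a..b} \<Longrightarrow> (u has_vector_derivative u' t) (at t within {a..b})"
    and cont: "continuous_on {a..b} u'"
    and bc: "d = a \<and> u b = 0 \<or> d = b \<and> u a = 0"
    and \<kappa>: "0 < \<kappa>" "\<kappa> * (b - a) < pi / 2"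
  shows "\<kappa>\<^sup>2 * integral {a..b} (\<lambda>t. (cmod (u t))\<^sup>2) \<le> integral {a..b} (\<lambda>t. (cmod (u' t))\<^sup>2)"
proof -
  define h where "h t = - \<kappa> * tan (\<kappa> * (t - d))" for t
  define F where "F t = h t * (u t \<bullet> u t)" for t
  define r where "r t = (cmod (u' t - h t *\<^sub>R u t))\<^sup>2" for t
  have cosnz: "cos (\<kappa> * (t - d)) \<noteq> 0" if "t \<in> {a..b}" for t
  proof -
    have "\<bar>t - d\<bar> \<le> b - a" using that bc by auto
    then have "\<kappa> * \<bar>t - d\<bar> \<le> \<kappa> * (b - a)" using \<kappa> by (intro mult_left_mono) auto
    then have "\<kappa> * \<bar>t - d\<bar> < pi / 2" using \<kappa>(2) by (rule le_less_trans)
    then have "\<bar>\<kappa> * (t - d)\<bar> < pi / 2" using \<kappa>(1) by (simp add: abs_mult)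
    then have "cos (\<kappa> * (t - d)) > 0" by (intro cos_gt_zero_pi) auto
    then show ?thesis by simp
  qed
  have hder: "(h has_real_derivative (- (\<kappa>\<^sup>2) - (h t)\<^sup>2)) (at t within {a..b})" if "t \<in> {a..b}" for t
  proof -
    have "(h has_real_derivative (- \<kappa> * (inverse ((cos (\<kappa> * (t - d)))\<^sup>2) * \<kappa>))) (at t within {a..b})"
      unfolding h_def using cosnz[OF that] by (auto intro!: derivative_eq_intros)
    moreover have "- \<kappa> * (inverse ((cos (\<kappa> * (t - d)))\<^sup>2) * \<kappa>) = - (\<kappa>\<^sup>2) - (h t)\<^sup>2"
    proof -
      have "inverse ((cos (\<kappa> * (t - d)))\<^sup>2) = 1 + (tan (\<kappa> * (t - d)))\<^sup>2"
        using tan_sec[OF cosnz[OF that]] by (simp add: power_inverse)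
      then show ?thesis by (simp add: h_def power2_eq_square algebra_simps)
    qed
    ultimately show ?thesis by metis
  qed
  have contu: "continuous_on {a..b} u"
    using der by (meson continuous_on_eq_continuous_within has_vector_derivative_continuous)
  have conth: "continuous_on {a..b} h"
    using hder by (meson DERIV_continuous continuous_on_eq_continuous_within)
  have Fder: "(F has_vector_derivative ((cmod (u' t))\<^sup>2 - \<kappa>\<^sup>2 * (cmod (u t))\<^sup>2 - r t)) (at t within {a..b})"
    if t: "t \<in> {a..b}" for t
  proof -
    have 1: "((\<lambda>t. u t \<bullet> u t) has_vector_derivative (2 * (u t \<bullet> u' t))) (at t within {a..b})"
      using bounded_bilinear.has_vector_derivative[OF bounded_bilinear_inner der[OF t] der[OF t]]
      by (simp add: inner_commute)
    have 2: "(h has_vector_derivative (- (\<kappa>\<^sup>2) - (h t)\<^sup>2)) (at t within {a..b})"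
      using hder[OF t] by (simp add: has_real_derivative_iff_has_vector_derivative)
    have "(F has_vector_derivative (h t * (2 * (u t \<bullet> u' t)) + (- (\<kappa>\<^sup>2) - (h t)\<^sup>2) * (u t \<bullet> u t))) (at t within {a..b})"
      unfolding F_def using has_vector_derivative_mult[OF 2 1] by simp
    moreover have "h t * (2 * (u t \<bullet> u' t)) + (- (\<kappa>\<^sup>2) - (h t)\<^sup>2) * (u t \<bullet> u t) = (cmod (u' t))\<^sup>2 - \<kappa>\<^sup>2 * (cmod (u t))\<^sup>2 - r t"
      unfolding r_def power2_norm_eq_inner
      by (simp add: inner_diff_left inner_diff_right inner_commute power2_eq_square algebra_simps)
    ultimately show ?thesis by simp
  qed
  have "((\<lambda>t. (cmod (u' t))\<^sup>2 - \<kappa>\<^sup>2 * (cmod (u t))\<^sup>2 - r t) has_integral (F b - F a)) {a..b}"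
    by (rule fundamental_theorem_of_calculus[OF ab Fder])
  moreover have "F b - F a = 0"
    using bc by (auto simp: F_def h_def)
  ultimately have "integral {a..b} (\<lambda>t. (cmod (u' t))\<^sup>2 - \<kappa>\<^sup>2 * (cmod (u t))\<^sup>2 - r t) = 0"
    by (simp add: integral_unique)
  moreover have ints: "(\<lambda>t. (cmod (u' t))\<^sup>2) integrable_on {a..b}" "(\<lambda>t. \<kappa>\<^sup>2 * (cmod (u t))\<^sup>2) integrable_on {a..b}"
     "r integrable_on {a..b}"
    unfolding r_def
    by (intro integrable_continuous_interval continuous_intros contu conth cont)+
  ultimately have "integral {a..b} (\<lambda>t. (cmod (u' t))\<^sup>2) - integral {a..b} (\<lambda>t. \<kappa>\<^sup>2 * (cmod (u t))\<^sup>2) - integral {a..b} r = 0"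
    by (simp add: integral_diff integrable_diff)
  moreover have "integral {a..b} r \<ge> 0"
    by (rule integral_nonneg[OF ints(3)]) (simp add: r_def)
  ultimately show ?thesis
    by simp
qed

text \<open>
  The sharp constant arises as \<open>\<kappa>\<close> tends to \<open>\<pi> / (2 (b - a))\<close>.
\<close>

lemma wirtinger:
  fixes u u' :: "real \<Rightarrow> complex"
  assumes ab: "a < b" and der: "\<And>t. t \<in> {a..b} \<Longrightarrow> (u has_vector_derivative u' t) (at t within {a..b})"
    and cont: "continuous_on {a..b} u'"
    and bc: "u a = 0 \<or> u b = 0"
  shows "integral {a..b} (\<lambda>t. (cmod (u t))\<^sup>2) \<le> (2 * (b - a) / pi)\<^sup>2 * integral {a..b} (\<lambda>t. (cmod (u' t))\<^sup>2)"
proof -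
  define X where "X = integral {a..b} (\<lambda>t. (cmod (u t))\<^sup>2)"
  define Y where "Y = integral {a..b} (\<lambda>t. (cmod (u' t))\<^sup>2)"
  obtain d where d: "d = a \<and> u b = 0 \<or> d = b \<and> u a = 0" using bc by auto
  have "X \<le> (2 * (b - a) / pi)\<^sup>2 * Y"
  proof (rule field_le_mult_one_interval)
    fix z :: real assume z: "0 < z" "z < 1"
    (* z is the square of the ratio of the frequency to the critical one. *)
    define \<kappa> where "\<kappa> = sqrt z * (pi / (2 * (b - a)))"
    have sz: "sqrt z < 1" using z by simp
    have "\<kappa> * (b - a) = sqrt z * (pi / 2)" using ab by (simp add: \<kappa>_def field_simps)
    also have "\<dots> < 1 * (pi / 2)" using sz by (intro mult_strict_right_mono) auto
    finally have k2: "\<kappa> * (b - a) < pi / 2" by simp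
    have k1: "0 < \<kappa>" using z ab by (simp add: \<kappa>_def)
    have "\<kappa>\<^sup>2 * X \<le> Y"
      unfolding X_def Y_def using wirtinger_tan[OF _ der cont d k1 k2] ab by simp
    moreover have "\<kappa>\<^sup>2 = z * (pi / (2 * (b - a)))\<^sup>2" unfolding \<kappa>_def power_mult_distrib using z by simp
    ultimately have *: "z * (pi / (2 * (b - a)))\<^sup>2 * X \<le> Y" by simp
    have "z * X = (2 * (b - a) / pi)\<^sup>2 * (z * (pi / (2 * (b - a)))\<^sup>2 * X)"
    proof -
      have "(2 * (b - a) / pi) * (pi / (2 * (b - a))) = 1"
        using ab by simp
      then have "(2 * (b - a) / pi)\<^sup>2 * (pi / (2 * (b - a)))\<^sup>2 = 1"
        by (metis power_mult_distrib power_one)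
      moreover have "(2 * (b - a) / pi)\<^sup>2 * (z * (pi / (2 * (b - a)))\<^sup>2 * X)
          = ((2 * (b - a) / pi)\<^sup>2 * (pi / (2 * (b - a)))\<^sup>2) * (z * X)"
        by (simp only: mult_ac)
      ultimately show ?thesis by (simp only: mult_1)
    qed
    also have "\<dots> \<le> (2 * (b - a) / pi)\<^sup>2 * Y"
      using * by (intro mult_left_mono) auto
    finally show "z * X \<le> (2 * (b - a) / pi)\<^sup>2 * Y" .
  qed
  then show ?thesis by (simp add: X_def Y_def)
qed

text \<open>
  The sample point \<open>x\<close> splits the cell into two intervals of length \<open>\<alpha> / 2\<close>, each with a zero of
  \<open>u - u x\<close> at one end; this halving produces \<open>\<alpha> / \<pi>\<close> instead of \<open>2 \<alpha> / \<pi>\<close>.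
\<close>

lemma wirtinger_cell:
  fixes u u' :: "real \<Rightarrow> complex"
  assumes \<alpha>: "\<alpha> > 0" and der: "\<And>t. (u has_vector_derivative u' t) (at t)"
    and cont: "continuous_on UNIV u'"
  shows "(\<integral>\<^sup>+t\<in>{- (\<alpha> / 2)..\<alpha> / 2}. sq_mod (u (x + t) - u x) \<partial>lborel)
    \<le> ennreal ((\<alpha> / pi)\<^sup>2) * (\<integral>\<^sup>+t\<in>{- (\<alpha> / 2)..\<alpha> / 2}. sq_mod (u' (x + t)) \<partial>lborel)"
proof -
  define L where "L = \<alpha> / 2"
  have L: "L > 0" using \<alpha> by (simp add: L_def)
  define v where "v t = u (x + t) - u x" for t
  define v' where "v' t = u' (x + t)" for t
  have vder: "(v has_vector_derivative v' t) (at t within S)" for t S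
  proof -
    have "((\<lambda>t. x + t) has_vector_derivative 1) (at t)"
      by (auto intro!: derivative_eq_intros)
    from vector_diff_chain_at[OF this der]
    have "((\<lambda>t. u (x + t)) has_vector_derivative u' (x + t)) (at t)"
      by (simp add: o_def)
    then have "(v has_vector_derivative v' t) (at t)"
      unfolding v_def v'_def by (auto intro!: derivative_eq_intros)
    then show ?thesis by (rule has_vector_derivative_at_within)
  qed
  have contv': "continuous_on S v'" for S
    unfolding v'_def by (intro continuous_on_compose2[OF cont] continuous_intros) auto
  have contv: "continuous_on S v" for S
    using vder by (meson continuous_on_eq_continuous_within has_vector_derivative_continuous)
  have i: "(\<lambda>t. (cmod (v t))\<^sup>2) integrable_on {a..b}" "(\<lambda>t. (cmod (v' t))\<^sup>2) integrable_on {a..b}" for a b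
    by (intro integrable_continuous_interval continuous_intros contv contv')+
  have v0: "v 0 = 0" by (simp add: v_def)
  have le1: "integral {-L..0} (\<lambda>t. (cmod (v t))\<^sup>2) \<le> (\<alpha> / pi)\<^sup>2 * integral {-L..0} (\<lambda>t. (cmod (v' t))\<^sup>2)"
    using wirtinger[of "-L" 0 v v'] L vder contv' v0 by (simp add: L_def)
  have le2: "integral {0..L} (\<lambda>t. (cmod (v t))\<^sup>2) \<le> (\<alpha> / pi)\<^sup>2 * integral {0..L} (\<lambda>t. (cmod (v' t))\<^sup>2)"
    using wirtinger[of 0 L v v'] L vder contv' v0 by (simp add: L_def)
  have "integral {-L..L} (\<lambda>t. (cmod (v t))\<^sup>2) = integral {-L..0} (\<lambda>t. (cmod (v t))\<^sup>2) + integral {0..L} (\<lambda>t. (cmod (v t))\<^sup>2)"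
    using L i Henstock_Kurzweil_Integration.integral_combine[of "-L" 0 L "\<lambda>t. (cmod (v t))\<^sup>2"] by simp
  also have "\<dots> \<le> (\<alpha> / pi)\<^sup>2 * (integral {-L..0} (\<lambda>t. (cmod (v' t))\<^sup>2) + integral {0..L} (\<lambda>t. (cmod (v' t))\<^sup>2))"
    using le1 le2 by (simp add: distrib_left)
  also have "integral {-L..0} (\<lambda>t. (cmod (v' t))\<^sup>2) + integral {0..L} (\<lambda>t. (cmod (v' t))\<^sup>2) = integral {-L..L} (\<lambda>t. (cmod (v' t))\<^sup>2)"
    using L i Henstock_Kurzweil_Integration.integral_combine[of "-L" 0 L "\<lambda>t. (cmod (v' t))\<^sup>2"] by simp
  finally have "ennreal (integral {-L..L} (\<lambda>t. (cmod (v t))\<^sup>2)) \<le> ennreal ((\<alpha> / pi)\<^sup>2 * integral {-L..L} (\<lambda>t. (cmod (v' t))\<^sup>2))"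
    by (rule ennreal_leI)
  also have "\<dots> = ennreal ((\<alpha> / pi)\<^sup>2) * ennreal (integral {-L..L} (\<lambda>t. (cmod (v' t))\<^sup>2))"
    by (rule ennreal_mult) (auto intro!: integral_nonneg i)
  finally show ?thesis
    by (subst (asm) (1 2) nn_integral_Icc_continuous[symmetric])
       (auto intro!: continuous_intros contv contv' simp: v_def[symmetric] v'_def[symmetric] L_def[symmetric])
qed

text \<open>
  Wirtinger's inequality needs a derivative, and \<open>g\<close> is only continuous. It is applied to the moving
  averages of \<open>g\<close> over intervals of length \<open>s\<close>: they are continuously differentiable, their derivative
  is the difference quotient of \<open>g\<close>, which the hypothesis bounds uniformly in \<open>s\<close>, and they tend to \<open>g\<close>
  pointwise. Fatou's lemma then transfers the estimate to \<open>g\<close>.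
\<close>

lemma sum_wirtinger_cells:
  fixes g :: "real \<Rightarrow> complex"
  assumes \<alpha>: "\<alpha> > 0" and g: "continuous_on UNIV g"
    and K: "\<And>s. s > 0 \<Longrightarrow> L2_norm_sq (\<lambda>t. g (t + s) - g t) \<le> ennreal (s\<^sup>2) * K"
  shows "(\<integral>\<^sup>+t. (\<integral>\<^sup>+k. sq_mod (g (x + \<alpha> * of_int k + t) - g (x + \<alpha> * of_int k)) \<partial>count_space UNIV)
      * indicator {- (\<alpha> / 2)..\<alpha> / 2} t \<partial>lborel) \<le> ennreal ((\<alpha> / pi)\<^sup>2) * K"
proof -
  have [measurable]: "g \<in> borel_measurable borel"
    using g by (rule borel_measurable_continuous_onI)
  have "\<exists>\<Gamma>. \<forall>t. (\<Gamma> has_vector_derivative g t) (at t)"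
    using einterval_antiderivative[of "-\<infinity>" "\<infinity>" g] g by (auto simp: continuous_on_eq_continuous_at)
  then obtain \<Gamma> where \<Gamma>: "\<And>t. (\<Gamma> has_vector_derivative g t) (at t)" by blast
  have contG: "continuous_on UNIV \<Gamma>"
    using \<Gamma> by (meson continuous_on_eq_continuous_at has_vector_derivative_continuous open_UNIV)
  have [measurable]: "\<Gamma> \<in> borel_measurable borel"
    using contG by (rule borel_measurable_continuous_onI)
  define s where "s n = 1 / real (Suc n)" for n
  have s: "s n > 0" for n by (simp add: s_def)
  define u where "u n t = (\<Gamma> (t + s n) - \<Gamma> t) /\<^sub>R s n" for n t
  define u' where "u' n t = (g (t + s n) - g t) /\<^sub>R s n" for n t
  have [measurable]: "u n \<in> borel_measurable borel" "u' n \<in> borel_measurable borel" for n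
    unfolding u_def u'_def by measurable
  have uder: "(u n has_vector_derivative u' n t) (at t)" for n t
  proof -
    have "((\<lambda>t. t + s n) has_vector_derivative 1) (at t)"
      by (auto intro!: derivative_eq_intros)
    from vector_diff_chain_at[OF this \<Gamma>]
    have "((\<lambda>t. \<Gamma> (t + s n)) has_vector_derivative g (t + s n)) (at t)"
      by (simp add: o_def)
    then show ?thesis
      unfolding u_def u'_def by (auto intro!: derivative_eq_intros \<Gamma>)
  qed
  have contu': "continuous_on UNIV (u' n)" for n
    unfolding u'_def by (intro continuous_intros continuous_on_compose2[OF g]) auto
  have lim: "(\<lambda>n. u n t) \<longlonglongrightarrow> g t" for t
  proof -
    have "((\<lambda>h. (\<Gamma> (t + h) - \<Gamma> t) /\<^sub>R h) \<longlongrightarrow> g t) (at 0)"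
    proof -
      have "((\<lambda>h. norm (\<Gamma> (t + h) - \<Gamma> t - h *\<^sub>R g t) / norm h) \<longlongrightarrow> 0) (at 0)"
        using \<Gamma>[of t] unfolding has_vector_derivative_def has_derivative_at by simp
      moreover have "norm (\<Gamma> (t + h) - \<Gamma> t - h *\<^sub>R g t) / norm h = norm ((\<Gamma> (t + h) - \<Gamma> t) /\<^sub>R h - g t)" if "h \<noteq> 0" for h
      proof -
        have "(\<Gamma> (t + h) - \<Gamma> t) /\<^sub>R h - g t = (\<Gamma> (t + h) - \<Gamma> t - h *\<^sub>R g t) /\<^sub>R h"
          using that by (simp add: scaleR_diff_right)
        then show ?thesis by (simp add: divide_inverse mult.commute)
      qed
      then have "eventually (\<lambda>h. norm (\<Gamma> (t + h) - \<Gamma> t - h *\<^sub>R g t) / norm h = norm ((\<Gamma> (t + h) - \<Gamma> t) /\<^sub>R h - g t)) (at 0)"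
        by (simp add: eventually_at_filter)
      ultimately have "((\<lambda>h. norm ((\<Gamma> (t + h) - \<Gamma> t) /\<^sub>R h - g t)) \<longlongrightarrow> 0) (at 0)"
        by (rule Lim_transform_eventually)
      then show ?thesis
        by (rule LIM_zero_cancel[OF tendsto_norm_zero_cancel])
    qed
    moreover have "filterlim s (at 0) sequentially"
    proof -
      have "s \<longlonglongrightarrow> 0"
        unfolding s_def using LIMSEQ_inverse_real_of_nat by (simp add: inverse_eq_divide)
      moreover have "s n \<noteq> 0" for n
        using s[of n] by simp
      ultimately show ?thesis
        by (simp add: filterlim_at)
    qed
    ultimately show ?thesis
      unfolding u_def by (rule filterlim_compose)
  qed
  let ?I = "\<lambda>t. indicator {- (\<alpha> / 2)..\<alpha> / 2} t :: ennreal"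
  let ?D = "\<lambda>u t k. sq_mod (u (x + \<alpha> * of_int k + t) - u (x + \<alpha> * of_int k))"
  have bound: "(\<integral>\<^sup>+t. (\<integral>\<^sup>+k. ?D (u n) t k \<partial>count_space UNIV) * ?I t \<partial>lborel) \<le> ennreal ((\<alpha> / pi)\<^sup>2) * K" for n
  proof -
    have "(\<integral>\<^sup>+t. (\<integral>\<^sup>+k. ?D (u n) t k \<partial>count_space UNIV) * ?I t \<partial>lborel)
        = (\<integral>\<^sup>+t. (\<integral>\<^sup>+k. ?D (u n) t k * ?I t \<partial>count_space UNIV) \<partial>lborel)"
      by (intro nn_integral_cong) (simp add: nn_integral_multc)
    also have "\<dots> = (\<integral>\<^sup>+k. (\<integral>\<^sup>+t. ?D (u n) t k * ?I t \<partial>lborel) \<partial>count_space UNIV)"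
      by (rule nn_integral_count_space_nn_integral) auto
    also have "\<dots> \<le> (\<integral>\<^sup>+k. ennreal ((\<alpha> / pi)\<^sup>2) * (\<integral>\<^sup>+t. sq_mod (u' n (x + \<alpha> * of_int k + t)) * ?I t \<partial>lborel) \<partial>count_space UNIV)"
      by (intro nn_integral_mono wirtinger_cell \<alpha> uder contu')
    also have "\<dots> = ennreal ((\<alpha> / pi)\<^sup>2) * (\<integral>\<^sup>+k. (\<integral>\<^sup>+t. sq_mod (u' n (x + \<alpha> * of_int k + t)) * ?I t \<partial>lborel) \<partial>count_space UNIV)"
      by (rule nn_integral_cmult) simp
    also have "(\<integral>\<^sup>+k. (\<integral>\<^sup>+t. sq_mod (u' n (x + \<alpha> * of_int k + t)) * ?I t \<partial>lborel) \<partial>count_space UNIV)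
       = (\<integral>\<^sup>+t. (\<integral>\<^sup>+k. sq_mod (u' n (x + \<alpha> * of_int k + t)) * ?I t \<partial>count_space UNIV) \<partial>lborel)"
      by (rule nn_integral_count_space_nn_integral[symmetric]) auto
    also have "\<dots> = (\<integral>\<^sup>+t\<in>{- (\<alpha> / 2).. - (\<alpha> / 2) + \<alpha>}. (\<integral>\<^sup>+k. sq_mod (u' n (x + (t + \<alpha> * of_int k))) \<partial>count_space UNIV) \<partial>lborel)"
      by (intro nn_integral_cong) (simp add: nn_integral_multc add_ac)
    also have "\<dots> = (\<integral>\<^sup>+t. sq_mod (u' n (x + t)) \<partial>lborel)"
      by (rule nn_integral_periodization[symmetric, OF _ \<alpha>]) simp
    also have "\<dots> = (\<integral>\<^sup>+t. sq_mod (u' n t) \<partial>lborel)"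
      using nn_integral_lborel_shift[of "\<lambda>t. sq_mod (u' n t)" x] by (simp add: add.commute)
    also have "\<dots> = (\<integral>\<^sup>+t. ennreal (1 / (s n)\<^sup>2) * sq_mod (g (t + s n) - g t) \<partial>lborel)"
      using s[of n] by (intro nn_integral_cong) (simp add: u'_def ennreal_mult[symmetric] power_mult_distrib power_inverse divide_inverse)
    also have "\<dots> = ennreal (1 / (s n)\<^sup>2) * L2_norm_sq (\<lambda>t. g (t + s n) - g t)"
      unfolding L2_norm_sq_def by (rule nn_integral_cmult) simp
    also have "\<dots> \<le> ennreal (1 / (s n)\<^sup>2) * (ennreal ((s n)\<^sup>2) * K)"
      by (intro mult_left_mono K s) simp
    also have "\<dots> = K"
      using s[of n] by (simp add: mult.assoc[symmetric] ennreal_mult[symmetric])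
    finally show ?thesis by (simp add: mult_left_mono)
  qed
  have "(\<integral>\<^sup>+t. (\<integral>\<^sup>+k. ?D g t k \<partial>count_space UNIV) * ?I t \<partial>lborel)
     \<le> (\<integral>\<^sup>+t. liminf (\<lambda>n. (\<integral>\<^sup>+k. ?D (u n) t k \<partial>count_space UNIV) * ?I t) \<partial>lborel)"
  proof (rule nn_integral_mono)
    fix t
    have "(\<integral>\<^sup>+k. ?D g t k \<partial>count_space UNIV) = (\<integral>\<^sup>+k. liminf (\<lambda>n. ?D (u n) t k) \<partial>count_space UNIV)"
      by (intro nn_integral_cong lim_imp_Liminf[symmetric] tendsto_ennrealI tendsto_intros lim) auto
    also have "\<dots> \<le> liminf (\<lambda>n. \<integral>\<^sup>+k. ?D (u n) t k \<partial>count_space UNIV)"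
      by (rule nn_integral_liminf) simp
    finally show "(\<integral>\<^sup>+k. ?D g t k \<partial>count_space UNIV) * ?I t \<le> liminf (\<lambda>n. (\<integral>\<^sup>+k. ?D (u n) t k \<partial>count_space UNIV) * ?I t)"
      by (cases "t \<in> {- (\<alpha> / 2)..\<alpha> / 2}") auto
  qed
  also have "\<dots> \<le> liminf (\<lambda>n. \<integral>\<^sup>+t. (\<integral>\<^sup>+k. ?D (u n) t k \<partial>count_space UNIV) * ?I t \<partial>lborel)"
    by (rule nn_integral_liminf) simp
  also have "\<dots> \<le> ennreal ((\<alpha> / pi)\<^sup>2) * K"
    by (rule Liminf_le) (auto simp: bound)
  finally show ?thesis .
qed

text \<open>
  By the previous lemma the step function with value \<open>g (x + \<alpha> k)\<close> on the \<open>k\<close>-th cell, whose squared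
  norm is \<open>\<alpha> S\<close>, has distance at most \<open>\<theta> \<parallel>g\<parallel>\<close> from \<open>g\<close>. Both inequalities are the triangle inequality for
  these two functions.
\<close>

lemma sampling_inequality:
  fixes g :: "real \<Rightarrow> complex" and x :: real
  assumes \<alpha>: "\<alpha> > 0" and g: "continuous_on UNIV g" and fin: "L2_norm_sq g < \<infinity>"
    and \<theta>: "0 < \<theta>" "\<theta> < 1"
    and shift: "\<And>s. s > 0 \<Longrightarrow> L2_norm_sq (\<lambda>t. g (t + s) - g t) \<le> ennreal ((s * (pi * \<theta> / \<alpha>))\<^sup>2) * L2_norm_sq g"
  defines "S \<equiv> \<integral>\<^sup>+k. sq_mod (g (x + \<alpha> * of_int k)) \<partial>count_space UNIV"
  shows "ennreal \<alpha> * S \<le> ennreal ((1 + \<theta>)\<^sup>2) * L2_norm_sq g"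
    and "ennreal ((1 - \<theta>)\<^sup>2) * L2_norm_sq g \<le> ennreal \<alpha> * S"
proof -
  have [measurable]: "g \<in> borel_measurable borel"
    using g by (rule borel_measurable_continuous_onI)
  let ?I = "\<lambda>t. indicator {- (\<alpha> / 2)..\<alpha> / 2} t :: ennreal"
  define P where "P t = (\<integral>\<^sup>+k. sq_mod (g (x + \<alpha> * of_int k + t)) \<partial>count_space UNIV)" for t
  define E where "E t = (\<integral>\<^sup>+k. sq_mod (g (x + \<alpha> * of_int k + t) - g (x + \<alpha> * of_int k)) \<partial>count_space UNIV)" for t
  define N where "N = L2_norm_sq g"
  have [measurable]: "P \<in> borel_measurable borel" "E \<in> borel_measurable borel"
    unfolding P_def E_def by measurable
  have PN: "(\<integral>\<^sup>+t. P t * ?I t \<partial>lborel) = N"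
  proof -
    have "(\<integral>\<^sup>+t. P t * ?I t \<partial>lborel) = (\<integral>\<^sup>+t\<in>{- (\<alpha> / 2).. - (\<alpha> / 2) + \<alpha>}. (\<integral>\<^sup>+k. sq_mod (g (x + (t + \<alpha> * of_int k))) \<partial>count_space UNIV) \<partial>lborel)"
      unfolding P_def by (intro nn_integral_cong) (simp add: add_ac)
    also have "\<dots> = (\<integral>\<^sup>+t. sq_mod (g (x + t)) \<partial>lborel)"
      by (rule nn_integral_periodization[symmetric, OF _ \<alpha>]) simp
    also have "\<dots> = N"
      unfolding N_def L2_norm_sq_def
      using nn_integral_lborel_shift[of "\<lambda>t. sq_mod (g t)" x] by (simp add: add.commute)
    finally show ?thesis .
  qed
  have EN: "(\<integral>\<^sup>+t. E t * ?I t \<partial>lborel) \<le> ennreal (\<theta>\<^sup>2) * N"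
  proof -
    have "(\<integral>\<^sup>+t. E t * ?I t \<partial>lborel) \<le> ennreal ((\<alpha> / pi)\<^sup>2) * (ennreal ((pi * \<theta> / \<alpha>)\<^sup>2) * N)"
      unfolding E_def
    proof (rule sum_wirtinger_cells[OF \<alpha> g])
      fix s :: real assume "s > 0"
      then show "L2_norm_sq (\<lambda>t. g (t + s) - g t) \<le> ennreal (s\<^sup>2) * (ennreal ((pi * \<theta> / \<alpha>)\<^sup>2) * N)"
        using shift[of s] by (simp add: N_def mult.assoc[symmetric] ennreal_mult[symmetric] power_mult_distrib power_divide)
    qed
    also have "\<dots> = ennreal (\<theta>\<^sup>2) * N"
      using \<alpha> by (simp add: mult.assoc[symmetric] ennreal_mult[symmetric] power_mult_distrib power_divide)
    finally show ?thesis .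
  qed
  have SI: "(\<integral>\<^sup>+t. S * ?I t \<partial>lborel) = ennreal \<alpha> * S"
    using \<alpha> by (simp add: nn_integral_cmult mult.commute)
  have up: "ennreal \<alpha> * S \<le> ennreal (1 + \<eta>) * N + ennreal (1 + 1 / \<eta>) * (ennreal (\<theta>\<^sup>2) * N)" if "\<eta> > 0" for \<eta>
  proof -
    have "S \<le> ennreal (1 + \<eta>) * P t + ennreal (1 + 1 / \<eta>) * E t" for t
      using nn_integral_norm_sq_le[OF _ _ that, of "\<lambda>k::int. g (x + \<alpha> * of_int k)" "count_space UNIV" "\<lambda>k. g (x + \<alpha> * of_int k + t)"]
      unfolding S_def P_def E_def by (simp add: norm_minus_commute)
    then have "(\<integral>\<^sup>+t. S * ?I t \<partial>lborel) \<le> (\<integral>\<^sup>+t. ennreal (1 + \<eta>) * (P t * ?I t) + ennreal (1 + 1 / \<eta>) * (E t * ?I t) \<partial>lborel)"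
      by (intro nn_integral_mono) (auto simp: indicator_def)
    also have "\<dots> = ennreal (1 + \<eta>) * N + ennreal (1 + 1 / \<eta>) * (\<integral>\<^sup>+t. E t * ?I t \<partial>lborel)"
      by (simp add: nn_integral_add nn_integral_cmult PN)
    also have "\<dots> \<le> ennreal (1 + \<eta>) * N + ennreal (1 + 1 / \<eta>) * (ennreal (\<theta>\<^sup>2) * N)"
      by (intro add_left_mono mult_left_mono EN) simp
    finally show ?thesis unfolding SI .
  qed
  have lo: "N \<le> ennreal (1 + \<eta>) * (ennreal \<alpha> * S) + ennreal (1 + 1 / \<eta>) * (ennreal (\<theta>\<^sup>2) * N)" if "\<eta> > 0" for \<eta>
  proof -
    have "P t \<le> ennreal (1 + \<eta>) * S + ennreal (1 + 1 / \<eta>) * E t" for t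
      using nn_integral_norm_sq_le[OF _ _ that, of "\<lambda>k::int. g (x + \<alpha> * of_int k + t)" "count_space UNIV" "\<lambda>k. g (x + \<alpha> * of_int k)"]
      unfolding S_def P_def E_def by simp
    then have "(\<integral>\<^sup>+t. P t * ?I t \<partial>lborel) \<le> (\<integral>\<^sup>+t. ennreal (1 + \<eta>) * (S * ?I t) + ennreal (1 + 1 / \<eta>) * (E t * ?I t) \<partial>lborel)"
      by (intro nn_integral_mono) (auto simp: indicator_def)
    also have "\<dots> = ennreal (1 + \<eta>) * (\<integral>\<^sup>+t. S * ?I t \<partial>lborel) + ennreal (1 + 1 / \<eta>) * (\<integral>\<^sup>+t. E t * ?I t \<partial>lborel)"
      by (simp add: nn_integral_add nn_integral_cmult)
    also have "\<dots> \<le> ennreal (1 + \<eta>) * (ennreal \<alpha> * S) + ennreal (1 + 1 / \<eta>) * (ennreal (\<theta>\<^sup>2) * N)"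
      unfolding SI by (intro add_left_mono mult_left_mono EN) simp
    finally show ?thesis unfolding PN .
  qed
  obtain n where n: "N = ennreal n" "n \<ge> 0"
    using fin by (cases N) (auto simp: N_def)
  (* The optimal parameter for the upper bound is \<theta>. *)
  have "ennreal \<alpha> * S \<le> ennreal (1 + \<theta>) * N + ennreal (1 + 1 / \<theta>) * (ennreal (\<theta>\<^sup>2) * N)"
    by (rule up[OF \<theta>(1)])
  also have "\<dots> = ennreal ((1 + \<theta>) * n + (1 + 1 / \<theta>) * (\<theta>\<^sup>2 * n))"
    using \<theta> n by (simp add: ennreal_mult ennreal_plus)
  also have "(1 + \<theta>) * n + (1 + 1 / \<theta>) * (\<theta>\<^sup>2 * n) = (1 + \<theta>)\<^sup>2 * n"
    using \<theta> by (simp add: field_simps power2_eq_square)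
  finally show "ennreal \<alpha> * S \<le> ennreal ((1 + \<theta>)\<^sup>2) * L2_norm_sq g"
    using n by (simp add: ennreal_mult N_def)
  show "ennreal ((1 - \<theta>)\<^sup>2) * L2_norm_sq g \<le> ennreal \<alpha> * S"
  proof (cases "ennreal \<alpha> * S")
    case (real q)
    (* The optimal parameter for the lower bound. *)
    define \<eta> where "\<eta> = \<theta> / (1 - \<theta>)"
    have \<eta>: "\<eta> > 0" "1 + \<eta> = 1 / (1 - \<theta>)" "1 + 1 / \<eta> = 1 / \<theta>"
      using \<theta> by (auto simp: \<eta>_def field_simps)
    have "N \<le> ennreal (1 / (1 - \<theta>)) * ennreal q + ennreal (1 / \<theta>) * (ennreal (\<theta>\<^sup>2) * N)"
      using lo[OF \<eta>(1)] unfolding \<eta>(2,3) real by simp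
    also have "\<dots> = ennreal (1 / (1 - \<theta>) * q + 1 / \<theta> * (\<theta>\<^sup>2 * n))"
      using \<theta> n real by (simp only: n(1)) (simp add: ennreal_mult[symmetric] ennreal_plus[symmetric] del: ennreal_plus)
    finally have "n \<le> 1 / (1 - \<theta>) * q + 1 / \<theta> * (\<theta>\<^sup>2 * n)"
      using n \<theta> real by (subst (asm) n(1), subst (asm) ennreal_le_iff) auto
    then have "(1 - \<theta>) * n \<le> q / (1 - \<theta>)"
      using \<theta> by (simp add: field_simps power2_eq_square)
    then have "(1 - \<theta>) * ((1 - \<theta>) * n) \<le> q"
      using \<theta> by (simp add: field_simps)
    then show ?thesis
      using n real by (simp add: N_def[symmetric] ennreal_mult[symmetric] power2_eq_square mult.assoc)
  qed simp
qed

section \<open>Trigonometric polynomials and Parseval on an interval\<close>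

text \<open>
  The variable is an angle, so that the closure properties can be stated without a period;
  \<open>trig_poly_dense\<close> rescales to an interval \<open>[0, L]\<close>.
\<close>

definition trig_poly :: "(real \<Rightarrow> complex) \<Rightarrow> bool" where
  "trig_poly p \<longleftrightarrow> (\<exists>(F::int set) c. finite F \<and> (\<forall>t. p t = (\<Sum>m\<in>F. c m * cis (of_int m * t))))"

lemma trig_poly_zero: "trig_poly (\<lambda>t. 0)"
  unfolding trig_poly_def by (rule exI[of _ "{}"]) simp

lemma trig_poly_add:
  assumes "trig_poly p" "trig_poly q"
  shows "trig_poly (\<lambda>t. p t + q t)"
proof -
  obtain F c where F: "finite F" "\<And>t. p t = (\<Sum>m\<in>F. c m * cis (of_int m * t))"
    using assms(1) by (auto simp: trig_poly_def)
  obtain G d where G: "finite G" "\<And>t. q t = (\<Sum>m\<in>G. d m * cis (of_int m * t))"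
    using assms(2) by (auto simp: trig_poly_def)
  let ?b = "\<lambda>m. (if m \<in> F then c m else 0) + (if m \<in> G then d m else 0)"
  have "p t + q t = (\<Sum>m\<in>F \<union> G. ?b m * cis (of_int m * t))" for t
  proof -
    have "p t = (\<Sum>m\<in>F \<union> G. (if m \<in> F then c m else 0) * cis (of_int m * t))"
      unfolding F(2) using F(1) G(1) by (intro sum.mono_neutral_cong_left) auto
    moreover have "q t = (\<Sum>m\<in>F \<union> G. (if m \<in> G then d m else 0) * cis (of_int m * t))"
      unfolding G(2) using F(1) G(1) by (intro sum.mono_neutral_cong_left) auto
    ultimately show ?thesis
      by (simp add: sum.distrib[symmetric] distrib_right)
  qed
  then show ?thesis
    unfolding trig_poly_def using F(1) G(1) by (intro exI[of _ "F \<union> G"] exI[of _ ?b]) auto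
qed

lemma trig_poly_monom_mult:
  assumes "trig_poly q"
  shows "trig_poly (\<lambda>t. a * cis (of_int n * t) * q t)"
proof -
  obtain G d where G: "finite G" "\<And>t. q t = (\<Sum>m\<in>G. d m * cis (of_int m * t))"
    using assms by (auto simp: trig_poly_def)
  have "a * cis (of_int n * t) * q t = (\<Sum>m\<in>(+) n ` G. (a * d (m - n)) * cis (of_int m * t))" for t
    unfolding G(2) sum_distrib_left
    by (subst sum.reindex) (auto intro!: inj_onI sum.cong simp: cis_mult[symmetric] algebra_simps)
  then show ?thesis
    unfolding trig_poly_def using G(1) by (intro exI[of _ "(+) n ` G"] exI[of _ "\<lambda>m. a * d (m - n)"]) auto
qed

lemma trig_poly_monom: "trig_poly (\<lambda>t. a * cis (of_int n * t))"
  unfolding trig_poly_def by (rule exI[of _ "{n}"], rule exI[of _ "\<lambda>_. a"]) simp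

lemma trig_poly_sum:
  assumes "finite A" "\<And>i. i \<in> A \<Longrightarrow> trig_poly (p i)"
  shows "trig_poly (\<lambda>t. \<Sum>i\<in>A. p i t)"
  using assms by (induction A) (auto intro: trig_poly_zero trig_poly_add)

lemma trig_poly_mult:
  assumes "trig_poly p" "trig_poly q"
  shows "trig_poly (\<lambda>t. p t * q t)"
proof -
  obtain F c where F: "finite F" "\<And>t. p t = (\<Sum>m\<in>F. c m * cis (of_int m * t))"
    using assms(1) by (auto simp: trig_poly_def)
  show ?thesis
    unfolding F(2) sum_distrib_right
    by (intro trig_poly_sum F(1) trig_poly_monom_mult assms(2))
qed

text \<open>
  A real-linear functional of \<open>cis t\<close> is a combination of \<open>cis t\<close> and \<open>cis (- t)\<close>; sums and products
  stay trigonometric polynomials.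
\<close>

lemma trig_poly_real_polynomial_function:
  fixes q :: "complex \<Rightarrow> real"
  assumes "real_polynomial_function q"
  shows "trig_poly (\<lambda>t. complex_of_real (q (cis t)))"
  using assms
proof (induction rule: real_polynomial_function.induct)
  case (linear f)
  have "complex_of_real (f (cis t)) = ((f 1 - \<i> * f \<i>) / 2) * cis (of_int 1 * t) + ((f 1 + \<i> * f \<i>) / 2) * cis (of_int (-1) * t)" for t
  proof -
    have "cis t = cos t *\<^sub>R 1 + sin t *\<^sub>R \<i>" by (simp add: complex_eq_iff)
    then have "f (cis t) = cos t * f 1 + sin t * f \<i>"
      using linear by (simp add: linear_simps)
    then show ?thesis
      by (simp add: complex_eq_iff field_simps)
  qed
  then show ?case
    using trig_poly_add[OF trig_poly_monom trig_poly_monom] by presburger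
next
  case (const c)
  show ?case using trig_poly_monom[of "of_real c" 0] by simp
qed (simp_all add: trig_poly_add trig_poly_mult)

text \<open>
  Equal values at the endpoints let \<open>v\<close> descend to a continuous function on the unit circle, where the
  Stone-Weierstrass theorem applies.
\<close>

lemma trig_poly_dense:
  fixes v :: "real \<Rightarrow> complex"
  assumes L: "L > 0" and v: "continuous_on {0..L} v" "v 0 = v L" and e: "e > 0"
  obtains F :: "int set" and c where "finite F"
    "\<And>x. x \<in> {0..L} \<Longrightarrow> cmod (v x - (trig_sum F c L x)) < e"
proof -
  define p where "p t = v (L * t)" for t
  have "path p"
    unfolding path_def p_def using L
    by (intro continuous_on_compose2[OF v(1)] continuous_intros) (auto simp: mult_left_le)
  then have "homotopic_loops UNIV p p"
    using v(2) by (simp add: homotopic_loops_refl pathfinish_def pathstart_def p_def)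
  then have "continuous_on (sphere 0 1) (p \<circ> (\<lambda>z. Arg2pi z / (2 * pi)))"
    using homotopic_loops_imp_homotopic_circlemaps homotopic_with_imp_continuous by blast
  then obtain g where g: "polynomial_function g"
      "\<And>z. z \<in> sphere 0 1 \<Longrightarrow> cmod (p (Arg2pi z / (2 * pi)) - g z) < e"
    using Stone_Weierstrass_polynomial_function[OF compact_sphere _ e, of 0 1 "p \<circ> (\<lambda>z. Arg2pi z / (2 * pi))"]
    unfolding o_def by blast
  have "trig_poly (\<lambda>t. complex_of_real (Re (g (cis t))) + \<i> * complex_of_real (Im (g (cis t))))"
  proof -
    have "real_polynomial_function (Re \<circ> g)" "real_polynomial_function (Im \<circ> g)"
      using g(1) by (auto simp: polynomial_function_def bounded_linear_Re bounded_linear_Im)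
    from this[THEN trig_poly_real_polynomial_function] show ?thesis
      using trig_poly_add trig_poly_monom_mult[of _ \<i> 0] by (simp add: o_def)
  qed
  then have "trig_poly (\<lambda>t. g (cis t))"
    by (simp add: complex_eq[symmetric])
  then obtain F c where F: "finite F" "\<And>t. g (cis t) = (\<Sum>m\<in>F. c m * cis (of_int m * t))"
    by (auto simp: trig_poly_def)
  have "cmod (v x - (trig_sum F c L x)) < e" if x: "x \<in> {0..L}" for x
  proof -
    let ?z = "cis (2 * pi * x / L)"
    have "p (Arg2pi ?z / (2 * pi)) = v x"
    proof (cases "x = L")
      case True
      then have "?z = 1" using L by (simp add: complex_eq_iff)
      moreover have "Arg2pi 1 = 0" by (simp add: Arg2pi_eq_0)
      ultimately show ?thesis using v(2) True by (simp add: p_def)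
    next
      case False
      then have "2 * pi * x / L < 2 * pi" "0 \<le> 2 * pi * x / L" using x L by (auto simp: field_simps)
      then have "Arg2pi ?z = 2 * pi * x / L"
        by (intro Arg2pi_unique[of 1]) (simp_all only: cis_conv_exp, simp_all)
      then show ?thesis using L by (simp add: p_def)
    qed
    moreover have "cmod (p (Arg2pi ?z / (2 * pi)) - g ?z) < e"
      by (rule g(2)) simp
    ultimately show ?thesis
      by (simp add: F(2) mult.assoc mult.left_commute)
  qed
  with F(1) show ?thesis by (rule that)
qed

lemma integral_cis_period:
  assumes "L > 0"
  shows "((\<lambda>x. cis (2 * pi * of_int m * x / L)) has_integral (if m = 0 then of_real L else 0)) {0..L}"
proof (cases "m = 0")
  case True
  then show ?thesis using has_integral_const_real[of "1::complex" 0 L] assms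
    by (simp add: scaleR_conv_of_real)
next
  case False
  define a where "a = 2 * pi * of_int m / L"
  have a: "a \<noteq> 0" using False assms by (simp add: a_def)
  have "((\<lambda>x. cis (a * x)) has_integral (cis (a * L) / (\<i> * a) - cis (a * 0) / (\<i> * a))) {0..L}"
  proof (rule fundamental_theorem_of_calculus)
    show "0 \<le> L" using assms by simp
    fix x assume "x \<in> {0..L}"
    have "((\<lambda>z. exp (\<i> * a * z) / (\<i> * a)) has_field_derivative exp (\<i> * a * of_real x)) (at (of_real x))"
      using a by (auto intro!: derivative_eq_intros)
    from has_vector_derivative_real_field[OF this]
    show "((\<lambda>x. cis (a * x) / (\<i> * a)) has_vector_derivative cis (a * x)) (at x within {0..L})"
      by (simp add: cis_conv_exp mult.assoc)
  qed
  moreover have "cis (a * L) = 1"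
  proof -
    have "a * L = 2 * pi * of_int m" using assms by (simp add: a_def)
    then show ?thesis using cis_multiple_2pi[of "of_int m"] by (simp add: complex_eq_iff)
  qed
  moreover have "a * x = 2 * pi * of_int m * x / L" for x by (simp add: a_def)
  ultimately show ?thesis using False by simp
qed

text \<open>
  Completing the square in the orthogonal system. The choice \<open>d m = C m / L\<close> gives Bessel's inequality,
  and dense trigonometric polynomials give the converse.
\<close>

lemma integral_norm_sq_minus_trig_poly:
  fixes P :: "real \<Rightarrow> complex" and F :: "int set"
  assumes L: "L > 0" and P: "continuous_on {0..L} P" and F: "finite F"
  defines "C \<equiv> \<lambda>m. integral {0..L} (\<lambda>x. P x * cis (- (2 * pi * of_int m * x / L)))"
  shows "integral {0..L} (\<lambda>x. (cmod (P x - (trig_sum F d L x)))\<^sup>2)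
    = integral {0..L} (\<lambda>x. (cmod (P x))\<^sup>2) + (\<Sum>m\<in>F. L * (cmod (d m - C m / L))\<^sup>2 - (cmod (C m))\<^sup>2 / L)"
proof -
  define E where "E m x = cis (2 * pi * of_int m * x / L)" for m :: int and x
  have contE: "continuous_on A (E m)" for A m
    unfolding E_def using L by (intro continuous_intros) auto
  have E': "cis (- (2 * pi * of_int m * x / L)) = cnj (E m x)" for m x by (simp add: E_def cis_cnj)
  have C: "((\<lambda>x. P x * cnj (E m x)) has_integral C m) {0..L}" for m
    unfolding C_def E' by (intro integrable_integral integrable_continuous_interval continuous_intros contE P)
  have C': "((\<lambda>x. cnj (P x) * E m x) has_integral cnj (C m)) {0..L}" for m
    using has_integral_linear[OF C bounded_linear_cnj, of m] by (simp add: o_def)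
  have EE: "((\<lambda>x. E m x * cnj (E n x)) has_integral (if m = n then of_real L else 0)) {0..L}" for m n
  proof -
    have "E m x * cnj (E n x) = cis (2 * pi * of_int (m - n) * x / L)" for x
      unfolding E_def cis_cnj cis_mult by (simp add: algebra_simps diff_divide_distrib)
    then show ?thesis using integral_cis_period[OF L, of "m - n"] by simp
  qed
  have PP: "((\<lambda>x. complex_of_real ((cmod (P x))\<^sup>2)) has_integral of_real (integral {0..L} (\<lambda>x. (cmod (P x))\<^sup>2))) {0..L}"
    by (intro has_integral_of_real integrable_integral integrable_continuous_interval continuous_intros P)
  have "((\<lambda>x. complex_of_real ((cmod (P x))\<^sup>2) - (\<Sum>m\<in>F. cnj (d m) * (P x * cnj (E m x))) - (\<Sum>m\<in>F. d m * (cnj (P x) * E m x))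
      + (\<Sum>m\<in>F. \<Sum>n\<in>F. d m * cnj (d n) * (E m x * cnj (E n x)))) has_integral
     (of_real (integral {0..L} (\<lambda>x. (cmod (P x))\<^sup>2)) - (\<Sum>m\<in>F. cnj (d m) * C m) - (\<Sum>m\<in>F. d m * cnj (C m))
      + (\<Sum>m\<in>F. \<Sum>n\<in>F. d m * cnj (d n) * (if m = n then of_real L else 0)))) {0..L}"
    (is "(?f has_integral ?I) _")
    by (intro has_integral_add has_integral_diff has_integral_sum has_integral_mult_right F C C' EE PP)
  moreover have "?f x = complex_of_real ((cmod (P x - (\<Sum>m\<in>F. d m * E m x)))\<^sup>2)" for x
    unfolding complex_norm_square complex_cnj_diff complex_cnj_mult cnj_sum
    by (simp add: algebra_simps sum_distrib_left sum_distrib_right sum_product) (rule sum.swap)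
  ultimately have "((\<lambda>x. complex_of_real ((cmod (P x - (\<Sum>m\<in>F. d m * E m x)))\<^sup>2)) has_integral ?I) {0..L}"
    by simp
  from has_integral_linear[OF this bounded_linear_Re]
  have "integral {0..L} (\<lambda>x. (cmod (P x - (\<Sum>m\<in>F. d m * E m x)))\<^sup>2) = Re ?I"
    by (simp add: o_def integral_unique)
  also have "?I = of_real (integral {0..L} (\<lambda>x. (cmod (P x))\<^sup>2)) + (\<Sum>m\<in>F. of_real (L * (cmod (d m - C m / L))\<^sup>2 - (cmod (C m))\<^sup>2 / L))"
  proof -
    have "(\<Sum>m\<in>F. \<Sum>n\<in>F. d m * cnj (d n) * (if m = n then of_real L else 0)) = (\<Sum>m\<in>F. d m * cnj (d m) * of_real L)"
      by (intro sum.cong refl) (simp add: F if_distrib cong: if_cong)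
    moreover have "complex_of_real (L * (cmod (d m - C m / L))\<^sup>2 - (cmod (C m))\<^sup>2 / L)
        = d m * cnj (d m) * of_real L - cnj (d m) * C m - d m * cnj (C m)" for m
      using L unfolding of_real_diff of_real_mult of_real_divide complex_norm_square
      by (simp add: field_simps)
    ultimately show ?thesis
      by (simp add: sum_subtractf)
  qed
  finally show ?thesis
    unfolding E_def by simp
qed

lemma parseval_interval:
  fixes P :: "real \<Rightarrow> complex"
  assumes L: "L > 0" and P: "continuous_on {0..L} P" and per: "P 0 = P L"
  shows "(\<integral>\<^sup>+m. sq_mod (integral {0..L} (\<lambda>x. P x * cis (- (2 * pi * of_int m * x / L)))) \<partial>count_space (UNIV :: int set))
    = ennreal L * (\<integral>\<^sup>+x\<in>{0..L}. sq_mod (P x) \<partial>lborel)"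
proof -
  define C where "C m = integral {0..L} (\<lambda>x. P x * cis (- (2 * pi * of_int m * x / L)))" for m :: int
  define I where "I = integral {0..L} (\<lambda>x. (cmod (P x))\<^sup>2)"
  note id = integral_norm_sq_minus_trig_poly[OF L P, folded C_def I_def]
  have I0: "I \<ge> 0" unfolding I_def by (intro integral_nonneg integrable_continuous_interval continuous_intros P) auto
  have ub: "(\<Sum>m\<in>F. (cmod (C m))\<^sup>2) \<le> L * I" if F: "finite F" for F
  proof -
    have "0 \<le> integral {0..L} (\<lambda>x. (cmod (P x - (\<Sum>m\<in>F. (C m / L) * cis (2 * pi * of_int m * x / L))))\<^sup>2)"
      using L by (intro integral_nonneg integrable_continuous_interval continuous_intros P) auto
    also have "\<dots> = I - (\<Sum>m\<in>F. (cmod (C m))\<^sup>2) / L"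
      by (subst id[OF F]) (simp add: sum_negf sum_divide_distrib)
    finally show ?thesis using L by (simp add: field_simps)
  qed
  have lb: "\<exists>F. finite F \<and> L * I - L * (L * e\<^sup>2) \<le> (\<Sum>m\<in>F. (cmod (C m))\<^sup>2)" if e: "e > 0" for e
  proof -
    obtain F d where F: "finite F" "\<And>x. x \<in> {0..L} \<Longrightarrow> cmod (P x - (trig_sum F d L x)) < e"
      using trig_poly_dense[OF L P per e] by blast
    have "I - (\<Sum>m\<in>F. (cmod (C m))\<^sup>2) / L \<le> I + (\<Sum>m\<in>F. L * (cmod (d m - C m / L))\<^sup>2 - (cmod (C m))\<^sup>2 / L)"
      using L by (simp add: sum_subtractf sum_divide_distrib sum_nonneg)
    also have "\<dots> = integral {0..L} (\<lambda>x. (cmod (P x - (trig_sum F d L x)))\<^sup>2)"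
      by (rule id[OF F(1), symmetric])
    also have "\<dots> \<le> integral {0..L} (\<lambda>x. e\<^sup>2)"
    proof (rule integral_le)
      show "(\<lambda>x. (cmod (P x - (trig_sum F d L x)))\<^sup>2) integrable_on {0..L}"
        using L by (intro integrable_continuous_interval continuous_intros P) auto
      show "(cmod (P x - (trig_sum F d L x)))\<^sup>2 \<le> e\<^sup>2" if "x \<in> {0..L}" for x
        using F(2)[OF that] by (intro power_mono) auto
    qed auto
    also have "\<dots> = L * e\<^sup>2" using L by simp
    finally have "L * (I - (\<Sum>m\<in>F. (cmod (C m))\<^sup>2) / L) \<le> L * (L * e\<^sup>2)"
      using L by (intro mult_left_mono) auto
    then show ?thesis using F(1) L by (intro exI[of _ F]) (simp add: algebra_simps)
  qed
  have "(\<integral>\<^sup>+m. sq_mod (C m) \<partial>count_space UNIV) = ennreal (L * I)"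
  proof (rule antisym)
    show "(\<integral>\<^sup>+m. sq_mod (C m) \<partial>count_space UNIV) \<le> ennreal (L * I)"
      unfolding infsum_ennreal_eq_nn_integral[symmetric]
      by (subst nonneg_infsum_complete) (auto intro!: SUP_least ennreal_leI ub)
    show "ennreal (L * I) \<le> (\<integral>\<^sup>+m. sq_mod (C m) \<partial>count_space UNIV)"
    proof (rule ennreal_le_epsilon)
      fix \<epsilon> :: real assume \<epsilon>: "\<epsilon> > 0"
      define e where "e = sqrt (\<epsilon> / (L * L))"
      have e: "e > 0" "L * (L * e\<^sup>2) = \<epsilon>" using \<epsilon> L by (auto simp: e_def)
      obtain F where F: "finite F" "L * I - L * (L * e\<^sup>2) \<le> (\<Sum>m\<in>F. (cmod (C m))\<^sup>2)"
        using lb[OF e(1)] by blast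
      have "ennreal (L * I) \<le> ennreal ((\<Sum>m\<in>F. (cmod (C m))\<^sup>2) + \<epsilon>)"
        using F(2) e by (intro ennreal_leI) simp
      also have "\<dots> = (\<Sum>m\<in>F. sq_mod (C m)) + ennreal \<epsilon>"
        using \<epsilon> by (simp add: ennreal_plus sum_nonneg)
      also have "(\<Sum>m\<in>F. sq_mod (C m)) \<le> (\<integral>\<^sup>+m. sq_mod (C m) \<partial>count_space UNIV)"
        unfolding infsum_ennreal_eq_nn_integral[symmetric] using F(1)
        by (subst nonneg_infsum_complete) (auto intro!: SUP_upper)
      finally show "ennreal (L * I) \<le> (\<integral>\<^sup>+m. sq_mod (C m) \<partial>count_space UNIV) + ennreal \<epsilon>"
        by (simp add: add_right_mono)
    qed
  qed
  also have "\<dots> = ennreal L * (\<integral>\<^sup>+x\<in>{0..L}. sq_mod (P x) \<partial>lborel)"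
    using L I0 by (subst nn_integral_Icc_continuous) (auto intro!: continuous_intros P simp: I_def ennreal_mult)
  finally show ?thesis by (simp add: C_def)
qed

lemma trig_poly_norm_sq:
  fixes F :: "int set"
  assumes L: "L > 0" and F: "finite F"
  shows "(\<integral>\<^sup>+x\<in>{0..L}. sq_mod (trig_sum F d L x) \<partial>lborel)
    = ennreal (L * (\<Sum>m\<in>F. (cmod (d m))\<^sup>2))"
  using L integral_norm_sq_minus_trig_poly[OF L _ F, of "\<lambda>_. 0" d]
  by (subst nn_integral_Icc_continuous) (auto intro!: continuous_intros simp: sum_distrib_left)

section \<open>Approximation by continuous functions\<close>

text \<open>
  Lebesgue measurable functions are almost everywhere limits of continuous ones; composing these with
  the radial retraction onto the disc of radius \<open>C\<close> preserves the limit and makes them dominated.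
\<close>

lemma bounded_measurable_approx:
  fixes f :: "real \<Rightarrow> complex"
  assumes f: "f \<in> borel_measurable borel" and C: "C > 0" "\<And>x. cmod (f x) \<le> C"
  obtains g :: "nat \<Rightarrow> real \<Rightarrow> complex" where "\<And>k. continuous_on UNIV (g k)" "\<And>k x. cmod (g k x) \<le> C"
    "AE x in lborel. (\<lambda>k. g k x) \<longlonglongrightarrow> f x"
proof -
  have "f measurable_on UNIV"
    using f by (intro lebesgue_measurable_imp_measurable_on) (auto intro: measurable_completion)
  then obtain N h where N: "negligible N" and h: "\<And>k. continuous_on UNIV (h k)"
      "\<And>x. x \<notin> N \<Longrightarrow> (\<lambda>k. h k x :: complex) \<longlonglongrightarrow> f x"
    unfolding measurable_on_def by auto
  define cl where "cl z = (C / max C (cmod z)) *\<^sub>R z" for z :: complex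
  have max0: "max C (cmod z) \<noteq> 0" for z using C by auto
  have cl_cont: "continuous_on UNIV cl"
    unfolding cl_def using max0 by (intro continuous_intros) auto
  have cl_bound: "cmod (cl z) \<le> C" for z
  proof -
    have "cmod (cl z) = C * (cmod z / max C (cmod z))"
      using C by (simp add: cl_def)
    also have "\<dots> \<le> C * 1"
      using C by (intro mult_left_mono) (auto simp: divide_le_eq)
    finally show ?thesis by simp
  qed
  have cl_id: "cl z = z" if "cmod z \<le> C" for z
    using that C by (simp add: cl_def max_def)
  show ?thesis
  proof (rule that[of "\<lambda>k x. cl (h k x)"])
    show "continuous_on UNIV (\<lambda>x. cl (h k x))" for k
      by (rule continuous_on_compose2[OF cl_cont h(1)]) auto
    show "cmod (cl (h k x)) \<le> C" for k x by (rule cl_bound)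
    have "(\<lambda>k. cl (h k x)) \<longlonglongrightarrow> f x" if "x \<notin> N" for x
    proof -
      have "(\<lambda>k. cl (h k x)) \<longlonglongrightarrow> cl (f x)"
        by (rule continuous_on_tendsto_compose[OF cl_cont h(2)[OF that]]) auto
      then show ?thesis by (simp add: cl_id C)
    qed
    moreover have "AE x in lborel. x \<notin> N"
    proof -
      have "AE x in lebesgue. x \<notin> N"
        using N by (intro AE_not_in) (simp add: negligible_iff_null_sets)
      then show ?thesis by (simp add: AE_completion_iff)
    qed
    ultimately show "AE x in lborel. (\<lambda>k. cl (h k x)) \<longlonglongrightarrow> f x"
      by (auto elim: eventually_mono)
  qed
qed

lemma L2_dominated_tendsto:
  fixes u :: "nat \<Rightarrow> real \<Rightarrow> complex"
  assumes [measurable]: "\<And>n. u n \<in> borel_measurable borel"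
    and lim: "AE x in lborel. (\<lambda>n. u n x) \<longlonglongrightarrow> 0"
    and dom: "\<And>n x. cmod (u n x) \<le> cmod (w x)" and w: "L2_norm_sq w < \<infinity>" "w \<in> borel_measurable borel"
  shows "(\<lambda>n. L2_norm_sq (u n)) \<longlonglongrightarrow> 0"
proof -
  note [measurable] = w(2)
  have "(\<lambda>n. \<integral>\<^sup>+x. sq_mod (u n x) \<partial>lborel) \<longlonglongrightarrow> (\<integral>\<^sup>+x. 0 \<partial>(lborel :: real measure))"
  proof (rule nn_integral_dominated_convergence[where w="\<lambda>x. sq_mod (w x)"])
    show "AE x in lborel. (\<lambda>n. sq_mod (u n x)) \<longlonglongrightarrow> 0"
      using lim
    proof eventually_elim
      case (elim x)
      have "(\<lambda>n. (cmod (u n x))\<^sup>2) \<longlonglongrightarrow> (cmod 0)\<^sup>2"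
        by (intro tendsto_intros elim)
      from tendsto_ennrealI[OF this] show ?case by simp
    qed
    show "(\<integral>\<^sup>+x. sq_mod (w x) \<partial>lborel) < \<infinity>"
      using w(1) by (simp add: L2_norm_sq_def)
  qed (auto intro!: AE_I2 ennreal_leI power_mono dom)
  then show ?thesis by (simp add: L2_norm_sq_def)
qed

lemma L2_norm_sq_cutoff_const:
  "L2_norm_sq (\<lambda>x. of_real c * indicator {-R..R} x) < \<infinity>"
proof -
  have "L2_norm_sq (\<lambda>x. of_real c * indicator {-R..R} x) = (\<integral>\<^sup>+x\<in>{-R..R}. ennreal (c\<^sup>2) \<partial>lborel)"
    unfolding L2_norm_sq_def by (intro nn_integral_cong) (auto simp: indicator_def norm_mult)
  also have "\<dots> = ennreal (c\<^sup>2) * emeasure lborel {-R..R}"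
    by (rule nn_integral_cmult_indicator) simp
  also have "\<dots> < \<infinity>" by (simp add: emeasure_lborel_Icc_eq ennreal_mult_less_top)
  finally show ?thesis .
qed

lemma L2_norm_sq_triangle:
  assumes [measurable]: "f \<in> borel_measurable borel" "g \<in> borel_measurable borel" "h \<in> borel_measurable borel"
  shows "L2_dist_sq f h \<le> 2 * L2_dist_sq f g + 2 * L2_dist_sq g h"
proof -
  have "L2_dist_sq f h \<le> ennreal (1 + 1) * L2_dist_sq f g + ennreal (1 + 1 / 1) * L2_norm_sq (\<lambda>x. (f x - h x) - (f x - g x))"
    unfolding L2_norm_sq_def by (rule nn_integral_norm_sq_le) auto
  then show ?thesis by (simp add: algebra_simps)
qed

lemma tendsto_zero_less:
  fixes X :: "nat \<Rightarrow> ennreal"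
  assumes "X \<longlonglongrightarrow> 0" "d > 0"
  shows "\<exists>n. X n < d"
  using order_tendstoD(2)[OF assms] unfolding eventually_sequentially by blast

text \<open>
  Truncation in domain and range reduces to a bounded \<open>f\<close> that vanishes off a compact interval. A
  continuous cutoff equal to one on that interval leaves the limit of the continuous approximants
  unchanged and gives them a common compact support.
\<close>

lemma L2_dense_compact_support_eps:
  assumes f: "f \<in> L2_space" and e: "(e::ennreal) > 0"
  obtains u R where "continuous_on UNIV u" "\<And>x. \<bar>x\<bar> > R \<Longrightarrow> u x = 0" "L2_dist_sq f u < e"
proof -
  have [measurable]: "f \<in> borel_measurable borel" and fin: "L2_norm_sq f < \<infinity>"
    using f by (auto simp: L2_space_def)
  obtain d :: ennreal where d: "d > 0" "2 * d + 2 * d < e"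
  proof (cases e)
    case (real r)
    then have "r > 0" using e by auto
    then have "2 * ennreal (r / 5) + 2 * ennreal (r / 5) < e"
      unfolding real by (simp add: ennreal_numeral[symmetric] ennreal_mult[symmetric] ennreal_plus[symmetric] ennreal_less_iff del: ennreal_numeral ennreal_plus)
    then show ?thesis using \<open>r > 0\<close> by (intro that[of "ennreal (r / 5)"]) auto
  next
    case top
    then show ?thesis by (intro that[of 1]) (auto simp: ennreal_mult_less_top)
  qed
  define fn where "fn n x = (if \<bar>x\<bar> \<le> real n \<and> cmod (f x) \<le> real n then f x else 0)" for n :: nat and x
  have [measurable]: "fn n \<in> borel_measurable borel" for n unfolding fn_def by measurable
  have "(\<lambda>n. L2_dist_sq f (fn n)) \<longlonglongrightarrow> 0"
  proof (rule L2_dominated_tendsto[where w=f])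
    show "AE x in lborel. (\<lambda>n. f x - fn n x) \<longlonglongrightarrow> 0"
    proof (intro AE_I2 tendsto_eventually)
      fix x
      obtain N :: nat where "real N \<ge> max \<bar>x\<bar> (cmod (f x))" using real_arch_simple[of "max \<bar>x\<bar> (cmod (f x))"] by (rule exE)
      then have "f x - fn n x = 0" if "n \<ge> N" for n using that by (simp add: fn_def)
      then show "eventually (\<lambda>n. f x - fn n x = 0) sequentially"
        unfolding eventually_sequentially by blast
    qed
  qed (use fin in \<open>auto simp: fn_def\<close>)
  then obtain n where n: "L2_dist_sq f (fn n) < d"
    using tendsto_zero_less[OF _ d(1)] by blast
  obtain g where g: "\<And>k. continuous_on UNIV (g k)" "\<And>k x. cmod (g k x) \<le> real n + 1"
    "AE x in lborel. (\<lambda>k. g k x) \<longlonglongrightarrow> fn n x"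
  proof -
    have "cmod (fn n x) \<le> real n + 1" for x by (simp add: fn_def)
    then show ?thesis
      using bounded_measurable_approx[of "fn n" "real n + 1"] that by auto
  qed
  have [measurable]: "g k \<in> borel_measurable borel" for k using g(1) by (rule borel_measurable_continuous_onI)
  define ct where "ct x = max 0 (min 1 (real n + 1 - \<bar>x\<bar>))" for x
  have contct: "continuous_on UNIV ct" unfolding ct_def by (intro continuous_intros)
  have [measurable]: "ct \<in> borel_measurable borel" using contct by (rule borel_measurable_continuous_onI)
  have fnct: "of_real (ct x) * fn n x = fn n x" for x by (auto simp: ct_def fn_def)
  define b where "b = 2 * (real n + 1)"
  have "(\<lambda>k. L2_norm_sq (\<lambda>x. fn n x - of_real (ct x) * g k x)) \<longlonglongrightarrow> 0"
  proof (rule L2_dominated_tendsto[where w="\<lambda>x. of_real b * indicator {-(real n + 1)..real n + 1} x"])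
    show "AE x in lborel. (\<lambda>k. fn n x - of_real (ct x) * g k x) \<longlonglongrightarrow> 0"
      using g(3)
    proof eventually_elim
      case (elim x)
      have "(\<lambda>k. fn n x - of_real (ct x) * g k x) \<longlonglongrightarrow> fn n x - of_real (ct x) * fn n x"
        by (intro tendsto_intros elim)
      then show ?case by (simp add: fnct)
    qed
    show "cmod (fn n x - of_real (ct x) * g k x) \<le> cmod (of_real b * indicator {-(real n + 1)..real n + 1} x)" for k x
    proof (cases "\<bar>x\<bar> \<le> real n + 1")
      case True
      have "cmod (fn n x - of_real (ct x) * g k x) \<le> cmod (fn n x) + \<bar>ct x\<bar> * cmod (g k x)"
        using norm_triangle_ineq4[of "fn n x" "of_real (ct x) * g k x"] by (simp add: norm_mult)
      also have "\<dots> \<le> (real n + 1) + 1 * (real n + 1)"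
        using g(2)[of k x] by (intro add_mono mult_mono) (auto simp: fn_def ct_def)
      also have "\<dots> = cmod (of_real b * indicator {-(real n + 1)..real n + 1} x)"
        using True by (auto simp: b_def norm_mult abs_le_iff simp del: of_real_add of_real_mult)
      finally show ?thesis .
    next
      case False
      then show ?thesis by (auto simp: fn_def ct_def)
    qed
    show "L2_norm_sq (\<lambda>x. of_real b * indicator {-(real n + 1)..real n + 1} x) < \<infinity>"
      by (rule L2_norm_sq_cutoff_const)
  qed auto
  then obtain k where k: "L2_norm_sq (\<lambda>x. fn n x - of_real (ct x) * g k x) < d"
    using tendsto_zero_less[OF _ d(1)] by blast
  show ?thesis
  proof (rule that[of "\<lambda>x. of_real (ct x) * g k x" "real n + 1"])
    show "continuous_on UNIV (\<lambda>x. of_real (ct x) * g k x)"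
      by (intro continuous_intros contct g)
    show "of_real (ct x) * g k x = 0" if "\<bar>x\<bar> > real n + 1" for x using that by (simp add: ct_def)
    have "L2_norm_sq (\<lambda>x. f x - of_real (ct x) * g k x) \<le> 2 * L2_dist_sq f (fn n) + 2 * L2_norm_sq (\<lambda>x. fn n x - of_real (ct x) * g k x)"
      by (rule L2_norm_sq_triangle) auto
    also have "\<dots> \<le> 2 * d + 2 * d"
      using n k by (intro add_mono mult_left_mono) auto
    finally show "L2_norm_sq (\<lambda>x. f x - of_real (ct x) * g k x) < e" using d(2) by simp
  qed
qed

lemma L2_dense_compact_support:
  assumes f: "f \<in> L2_space"
  obtains u :: "nat \<Rightarrow> real \<Rightarrow> complex" where "\<And>n. continuous_on UNIV (u n)" "\<And>n. \<exists>R. \<forall>x. \<bar>x\<bar> > R \<longrightarrow> u n x = 0"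
    "(\<lambda>n. L2_dist_sq f (u n)) \<longlonglongrightarrow> 0"
proof -
  have "\<exists>u. continuous_on UNIV u \<and> (\<exists>R. \<forall>x. \<bar>x\<bar> > R \<longrightarrow> u x = 0) \<and> L2_dist_sq f u < ennreal (1 / real (Suc n))" for n
  proof -
    have "ennreal (1 / real (Suc n)) > 0" by simp
    from L2_dense_compact_support_eps[OF f this] show ?thesis by metis
  qed
  then obtain u where u: "\<And>n. continuous_on UNIV (u n)" "\<And>n. \<exists>R. \<forall>x. \<bar>x\<bar> > R \<longrightarrow> u n x = 0"
    "\<And>n. L2_dist_sq f (u n) < ennreal (1 / real (Suc n))" by metis
  have "(\<lambda>n. 1 / real (Suc n)) \<longlonglongrightarrow> 0"
    using LIMSEQ_inverse_real_of_nat by (simp add: inverse_eq_divide)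
  from tendsto_ennrealI[OF this] have lim: "(\<lambda>n. ennreal (1 / real (Suc n))) \<longlonglongrightarrow> 0"
    by (simp only: ennreal_0)
  have "(\<lambda>n. L2_dist_sq f (u n)) \<longlonglongrightarrow> 0"
  proof (rule tendsto_sandwich[OF _ _ tendsto_const lim])
    show "eventually (\<lambda>n. L2_dist_sq f (u n) \<le> ennreal (1 / real (Suc n))) sequentially"
      by (intro always_eventually allI less_imp_le u(3))
  qed simp
  with u(1,2) show thesis by (rule that)
qed

section \<open>Completeness of the space of square-integrable functions\<close>

lemma L2_norm_sq_fatou:
  fixes u :: "nat \<Rightarrow> real \<Rightarrow> complex"
  assumes [measurable]: "\<And>k. u k \<in> borel_measurable borel" "v \<in> borel_measurable borel"
    and lim: "AE x in lborel. (\<lambda>k. u k x) \<longlonglongrightarrow> g x"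
    and le: "\<And>k. k \<ge> N \<Longrightarrow> L2_dist_sq v (u k) \<le> e"
  shows "L2_dist_sq v g \<le> e"
proof -
  have "L2_dist_sq v g = (\<integral>\<^sup>+x. liminf (\<lambda>k. sq_mod (v x - u k x)) \<partial>lborel)"
    unfolding L2_norm_sq_def
  proof (rule nn_integral_cong_AE)
    show "AE x in lborel. sq_mod (v x - g x) = liminf (\<lambda>k. sq_mod (v x - u k x))"
      using lim
    proof eventually_elim
      case (elim x)
      show ?case
        by (intro lim_imp_Liminf[symmetric] tendsto_ennrealI tendsto_intros elim) auto
    qed
  qed
  also have "\<dots> \<le> liminf (\<lambda>k. L2_dist_sq v (u k))"
    unfolding L2_norm_sq_def by (rule nn_integral_liminf) measurable
  also have "\<dots> \<le> e"
    by (rule Liminf_le) (use le in \<open>auto simp: eventually_sequentially\<close>)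
  finally show ?thesis .
qed

lemma L2_norm_sq_commute: "L2_dist_sq f g = L2_dist_sq g f"
  by (simp add: L2_norm_sq_def norm_minus_commute)

text \<open>
  The weights \<open>2 ^ k\<close> are small enough for \<open>\<Sum>\<^sub>k 2\<^sup>k \<bar>d\<^sub>k\<bar>\<^sup>2\<close> to have a finite integral, and large enough for
  its finiteness at a point to force \<open>\<bar>d\<^sub>k\<bar> = O (2 powr (- k / 2))\<close> there.
\<close>

lemma AE_summable_of_L2_geometric:
  fixes d :: "nat \<Rightarrow> real \<Rightarrow> complex"
  assumes [measurable]: "\<And>k. d k \<in> borel_measurable borel"
    and d: "\<And>k. L2_norm_sq (d k) \<le> ennreal ((1 / 8) ^ k)"
  shows "AE x in lborel. summable (\<lambda>k. d k x)"
proof -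
  have "(\<integral>\<^sup>+x. (\<Sum>k. ennreal (2 ^ k) * sq_mod (d k x)) \<partial>lborel) = (\<Sum>k. ennreal (2 ^ k) * L2_norm_sq (d k))"
    unfolding L2_norm_sq_def by (subst nn_integral_suminf) (auto simp: nn_integral_cmult)
  also have "\<dots> \<le> (\<Sum>k. ennreal ((1 / 4) ^ k))"
  proof (intro suminf_le summableI)
    fix k
    have "ennreal (2 ^ k) * L2_norm_sq (d k) \<le> ennreal (2 ^ k) * ennreal ((1 / 8) ^ k)"
      by (intro mult_left_mono d) auto
    also have "\<dots> = ennreal ((1 / 4) ^ k)"
      by (simp add: ennreal_mult[symmetric] power_mult_distrib[symmetric])
    finally show "ennreal (2 ^ k) * L2_norm_sq (d k) \<le> ennreal ((1 / 4) ^ k)" .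
  qed
  also have "\<dots> = ennreal (\<Sum>k. (1 / 4) ^ k)"
    by (rule suminf_ennreal2) (auto intro: summable_geometric)
  finally have "(\<integral>\<^sup>+x. (\<Sum>k. ennreal (2 ^ k) * sq_mod (d k x)) \<partial>lborel) < \<infinity>"
    by (rule le_less_trans) simp
  then have "AE x in lborel. (\<Sum>k. ennreal (2 ^ k) * sq_mod (d k x)) \<noteq> \<infinity>"
    by (intro nn_integral_PInf_AE) auto
  then show ?thesis
  proof eventually_elim
    case (elim x)
    then obtain C where C: "(\<Sum>k. ennreal (2 ^ k) * sq_mod (d k x)) = ennreal C" "C \<ge> 0"
      by (cases "\<Sum>k. ennreal (2 ^ k) * sq_mod (d k x)") auto
    have b: "cmod (d k x) \<le> sqrt C * sqrt (1 / 2) ^ k" for k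
    proof -
      have "ennreal (2 ^ k) * sq_mod (d k x) = (\<Sum>i\<in>{k}. ennreal (2 ^ i) * sq_mod (d i x))"
        by simp
      also have "\<dots> \<le> ennreal C"
        unfolding C(1)[symmetric] by (intro sum_le_suminf summableI) auto
      finally have "2 ^ k * (cmod (d k x))\<^sup>2 \<le> C"
        using C(2) by (simp add: ennreal_mult[symmetric])
      then have "(cmod (d k x))\<^sup>2 \<le> C * (1 / 2) ^ k"
        by (simp add: field_simps power_divide)
      then have "cmod (d k x) \<le> sqrt (C * (1 / 2) ^ k)"
        by (rule real_le_rsqrt)
      then show ?thesis by (simp add: real_sqrt_mult real_sqrt_power)
    qed
    have "summable (\<lambda>k. sqrt C * sqrt (1 / 2) ^ k)"
      by (intro summable_mult summable_geometric) (simp add: real_sqrt_lt_1_iff)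
    then show ?case
      by (rule summable_comparison_test'[where N=0]) (use b in auto)
  qed
qed

text \<open>
  Fatou's lemma along the subsequence turns the Cauchy condition into convergence to \<open>g\<close>.
\<close>

lemma L2_cauchy_limit_of_subsequence:
  fixes u :: "nat \<Rightarrow> real \<Rightarrow> complex"
  assumes um: "\<And>n. u n \<in> borel_measurable borel" and gm: "g \<in> borel_measurable borel"
    and fin: "\<And>n. L2_norm_sq (u n) < \<infinity>"
    and cauchy: "\<And>e::ennreal. e > 0 \<Longrightarrow> \<exists>N. \<forall>m\<ge>N. \<forall>n\<ge>N. L2_dist_sq (u m) (u n) \<le> e"
    and r: "\<And>k. r k \<ge> k" and lim: "AE x in lborel. (\<lambda>k. u (r k) x) \<longlonglongrightarrow> g x"
  shows "g \<in> L2_space" "(\<lambda>n. L2_dist_sq (u n) g) \<longlonglongrightarrow> 0"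
proof -
  note [measurable] = um gm
  have close: "\<exists>N. \<forall>n\<ge>N. L2_dist_sq (u n) g \<le> e" if e: "e > 0" for e
  proof -
    obtain N where N: "\<And>m n. m \<ge> N \<Longrightarrow> n \<ge> N \<Longrightarrow> L2_dist_sq (u m) (u n) \<le> e"
      using cauchy[OF e] by auto
    have "L2_dist_sq (u n) g \<le> e" if "n \<ge> N" for n
      by (rule L2_norm_sq_fatou[OF _ _ lim, of _ N]) (auto intro!: N that order_trans[OF _ r])
    then show ?thesis by auto
  qed
  show "(\<lambda>n. L2_dist_sq (u n) g) \<longlonglongrightarrow> 0"
  proof (rule order_tendstoI)
    fix a :: ennreal assume a: "0 < a"
    then obtain e where e: "0 < e" "e < a" using dense by blast
    from close[OF e(1)] show "eventually (\<lambda>n. L2_dist_sq (u n) g < a) sequentially"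
      unfolding eventually_sequentially using e(2) by (meson le_less_trans)
  qed simp
  show "g \<in> L2_space"
  proof -
    obtain n where n: "L2_dist_sq (u n) g \<le> 1"
      using close[of 1] by auto
    have "L2_norm_sq (\<lambda>x. g x - 0) \<le> 2 * L2_dist_sq g (u n) + 2 * L2_norm_sq (\<lambda>x. u n x - 0)"
      by (rule L2_norm_sq_triangle) auto
    also have "\<dots> < \<infinity>"
      using n fin[of n] by (subst L2_norm_sq_commute) (auto simp: ennreal_mult_less_top ennreal_add_less_top intro: le_less_trans)
    finally show ?thesis by (simp add: L2_space_def)
  qed
qed

text \<open>
  The Riesz-Fischer theorem: a rapidly converging subsequence converges almost everywhere.
\<close>

lemma L2_complete:
  fixes u :: "nat \<Rightarrow> real \<Rightarrow> complex"
  assumes um: "\<And>n. u n \<in> borel_measurable borel" and fin: "\<And>n. L2_norm_sq (u n) < \<infinity>"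
    and cauchy: "\<And>e::ennreal. e > 0 \<Longrightarrow> \<exists>N. \<forall>m\<ge>N. \<forall>n\<ge>N. L2_dist_sq (u m) (u n) \<le> e"
  shows "\<exists>g \<in> L2_space. (\<lambda>n. L2_dist_sq (u n) g) \<longlonglongrightarrow> 0"
proof -
  note [measurable] = um
  have "\<exists>N. \<forall>m\<ge>N. \<forall>n\<ge>N. L2_dist_sq (u m) (u n) \<le> ennreal ((1 / 8) ^ k)" for k
    by (rule cauchy) simp
  then obtain N where N: "\<And>k m n. m \<ge> N k \<Longrightarrow> n \<ge> N k \<Longrightarrow> L2_dist_sq (u m) (u n) \<le> ennreal ((1 / 8) ^ k)"
    by metis
  (* The partial sums dominate every earlier N j, and the summand k makes r unbounded. *)
  define r where "r k = k + (\<Sum>j\<le>k. N j)" for k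
  have rN: "r k \<ge> N k" "r (Suc k) \<ge> N k" "r k \<ge> k" for k
    using member_le_sum[of k "{..k}" N] by (auto simp: r_def)
  have "AE x in lborel. summable (\<lambda>k. u (r (Suc k)) x - u (r k) x)"
    by (rule AE_summable_of_L2_geometric) (auto intro: N rN)
  then have conv: "AE x in lborel. convergent (\<lambda>k. u (r k) x)"
  proof eventually_elim
    case (elim x)
    then have "convergent (\<lambda>n. \<Sum>k<n. u (r (Suc k)) x - u (r k) x)"
      by (simp add: summable_iff_convergent)
    then have "convergent (\<lambda>n. u (r n) x - u (r 0) x)"
      by (simp add: sum_lessThan_telescope[of "\<lambda>k. u (r k) x"])
    then show ?case
      using convergent_add[OF _ convergent_const[of "u (r 0) x"]] by force
  qed
  define g where "g x = lim (\<lambda>k. u (r k) x)" for x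
  have gm [measurable]: "g \<in> borel_measurable borel"
    unfolding g_def[abs_def] by (rule borel_measurable_lim_metric) simp
  have lim: "AE x in lborel. (\<lambda>k. u (r k) x) \<longlonglongrightarrow> g x"
    using conv by eventually_elim (simp add: g_def convergent_LIMSEQ_iff)
  show ?thesis
    using L2_cauchy_limit_of_subsequence[OF um gm fin cauchy rN(3) lim] by blast
qed

lemma L2_norm_sq_add_tendsto_0:
  fixes u v :: "nat \<Rightarrow> real \<Rightarrow> complex"
  assumes [measurable]: "\<And>n. u n \<in> borel_measurable borel" "\<And>n. v n \<in> borel_measurable borel"
    and u: "(\<lambda>n. L2_norm_sq (u n)) \<longlonglongrightarrow> 0" and v: "(\<lambda>n. L2_norm_sq (v n)) \<longlonglongrightarrow> 0"
  shows "(\<lambda>n. L2_norm_sq (\<lambda>x. u n x + v n x)) \<longlonglongrightarrow> 0"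
proof (rule tendsto_sandwich[OF _ _ tendsto_const])
  have "(\<lambda>n. 2 * L2_norm_sq (u n) + 2 * L2_norm_sq (v n)) \<longlonglongrightarrow> 2 * 0 + 2 * 0"
    by (intro tendsto_intros ennreal_tendsto_cmult u v) auto
  then show "(\<lambda>n. 2 * L2_norm_sq (u n) + 2 * L2_norm_sq (v n)) \<longlonglongrightarrow> 0" by simp
  have "L2_norm_sq (\<lambda>x. u n x - (- v n x)) \<le> 2 * L2_norm_sq (\<lambda>x. u n x - 0) + 2 * L2_norm_sq (\<lambda>x. 0 - (- v n x))" for n
    by (rule L2_norm_sq_triangle) auto
  then show "eventually (\<lambda>n. L2_norm_sq (\<lambda>x. u n x + v n x) \<le> 2 * L2_norm_sq (u n) + 2 * L2_norm_sq (v n)) sequentially"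
    by simp
qed simp

lemma L2_norm_sq_sum_tendsto_0:
  fixes u :: "'i \<Rightarrow> nat \<Rightarrow> real \<Rightarrow> complex"
  assumes "finite J" and m: "\<And>j n. u j n \<in> borel_measurable borel"
    and u: "\<And>j. (\<lambda>n. L2_norm_sq (u j n)) \<longlonglongrightarrow> 0"
  shows "(\<lambda>n. L2_norm_sq (\<lambda>x. \<Sum>j\<in>J. u j n x)) \<longlonglongrightarrow> 0"
  using assms(1)
proof (induction J)
  case empty
  then show ?case by (simp add: L2_norm_sq_def)
next
  case (insert j J)
  note [measurable] = m
  show ?case
    using insert by (simp add: L2_norm_sq_add_tendsto_0 u)
qed

lemma L2_norm_sq_cmult_shift:
  assumes [measurable]: "f \<in> borel_measurable borel"
  shows "L2_norm_sq (\<lambda>t. c * f (t + s)) = ennreal ((cmod c)\<^sup>2) * L2_norm_sq f"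
proof -
  have "L2_norm_sq (\<lambda>t. c * f (t + s)) = (\<integral>\<^sup>+t. ennreal ((cmod c)\<^sup>2) * sq_mod (f (t + s)) \<partial>lborel)"
    unfolding L2_norm_sq_def by (simp add: norm_mult power_mult_distrib ennreal_mult)
  also have "\<dots> = ennreal ((cmod c)\<^sup>2) * (\<integral>\<^sup>+t. sq_mod (f (t + s)) \<partial>lborel)"
    by (rule nn_integral_cmult) simp
  also have "(\<integral>\<^sup>+t. sq_mod (f (t + s)) \<partial>lborel) = L2_norm_sq f"
    unfolding L2_norm_sq_def by (rule nn_integral_lborel_shift[of "\<lambda>t. sq_mod (f t)"]) simp
  finally show ?thesis .
qed

text \<open>
  Norms agree in the limit if they agree along two convergent sequences. The statement is one-sided;
  exchanging the roles of the sequences gives equality.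
\<close>

lemma L2_isometry_limit:
  fixes u v :: "nat \<Rightarrow> real \<Rightarrow> complex"
  assumes [measurable]: "\<And>n. u n \<in> borel_measurable borel" "\<And>n. v n \<in> borel_measurable borel"
    "f \<in> borel_measurable borel" "g \<in> borel_measurable borel"
    and u: "(\<lambda>n. L2_dist_sq (u n) f) \<longlonglongrightarrow> 0" and v: "(\<lambda>n. L2_dist_sq (v n) g) \<longlonglongrightarrow> 0"
    and eq: "\<And>n. L2_norm_sq (u n) = L2_norm_sq (v n)"
  shows "L2_norm_sq f \<le> L2_norm_sq g"
proof -
  have slack: "L2_norm_sq f \<le> ennreal (1 + \<eta>) * (ennreal (1 + \<eta>) * L2_norm_sq g)" if \<eta>: "\<eta> > 0" for \<eta>
  proof (rule LIMSEQ_le_const)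
    let ?R = "\<lambda>n. ennreal (1 + \<eta>) * (ennreal (1 + \<eta>) * L2_norm_sq g + ennreal (1 + 1 / \<eta>) * L2_dist_sq (v n) g)
        + ennreal (1 + 1 / \<eta>) * L2_dist_sq (u n) f"
    have "?R \<longlonglongrightarrow> ennreal (1 + \<eta>) * (ennreal (1 + \<eta>) * L2_norm_sq g + ennreal (1 + 1 / \<eta>) * 0) + ennreal (1 + 1 / \<eta>) * 0"
      by (intro tendsto_intros ennreal_tendsto_cmult u v) auto
    then show "?R \<longlonglongrightarrow> ennreal (1 + \<eta>) * (ennreal (1 + \<eta>) * L2_norm_sq g)" by simp
    have "L2_norm_sq f \<le> ?R n" for n
    proof -
      have "L2_norm_sq f \<le> ennreal (1 + \<eta>) * L2_norm_sq (u n) + ennreal (1 + 1 / \<eta>) * L2_dist_sq f (u n)"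
        unfolding L2_norm_sq_def by (rule nn_integral_norm_sq_le) (use \<eta> in auto)
      moreover have "L2_norm_sq (v n) \<le> ennreal (1 + \<eta>) * L2_norm_sq g + ennreal (1 + 1 / \<eta>) * L2_dist_sq (v n) g"
        unfolding L2_norm_sq_def by (rule nn_integral_norm_sq_le) (use \<eta> in auto)
      ultimately show ?thesis
        unfolding eq L2_norm_sq_commute[of f] by (meson add_right_mono mult_left_mono order_trans zero_le)
    qed
    then show "\<exists>N. \<forall>n\<ge>N. L2_norm_sq f \<le> ?R n" by blast
  qed
  show ?thesis
  proof (rule ennreal_le_of_slack)
    fix \<eta> :: real assume \<eta>: "\<eta> > 0"
    define d where "d = sqrt (1 + \<eta>) - 1"
    have d: "d > 0" "(1 + d) * (1 + d) = 1 + \<eta>" using \<eta> by (auto simp: d_def)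
    then have "ennreal (1 + d) * ennreal (1 + d) = ennreal (1 + \<eta>)"
      by (subst ennreal_mult[symmetric]) auto
    then show "L2_norm_sq f \<le> ennreal (1 + \<eta>) * L2_norm_sq g"
      using slack[OF d(1)] by (simp only: mult.assoc[symmetric])
  qed
qed

section \<open>The Plancherel theorem\<close>

text \<open>
  The transform of integrable functions, kept apart from \<^const>\<open>fourier\<close>, which for other functions is
  an unspecified \<open>L\<^sup>2\<close>-limit.
\<close>

definition fourier_L1 :: "(real \<Rightarrow> complex) \<Rightarrow> real \<Rightarrow> complex" where
  "fourier_L1 f w = (LINT x|lborel. f x * cis (- (2 * pi * w * x)))"

text \<open>
  Functions for which the Plancherel theorem follows from dominated convergence. The class contains
  the truncations of continuous functions and is closed under translation and linear combination.
\<close>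

definition tame :: "(real \<Rightarrow> complex) \<Rightarrow> bool" where
  "tame f \<longleftrightarrow> f \<in> borel_measurable borel \<and> (\<exists>C. \<forall>x. cmod (f x) \<le> C) \<and> (\<exists>R. \<forall>x. \<bar>x\<bar> > R \<longrightarrow> f x = 0) \<and> finite {x. \<not> isCont f x}"

lemma measurable_cis [measurable (raw)]:
  assumes [measurable]: "f \<in> borel_measurable M"
  shows "(\<lambda>x. cis (f x)) \<in> borel_measurable M"
proof -
  have "cis \<in> borel_measurable borel"
    by (intro borel_measurable_continuous_onI continuous_intros)
  then show ?thesis by measurable
qed

lemma measurable_cnj [measurable (raw)]:
  assumes [measurable]: "f \<in> borel_measurable M"
  shows "(\<lambda>x. cnj (f x)) \<in> borel_measurable M"
proof -
  have "cnj \<in> borel_measurable borel"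
    by (intro borel_measurable_continuous_onI continuous_intros)
  then show ?thesis by measurable
qed

lemma tame_obtain:
  assumes "tame f"
  obtains C R where "C > 0" "R > 0" "\<And>x. cmod (f x) \<le> C" "\<And>x. \<bar>x\<bar> > R \<Longrightarrow> f x = 0"
proof -
  obtain C R where CR: "\<And>x. cmod (f x) \<le> C" "\<And>x. \<bar>x\<bar> > R \<Longrightarrow> f x = 0"
    using assms by (auto simp: tame_def)
  have "cmod (f x) \<le> \<bar>C\<bar> + 1" for x using CR(1)[of x] by linarith
  then show ?thesis
    by (intro that[of "\<bar>C\<bar> + 1" "\<bar>R\<bar> + 1"]) (auto intro: CR(2))
qed

lemma tame_integrable:
  assumes "tame f"
  shows "integrable lborel f"
proof -
  obtain C R where CR: "C > 0" "R > 0" "\<And>x. cmod (f x) \<le> C" "\<And>x. \<bar>x\<bar> > R \<Longrightarrow> f x = 0"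
    using tame_obtain[OF assms] by blast
  show ?thesis
  proof (rule Bochner_Integration.integrable_bound)
    show "integrable lborel (\<lambda>x. C * indicator {-R..R} x :: real)"
      by (simp add: integrable_indicator_iff emeasure_lborel_Icc_eq)
    show "f \<in> borel_measurable lborel" using assms by (simp add: tame_def)
    show "AE x in lborel. cmod (f x) \<le> norm (C * indicator {-R..R} x :: real)"
    proof (rule AE_I2)
      fix x show "cmod (f x) \<le> norm (C * indicator {-R..R} x :: real)"
        using CR(3)[of x] CR(4)[of x] CR(1) by (cases "\<bar>x\<bar> > R") (auto simp: indicator_def abs_le_iff)
    qed
  qed
qed

text \<open>
  The Fourier transform of a Gaussian, read off from the characteristic function of the standard
  normal distribution.
\<close>

lemma gauss_char:
  fixes t a :: real
  assumes a: "a > 0"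
  shows "(LINT w|lborel. complex_of_real (exp (- (w / a)\<^sup>2 / 2)) * cis (w * t)) = of_real (sqrt (2 * pi) * a * exp (- (a * t)\<^sup>2 / 2))"
proof -
  have "(LINT w|lborel. complex_of_real (exp (- (w / a)\<^sup>2 / 2)) * cis (w * t))
      = \<bar>a\<bar> *\<^sub>R (LINT v|lborel. complex_of_real (exp (- ((0 + a * v) / a)\<^sup>2 / 2)) * cis ((0 + a * v) * t))"
    using a by (intro lborel_integral_real_affine) auto
  also have "(LINT v|lborel. complex_of_real (exp (- ((0 + a * v) / a)\<^sup>2 / 2)) * cis ((0 + a * v) * t))
      = (LINT v|lborel. sqrt (2 * pi) *\<^sub>R (std_normal_density v *\<^sub>R iexp ((a * t) * v)))"
  proof (rule Bochner_Integration.integral_cong[OF refl])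
    fix v
    have "(0 + a * v) / a = v" using a by simp
    moreover have "cis ((0 + a * v) * t) = iexp ((a * t) * v)"
      unfolding cis_conv_exp by (simp only: add_0 mult_ac)
    moreover have "exp (- v\<^sup>2 / 2) = sqrt (2 * pi) * std_normal_density v"
      by (simp add: std_normal_density_def)
    ultimately show "complex_of_real (exp (- ((0 + a * v) / a)\<^sup>2 / 2)) * cis ((0 + a * v) * t)
        = sqrt (2 * pi) *\<^sub>R (std_normal_density v *\<^sub>R iexp ((a * t) * v))"
      by (simp only: scaleR_conv_of_real of_real_mult mult.assoc)
  qed
  also have "\<dots> = sqrt (2 * pi) *\<^sub>R (LINT v|lborel. std_normal_density v *\<^sub>R iexp ((a * t) * v))"
    by (rule Bochner_Integration.integral_scaleR_right)
  also have "(LINT v|lborel. std_normal_density v *\<^sub>R iexp ((a * t) * v)) = char std_normal_distribution (a * t)"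
    unfolding char_def by (subst integral_density) (auto simp: normal_density_nonneg)
  also have "\<dots> = complex_of_real (exp (- ((a * t)\<^sup>2) / 2))"
    unfolding char_std_normal_distribution ..
  finally show ?thesis using a by (simp add: scaleR_conv_of_real)
qed

lemma integrable_gauss:
  assumes "a > 0"
  shows "integrable lborel (\<lambda>w. exp (- (w / a)\<^sup>2 / 2) :: real)"
proof -
  have "integrable lborel (\<lambda>x. sqrt (2 * pi) * std_normal_density x)"
    by simp
  then have "integrable lborel (\<lambda>x. exp (- x\<^sup>2 / 2) :: real)"
    by (simp add: std_normal_density_def)
  from lborel_integrable_real_affine[OF this, of "1 / a" 0] show ?thesis
    using assms by simp
qed

text \<open>
  The integrability condition of every use of Fubini's theorem below, where \<open>h\<close> is an exponential
  kernel, possibly times a normalised bounded factor.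
\<close>

lemma integrable_product_bounded:
  fixes f g :: "real \<Rightarrow> complex" and h :: "real \<Rightarrow> real \<Rightarrow> complex"
  assumes f: "integrable lborel f" and g: "integrable lborel g"
    and [measurable]: "case_prod h \<in> borel_measurable (lborel \<Otimes>\<^sub>M lborel)" and h: "\<And>x y. cmod (h x y) \<le> 1"
  shows "integrable (lborel \<Otimes>\<^sub>M lborel) (\<lambda>(x, y). f x * g y * h x y)"
proof -
  note [measurable] = borel_measurable_integrable[OF f] borel_measurable_integrable[OF g]
  have "integrable (lborel \<Otimes>\<^sub>M lborel) (\<lambda>z. f (fst z) * g (snd z))"
  proof (rule lborel_pair.Fubini_integrable)
    show "integrable lborel (\<lambda>x. LINT y|lborel. cmod (f (fst (x, y)) * g (snd (x, y))))"
      using f by (simp add: norm_mult)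
    show "AE x in lborel. integrable lborel (\<lambda>y. f (fst (x, y)) * g (snd (x, y)))"
      using g by simp
  qed measurable
  then show ?thesis
  proof (rule Bochner_Integration.integrable_bound)
    have "cmod (f x * g y * h x y) \<le> cmod (f x * g y) * 1" for x y
      unfolding norm_mult by (intro mult_left_mono h) auto
    then show "AE z in lborel \<Otimes>\<^sub>M lborel. cmod (case z of (x, y) \<Rightarrow> f x * g y * h x y) \<le> cmod (f (fst z) * g (snd z))"
      by (intro AE_I2) (auto split: prod.split)
  qed measurable
qed

lemma fourier_L1_bounded_measurable:
  assumes f: "integrable lborel f"
  shows "cmod (fourier_L1 f w) \<le> (LINT x|lborel. cmod (f x))" "fourier_L1 f \<in> borel_measurable borel"
proof -
  note [measurable] = borel_measurable_integrable[OF f]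
  have "cmod (fourier_L1 f w) \<le> (LINT x|lborel. cmod (f x * cis (- (2 * pi * w * x))))"
    unfolding fourier_L1_def by (rule integral_norm_bound)
  then show "cmod (fourier_L1 f w) \<le> (LINT x|lborel. cmod (f x))" by (simp add: norm_mult)
  have "(\<lambda>w. LINT x|lborel. f x * cis (- (2 * pi * w * x))) \<in> borel_measurable lborel"
    by measurable
  then show "fourier_L1 f \<in> borel_measurable borel" unfolding fourier_L1_def[abs_def] by simp
qed

lemma integrable_mult_cis:
  assumes f: "integrable lborel f"
  shows "integrable lborel (\<lambda>x. f x * cis (a * x))"
proof -
  note [measurable] = borel_measurable_integrable[OF f]
  show ?thesis
    by (rule Bochner_Integration.integrable_bound[OF f]) (auto simp: norm_mult)
qed

text \<open>
  The Gaussian makes the triple integral over \<open>w\<close>, \<open>x\<close>, \<open>y\<close> absolutely convergent. Integrating over \<open>w\<close>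
  first leaves a Gaussian in \<open>y - x\<close>, which the substitution \<open>x = y + s / (2 \<pi> a)\<close> turns into the standard
  normal density.
\<close>

lemma gauss_plancherel:
  fixes f :: "real \<Rightarrow> complex" and a :: real
  assumes f: "integrable lborel f" and a: "a > 0"
  shows "(LINT w|lborel. complex_of_real (exp (- (w / a)\<^sup>2 / 2)) * (fourier_L1 f w * cnj (fourier_L1 f w)))
     = (LINT y|lborel. cnj (f y) * (LINT s|lborel. std_normal_density s *\<^sub>R f (y + s / (2 * pi * a))))"
proof -
  note [measurable] = borel_measurable_integrable[OF f] fourier_L1_bounded_measurable(2)[OF f]
  define G where "G w = complex_of_real (exp (- (w / a)\<^sup>2 / 2))" for w
  have Gint: "integrable lborel G" unfolding G_def using integrable_gauss[OF a] by (intro integrable_of_real)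
  note [measurable] = borel_measurable_integrable[OF Gint]
  define B where "B = (LINT x|lborel. cmod (f x)) + 1"
  have B: "B > 0" "cmod (fourier_L1 f w) \<le> B" for w
    using fourier_L1_bounded_measurable(1)[OF f, of w] by (auto simp: B_def add_nonneg_pos)
  have cf: "integrable lborel (\<lambda>y. cnj (f y))" using f by simp
  have step1: "cnj (fourier_L1 f w) = (LINT y|lborel. cnj (f y) * cis (2 * pi * w * y))" for w
    unfolding fourier_L1_def Bochner_Integration.integral_cnj[symmetric] by (simp add: cis_cnj)
  have "(LINT w|lborel. G w * (fourier_L1 f w * cnj (fourier_L1 f w)))
      = (LINT w|lborel. (LINT y|lborel. G w * fourier_L1 f w * (cnj (f y) * cis (2 * pi * w * y))))"
    unfolding step1 by (simp only: Bochner_Integration.integral_mult_right_zero mult.assoc)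
  also have "\<dots> = (LINT y|lborel. (LINT w|lborel. G w * fourier_L1 f w * (cnj (f y) * cis (2 * pi * w * y))))"
  proof (rule lborel_pair.Fubini_integral[symmetric])
    have "integrable (lborel \<Otimes>\<^sub>M lborel) (\<lambda>(w, y). (of_real B * G w) * cnj (f y) * (fourier_L1 f w / of_real B * cis (2 * pi * w * y)))"
    proof (rule integrable_product_bounded)
      show "cmod (fourier_L1 f w / of_real B * cis (2 * pi * w * y)) \<le> 1" for w y
        using B(1) B(2)[of w] by (simp add: norm_mult norm_divide divide_le_eq_1)
    qed (use Gint cf in \<open>auto\<close>)
    also have "(\<lambda>(w, y). (of_real B * G w) * cnj (f y) * (fourier_L1 f w / of_real B * cis (2 * pi * w * y)))
        = (\<lambda>(w, y). G w * fourier_L1 f w * (cnj (f y) * cis (2 * pi * w * y)))"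
      using B(1) by (auto simp: fun_eq_iff)
    finally show "integrable (lborel \<Otimes>\<^sub>M lborel) (\<lambda>(w, y). G w * fourier_L1 f w * (cnj (f y) * cis (2 * pi * w * y)))" .
  qed
  also have "\<dots> = (LINT y|lborel. cnj (f y) * (LINT s|lborel. std_normal_density s *\<^sub>R f (y + s / (2 * pi * a))))"
  proof (rule Bochner_Integration.integral_cong[OF refl])
    fix y
    have "(LINT w|lborel. G w * fourier_L1 f w * (cnj (f y) * cis (2 * pi * w * y)))
       = (LINT w|lborel. cnj (f y) * (G w * cis (2 * pi * w * y) * fourier_L1 f w))"
      by (intro Bochner_Integration.integral_cong refl) (simp add: mult_ac)
    also have "\<dots> = cnj (f y) * (LINT w|lborel. G w * cis (2 * pi * w * y) * fourier_L1 f w)"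
      by simp
    also have "(LINT w|lborel. G w * cis (2 * pi * w * y) * fourier_L1 f w)
        = (LINT w|lborel. (LINT x|lborel. G w * f x * cis (w * (2 * pi * (y - x)))))"
    proof (rule Bochner_Integration.integral_cong[OF refl])
      fix w
      have "cis (2 * pi * w * y) * cis (- (2 * pi * w * x)) = cis (w * (2 * pi * (y - x)))" for x
        by (simp add: cis_mult algebra_simps)
      then have "(LINT x|lborel. G w * f x * cis (w * (2 * pi * (y - x))))
          = (LINT x|lborel. G w * cis (2 * pi * w * y) * (f x * cis (- (2 * pi * w * x))))"
        by (intro Bochner_Integration.integral_cong refl) (metis (no_types, lifting) mult.assoc mult.left_commute)
      also have "\<dots> = G w * cis (2 * pi * w * y) * fourier_L1 f w"
        unfolding fourier_L1_def by (rule Bochner_Integration.integral_mult_right_zero)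
      finally show "G w * cis (2 * pi * w * y) * fourier_L1 f w = (LINT x|lborel. G w * f x * cis (w * (2 * pi * (y - x))))" ..
    qed
    also have "\<dots> = (LINT x|lborel. (LINT w|lborel. G w * f x * cis (w * (2 * pi * (y - x)))))"
    proof (rule lborel_pair.Fubini_integral[symmetric])
      show "integrable (lborel \<Otimes>\<^sub>M lborel) (\<lambda>(w, x). G w * f x * cis (w * (2 * pi * (y - x))))"
        by (rule integrable_product_bounded[OF Gint f]) auto
    qed
    also have "\<dots> = (LINT x|lborel. of_real (sqrt (2 * pi) * a * exp (- (a * (2 * pi * (y - x)))\<^sup>2 / 2)) * f x)"
    proof (rule Bochner_Integration.integral_cong[OF refl])
      fix x
      have "(LINT w|lborel. G w * f x * cis (w * (2 * pi * (y - x)))) = (LINT w|lborel. f x * (G w * cis (w * (2 * pi * (y - x)))))"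
        by (intro Bochner_Integration.integral_cong refl) (simp add: mult_ac)
      also have "\<dots> = f x * (LINT w|lborel. G w * cis (w * (2 * pi * (y - x))))"
        by simp
      finally show "(LINT w|lborel. G w * f x * cis (w * (2 * pi * (y - x)))) = of_real (sqrt (2 * pi) * a * exp (- (a * (2 * pi * (y - x)))\<^sup>2 / 2)) * f x"
        unfolding G_def gauss_char[OF a] by (simp add: mult.commute)
    qed
    also have "\<dots> = \<bar>1 / (2 * pi * a)\<bar> *\<^sub>R (LINT s|lborel. of_real (sqrt (2 * pi) * a * exp (- (a * (2 * pi * (y - (y + 1 / (2 * pi * a) * s))))\<^sup>2 / 2)) * f (y + 1 / (2 * pi * a) * s))"
      using a by (intro lborel_integral_real_affine) auto
    also have "\<dots> = (LINT s|lborel. \<bar>1 / (2 * pi * a)\<bar> *\<^sub>R (of_real (sqrt (2 * pi) * a * exp (- (a * (2 * pi * (y - (y + 1 / (2 * pi * a) * s))))\<^sup>2 / 2)) * f (y + 1 / (2 * pi * a) * s)))"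
      by simp
    also have "\<dots> = (LINT s|lborel. std_normal_density s *\<^sub>R f (y + s / (2 * pi * a)))"
    proof (rule Bochner_Integration.integral_cong[OF refl])
      fix s
      have 1: "a * (2 * pi * (y - (y + 1 / (2 * pi * a) * s))) = - s" using a by simp
      have "\<bar>1 / (2 * pi * a)\<bar> * (sqrt (2 * pi) * a) = 1 / sqrt (2 * pi)"
        using a by (simp add: field_simps)
      then have "\<bar>1 / (2 * pi * a)\<bar> * (sqrt (2 * pi) * a * exp (- s\<^sup>2 / 2)) = std_normal_density s"
        unfolding std_normal_density_def by (metis mult.assoc)
      then show "\<bar>1 / (2 * pi * a)\<bar> *\<^sub>R (of_real (sqrt (2 * pi) * a * exp (- (a * (2 * pi * (y - (y + 1 / (2 * pi * a) * s))))\<^sup>2 / 2)) * f (y + 1 / (2 * pi * a) * s))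
        = std_normal_density s *\<^sub>R f (y + s / (2 * pi * a))"
        unfolding 1 power2_minus scaleR_conv_of_real by (simp only: mult.assoc[symmetric] of_real_mult[symmetric]) simp
    qed
    finally show "(LINT w|lborel. G w * fourier_L1 f w * (cnj (f y) * cis (2 * pi * w * y))) = cnj (f y) * (LINT s|lborel. std_normal_density s *\<^sub>R f (y + s / (2 * pi * a)))" .
  qed
  finally show ?thesis by (simp add: G_def)
qed

text \<open>
  In \<open>gauss_plancherel\<close> let \<open>a\<close> tend to infinity. The left side increases to the norm of the transform.
  On the right the averages of \<open>f\<close> concentrate at \<open>y\<close> and tend to \<open>f y\<close> wherever \<open>f\<close> is continuous.
\<close>

lemma plancherel_tame:
  assumes f: "tame f"
  shows "L2_norm_sq (fourier_L1 f) = L2_norm_sq f"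
proof -
  note fint = tame_integrable[OF f]
  note [measurable] = borel_measurable_integrable[OF fint] fourier_L1_bounded_measurable(2)[OF fint]
  obtain C R where CR: "C > 0" "R > 0" "\<And>x. cmod (f x) \<le> C" "\<And>x. \<bar>x\<bar> > R \<Longrightarrow> f x = 0"
    using tame_obtain[OF f] by blast
  have cont: "AE x in lborel. isCont f x"
    using AE_not_in[OF finite_imp_null_set_lborel, of "{x. \<not> isCont f x}"] f by (simp add: tame_def)
  define a where "a n = real (Suc n)" for n
  have a: "a n > 0" for n by (simp add: a_def)
  define J where "J n y = (LINT s|lborel. std_normal_density s *\<^sub>R f (y + s / (2 * pi * a n)))" for n y
  have Jm [measurable]: "J n \<in> borel_measurable borel" for n
  proof -
    have "(\<lambda>y. LINT s|lborel. std_normal_density s *\<^sub>R f (y + s / (2 * pi * a n))) \<in> borel_measurable lborel"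
      by measurable
    then show ?thesis unfolding J_def[abs_def] by simp
  qed
  have dens: "integrable lborel (\<lambda>s. C * std_normal_density s)" by simp
  have Jb: "cmod (J n y) \<le> C" for n y
  proof -
    have "cmod (J n y) \<le> (LINT s|lborel. C * std_normal_density s)"
      unfolding J_def
    proof (rule Bochner_Integration.integral_norm_bound_integral[OF _ dens])
      have b: "norm (std_normal_density s *\<^sub>R f (y + s / (2 * pi * a n))) \<le> C * std_normal_density s" for s
        using mult_right_mono[OF CR(3), of "std_normal_density s" "y + s / (2 * pi * a n)"] by (simp add: normal_density_nonneg mult.commute)
      then show "cmod (std_normal_density s *\<^sub>R f (y + s / (2 * pi * a n))) \<le> C * std_normal_density s" for s .
      show "integrable lborel (\<lambda>s. std_normal_density s *\<^sub>R f (y + s / (2 * pi * a n)))"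
        by (rule Bochner_Integration.integrable_bound[OF dens]) (use b CR(1) in \<open>auto simp: normal_density_nonneg\<close>)
    qed
    then show ?thesis by simp
  qed
  have ainf: "(\<lambda>n. 1 / a n) \<longlonglongrightarrow> 0"
    unfolding a_def using LIMSEQ_inverse_real_of_nat by (simp add: inverse_eq_divide)
  have Jlim: "(\<lambda>n. J n y) \<longlonglongrightarrow> f y" if y: "isCont f y" for y
  proof -
    have "(\<lambda>n. J n y) \<longlonglongrightarrow> (LINT s|lborel. std_normal_density s *\<^sub>R f y)"
      unfolding J_def
    proof (rule integral_dominated_convergence[OF _ _ dens])
      show "AE s in lborel. (\<lambda>n. std_normal_density s *\<^sub>R f (y + s / (2 * pi * a n))) \<longlonglongrightarrow> std_normal_density s *\<^sub>R f y"
      proof (rule AE_I2)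
        fix s
        have "(\<lambda>n. y + (s / (2 * pi)) * (1 / a n)) \<longlonglongrightarrow> y + (s / (2 * pi)) * 0"
          by (intro tendsto_intros ainf)
        then have "(\<lambda>n. y + s / (2 * pi * a n)) \<longlonglongrightarrow> y" by simp
        then have "(\<lambda>n. f (y + s / (2 * pi * a n))) \<longlonglongrightarrow> f y"
          by (rule isCont_tendsto_compose[OF y])
        then show "(\<lambda>n. std_normal_density s *\<^sub>R f (y + s / (2 * pi * a n))) \<longlonglongrightarrow> std_normal_density s *\<^sub>R f y"
          by (intro tendsto_intros)
      qed
      show "AE s in lborel. norm (std_normal_density s *\<^sub>R f (y + s / (2 * pi * a n))) \<le> C * std_normal_density s" for n
        using mult_right_mono[OF CR(3), of "std_normal_density s" "y + s / (2 * pi * a n)" for s] by (intro AE_I2) (simp add: normal_density_nonneg mult.commute)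
    qed auto
    then show ?thesis by simp
  qed
  have "(\<lambda>n. LINT y|lborel. cnj (f y) * J n y) \<longlonglongrightarrow> (LINT y|lborel. cnj (f y) * f y)"
  proof (rule integral_dominated_convergence)
    show "integrable lborel (\<lambda>y. C * cmod (f y))" using fint by simp
    show "AE y in lborel. (\<lambda>n. cnj (f y) * J n y) \<longlonglongrightarrow> cnj (f y) * f y"
      using cont by eventually_elim (intro tendsto_intros Jlim)
    show "AE y in lborel. norm (cnj (f y) * J n y) \<le> C * cmod (f y)" for n
      using mult_right_mono[OF Jb, of "cmod (f y)" n y for y] by (intro AE_I2) (simp add: norm_mult mult.commute)
  qed auto
  then have lim: "(\<lambda>n. LINT w|lborel. complex_of_real (exp (- (w / a n)\<^sup>2 / 2)) * (fourier_L1 f w * cnj (fourier_L1 f w))) \<longlonglongrightarrow> (LINT y|lborel. cnj (f y) * f y)"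
    unfolding J_def gauss_plancherel[OF fint a] .
  let ?h = "\<lambda>n w. exp (- (w / a n)\<^sup>2 / 2) * (cmod (fourier_L1 f w))\<^sup>2"
  have eq1: "complex_of_real (exp (- (w / a n)\<^sup>2 / 2)) * (fourier_L1 f w * cnj (fourier_L1 f w)) = of_real (?h n w)" for n w
    unfolding of_real_mult complex_norm_square ..
  have eq2: "cnj (f y) * f y = of_real ((cmod (f y))\<^sup>2)" for y
    unfolding complex_norm_square by (simp add: mult.commute)
  have lim': "(\<lambda>n. LINT w|lborel. ?h n w) \<longlonglongrightarrow> (LINT y|lborel. (cmod (f y))\<^sup>2)"
    using lim unfolding eq1 eq2 integral_complex_of_real by (simp only: tendsto_of_real_iff)
  have fsq: "integrable lborel (\<lambda>y. (cmod (f y))\<^sup>2)"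
  proof (rule Bochner_Integration.integrable_bound)
    show "integrable lborel (\<lambda>y. C * cmod (f y))" using fint by simp
    show "AE y in lborel. norm ((cmod (f y))\<^sup>2) \<le> norm (C * cmod (f y))"
      using mult_right_mono[OF CR(3), of "cmod (f y)" y for y] CR(1) by (intro AE_I2) (simp add: power2_eq_square abs_mult)
  qed auto
  define B where "B = (LINT x|lborel. cmod (f x))"
  have hint: "integrable lborel (?h n)" for n
  proof (rule Bochner_Integration.integrable_bound)
    show "integrable lborel (\<lambda>w. B\<^sup>2 * exp (- (w / a n)\<^sup>2 / 2))" using integrable_gauss[OF a] by simp
    have "(cmod (fourier_L1 f w))\<^sup>2 \<le> B\<^sup>2" for w
      unfolding B_def using fourier_L1_bounded_measurable(1)[OF fint] by (intro power_mono) auto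
    then show "AE w in lborel. norm (?h n w) \<le> norm (B\<^sup>2 * exp (- (w / a n)\<^sup>2 / 2))"
      by (intro AE_I2) (simp add: abs_mult mult.commute)
  qed auto
  have "(\<lambda>n. \<integral>\<^sup>+w. ennreal (?h n w) \<partial>lborel) \<longlonglongrightarrow> (\<integral>\<^sup>+w. sq_mod (fourier_L1 f w) \<partial>lborel)"
  proof (rule nn_integral_LIMSEQ)
    have "?h m w \<le> ?h n w" if "m \<le> n" for m n w
    proof -
      have "\<bar>w / a n\<bar> \<le> \<bar>w / a m\<bar>" using that by (simp add: a_def divide_left_mono)
      then have "(w / a n)\<^sup>2 \<le> (w / a m)\<^sup>2" by (simp only: abs_le_square_iff)
      then show ?thesis by (intro mult_right_mono) auto
    qed
    then show "incseq (\<lambda>n w. ennreal (?h n w))"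
      by (auto simp: incseq_def le_fun_def intro!: ennreal_leI)
    show "(\<lambda>n. ennreal (?h n w)) \<longlonglongrightarrow> sq_mod (fourier_L1 f w)" for w
    proof -
      have "(\<lambda>n. exp (- (w * (1 / a n))\<^sup>2 / 2) * (cmod (fourier_L1 f w))\<^sup>2) \<longlonglongrightarrow> exp (- (w * 0)\<^sup>2 / 2) * (cmod (fourier_L1 f w))\<^sup>2"
        by (intro tendsto_intros ainf) auto
      then show ?thesis by (intro tendsto_ennrealI) simp
    qed
  qed auto
  moreover have "(\<integral>\<^sup>+w. ennreal (?h n w) \<partial>lborel) = ennreal (LINT w|lborel. ?h n w)" for n
    by (intro nn_integral_eq_integral hint AE_I2) auto
  ultimately have "(\<lambda>n. ennreal (LINT w|lborel. ?h n w)) \<longlonglongrightarrow> L2_norm_sq (fourier_L1 f)"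
    by (simp add: L2_norm_sq_def)
  moreover have "(\<lambda>n. ennreal (LINT w|lborel. ?h n w)) \<longlonglongrightarrow> L2_norm_sq f"
  proof -
    have "L2_norm_sq f = ennreal (LINT y|lborel. (cmod (f y))\<^sup>2)"
      unfolding L2_norm_sq_def by (intro nn_integral_eq_integral fsq AE_I2) auto
    then show ?thesis using tendsto_ennrealI[OF lim'] by simp
  qed
  ultimately show ?thesis by (rule LIMSEQ_unique)
qed

lemma tame_diff:
  assumes "tame f" "tame g"
  shows "tame (\<lambda>x. f x - g x)"
proof -
  obtain C R where f: "\<And>x. cmod (f x) \<le> C" "\<And>x. \<bar>x\<bar> > R \<Longrightarrow> f x = 0"
    using tame_obtain[OF assms(1)] by metis
  obtain C' R' where g: "\<And>x. cmod (g x) \<le> C'" "\<And>x. \<bar>x\<bar> > R' \<Longrightarrow> g x = 0"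
    using tame_obtain[OF assms(2)] by metis
  have "cmod (f x - g x) \<le> C + C'" for x
    using norm_triangle_ineq4[of "f x" "g x"] f(1)[of x] g(1)[of x] by linarith
  moreover have "f x - g x = 0" if "\<bar>x\<bar> > max R R'" for x using that f(2) g(2) by simp
  moreover have "{x. \<not> isCont (\<lambda>x. f x - g x) x} \<subseteq> {x. \<not> isCont f x} \<union> {x. \<not> isCont g x}"
    by (auto intro: continuous_diff)
  then have "finite {x. \<not> isCont (\<lambda>x. f x - g x) x}"
    using assms by (auto simp: tame_def intro: finite_subset)
  moreover have "(\<lambda>x. f x - g x) \<in> borel_measurable borel" using assms by (auto simp: tame_def)
  ultimately show ?thesis unfolding tame_def by blast
qed

lemma tame_cmult_shift:
  assumes "tame f"
  shows "tame (\<lambda>x. c * f (x + s))"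
proof -
  obtain C R where f: "C > 0" "\<And>x. cmod (f x) \<le> C" "\<And>x. \<bar>x\<bar> > R \<Longrightarrow> f x = 0"
    using tame_obtain[OF assms(1)] by metis
  have "cmod (c * f (x + s)) \<le> cmod c * C" for x
    unfolding norm_mult by (intro mult_left_mono f) auto
  moreover have "c * f (x + s) = 0" if "\<bar>x\<bar> > R + \<bar>s\<bar>" for x using that f(3) by simp
  moreover have "{x. \<not> isCont (\<lambda>x. c * f (x + s)) x} \<subseteq> (\<lambda>x. x - s) ` {x. \<not> isCont f x}"
  proof
    fix x assume x: "x \<in> {x. \<not> isCont (\<lambda>x. c * f (x + s)) x}"
    have "\<not> isCont f (x + s)"
    proof
      assume "isCont f (x + s)"
      then have "isCont (\<lambda>x. c * f (x + s)) x"
        by (intro continuous_intros isCont_o2[of x "\<lambda>x. x + s" f]) auto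
      then show False using x by simp
    qed
    then show "x \<in> (\<lambda>x. x - s) ` {x. \<not> isCont f x}"
      by (intro image_eqI[of _ _ "x + s"]) auto
  qed
  then have "finite {x. \<not> isCont (\<lambda>x. c * f (x + s)) x}"
    using assms by (auto simp: tame_def intro: finite_subset)
  moreover have [measurable]: "f \<in> borel_measurable borel" using assms by (auto simp: tame_def)
  have "(\<lambda>x. c * f (x + s)) \<in> borel_measurable borel" by measurable
  ultimately show ?thesis unfolding tame_def by blast
qed

lemma tame_sum:
  assumes "finite J" "\<And>j. j \<in> J \<Longrightarrow> tame (f j)"
  shows "tame (\<lambda>x. \<Sum>j\<in>J. f j x)"
  using assms
proof (induction J)
  case empty
  show ?case by (auto simp: tame_def)
next
  case (insert j J)
  have "tame (\<lambda>x. f j x - (-1) * (\<Sum>j\<in>J. f j (x + 0)))"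
    using insert by (intro tame_diff tame_cmult_shift) auto
  then show ?case using insert by simp
qed

definition truncation :: "(real \<Rightarrow> complex) \<Rightarrow> nat \<Rightarrow> real \<Rightarrow> complex" where
  "truncation f n x = indicator {- real n..real n} x *\<^sub>R f x"

lemma truncation_measurable [measurable]:
  assumes [measurable]: "f \<in> borel_measurable borel"
  shows "truncation f n \<in> borel_measurable borel"
  unfolding truncation_def[abs_def] by measurable

lemma tame_truncation:
  assumes f: "continuous_on UNIV f"
  shows "tame (truncation f n)"
proof -
  have [measurable]: "f \<in> borel_measurable borel" using f by (rule borel_measurable_continuous_onI)
  have "bounded (f ` {- real n..real n})"
    by (intro compact_imp_bounded compact_continuous_image continuous_on_subset[OF f]) auto
  then have "\<exists>C. \<forall>x\<in>{- real n..real n}. cmod (f x) \<le> C"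
    unfolding bounded_iff by blast
  then obtain C where "\<And>x. x \<in> {- real n..real n} \<Longrightarrow> cmod (f x) \<le> C"
    by blast
  then have "cmod (f x) \<le> \<bar>C\<bar>" if "x \<in> {- real n..real n}" for x
    using that abs_ge_self order_trans by blast
  then have "cmod (truncation f n x) \<le> \<bar>C\<bar>" for x
    by (simp add: truncation_def indicator_def)
  moreover have "truncation f n x = 0" if "\<bar>x\<bar> > real n" for x
    using that by (auto simp: truncation_def indicator_def)
  moreover have "{x. \<not> isCont (truncation f n) x} \<subseteq> {- real n, real n}"
  proof (rule ccontr)
    assume "\<not> {x. \<not> isCont (truncation f n) x} \<subseteq> {- real n, real n}"
    then obtain x where x: "\<not> isCont (truncation f n) x" "x \<noteq> - real n" "x \<noteq> real n" by auto
    show False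
    proof (cases "x \<in> {- real n<..<real n}")
      case True
      have "eventually (\<lambda>y. y \<in> {- real n<..<real n}) (nhds x)"
        using True by (intro eventually_nhds_in_open) auto
      then have "eventually (\<lambda>y. truncation f n y = f y) (nhds x)"
        by eventually_elim (auto simp: truncation_def)
      moreover have "isCont f x" using f by (simp add: continuous_on_eq_continuous_at)
      ultimately show False using x(1) isCont_cong by blast
    next
      case False
      then have "x \<in> - {- real n..real n}" using x by auto
      then have "eventually (\<lambda>y. y \<in> - {- real n..real n}) (nhds x)"
        by (intro eventually_nhds_in_open) auto
      then have "eventually (\<lambda>y. truncation f n y = 0) (nhds x)"
        by eventually_elim (auto simp: truncation_def)
      then have "isCont (truncation f n) x \<longleftrightarrow> isCont (\<lambda>_. 0 :: complex) x" by (rule isCont_cong)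
      then show False using x(1) by simp
    qed
  qed
  then have "finite {x. \<not> isCont (truncation f n) x}" by (rule finite_subset) simp
  ultimately show ?thesis unfolding tame_def by (metis truncation_measurable \<open>f \<in> borel_measurable borel\<close>)
qed

lemma truncation_tendsto:
  assumes f: "f \<in> L2_space"
  shows "(\<lambda>n. L2_dist_sq (truncation f n) f) \<longlonglongrightarrow> 0"
proof (rule L2_dominated_tendsto[where w=f])
  have [measurable]: "f \<in> borel_measurable borel" using f by (simp add: L2_space_def)
  show "(\<lambda>x. truncation f n x - f x) \<in> borel_measurable borel" for n by measurable
  show "AE x in lborel. (\<lambda>n. truncation f n x - f x) \<longlonglongrightarrow> 0"
  proof (intro AE_I2 tendsto_eventually)
    fix x
    obtain N :: nat where N: "\<bar>x\<bar> \<le> real N" using real_arch_simple[of "\<bar>x\<bar>"] by (rule exE)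
    have "truncation f n x - f x = 0" if "n \<ge> N" for n using N that by (auto simp: truncation_def indicator_def)
    then show "eventually (\<lambda>n. truncation f n x - f x = 0) sequentially"
      unfolding eventually_sequentially by blast
  qed
qed (use f in \<open>auto simp: truncation_def indicator_def L2_space_def\<close>)

lemma fourier_L1_diff:
  assumes f: "integrable lborel f" and g: "integrable lborel g"
  shows "fourier_L1 (\<lambda>x. f x - g x) w = fourier_L1 f w - fourier_L1 g w"
proof -
  have "(\<lambda>x. (f x - g x) * cis (- (2 * pi * w * x))) = (\<lambda>x. f x * cis (- (2 * pi * w) * x) - g x * cis (- (2 * pi * w) * x))"
    by (simp add: fun_eq_iff algebra_simps)
  then show ?thesis unfolding fourier_L1_def
    using Bochner_Integration.integral_diff[OF integrable_mult_cis[OF f, of "- (2 * pi * w)"] integrable_mult_cis[OF g, of "- (2 * pi * w)"]]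
    by simp
qed

lemma fourier_L1_truncations:
  "(\<lambda>n w. \<integral>x\<in>{- real n..real n}. f x * cis (- (2 * pi * w * x)) \<partial>lborel) = (\<lambda>n. fourier_L1 (truncation f n))"
  unfolding fourier_L1_def truncation_def set_lebesgue_integral_def by (simp add: fun_eq_iff)

lemma fourier_L1_truncation_cauchy:
  assumes f: "continuous_on UNIV f" "f \<in> L2_space" and e: "(e::ennreal) > 0"
  shows "\<exists>N. \<forall>m\<ge>N. \<forall>n\<ge>N. L2_dist_sq (fourier_L1 (truncation f m)) (fourier_L1 (truncation f n)) \<le> e"
proof -
  have [measurable]: "f \<in> borel_measurable borel" using f by (simp add: L2_space_def)
  have "(\<lambda>n. 4 * L2_dist_sq (truncation f n) f) \<longlonglongrightarrow> 4 * 0"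
    by (intro ennreal_tendsto_cmult truncation_tendsto f) auto
  then have "(\<lambda>n. 4 * L2_dist_sq (truncation f n) f) \<longlonglongrightarrow> 0" by simp
  from order_tendstoD(2)[OF this e] obtain N where N: "\<And>n. n \<ge> N \<Longrightarrow> 4 * L2_dist_sq (truncation f n) f < e"
    unfolding eventually_sequentially by blast
  have "L2_dist_sq (fourier_L1 (truncation f m)) (fourier_L1 (truncation f n)) \<le> e" if "m \<ge> N" "n \<ge> N" for m n
  proof -
    have "L2_dist_sq (fourier_L1 (truncation f m)) (fourier_L1 (truncation f n)) = L2_norm_sq (fourier_L1 (\<lambda>x. truncation f m x - truncation f n x))"
      by (intro arg_cong[where f=L2_norm_sq] ext fourier_L1_diff[symmetric] tame_integrable tame_truncation f)
    also have "\<dots> = L2_dist_sq (truncation f m) (truncation f n)"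
      by (intro plancherel_tame tame_diff tame_truncation f)
    also have "\<dots> \<le> 2 * L2_dist_sq (truncation f m) f + 2 * L2_dist_sq f (truncation f n)"
      by (rule L2_norm_sq_triangle) measurable
    also have "\<dots> \<le> e"
    proof (cases "L2_dist_sq (truncation f m) f \<le> L2_dist_sq (truncation f n) f")
      case True
      then have "2 * L2_dist_sq (truncation f m) f + 2 * L2_dist_sq f (truncation f n)
        \<le> 2 * L2_dist_sq (truncation f n) f + 2 * L2_dist_sq (truncation f n) f"
        unfolding L2_norm_sq_commute[of f] by (intro add_mono mult_left_mono) auto
      also have "\<dots> = 4 * L2_dist_sq (truncation f n) f"
        by (simp add: distrib_right[symmetric])
      finally show ?thesis using N[OF that(2)] by simp
    next
      case False
      then have "2 * L2_dist_sq (truncation f m) f + 2 * L2_dist_sq f (truncation f n)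
        \<le> 2 * L2_dist_sq (truncation f m) f + 2 * L2_dist_sq (truncation f m) f"
        unfolding L2_norm_sq_commute[of f] by (intro add_mono mult_left_mono) auto
      also have "\<dots> = 4 * L2_dist_sq (truncation f m) f"
        by (simp add: distrib_right[symmetric])
      finally show ?thesis using N[OF that(1)] by simp
    qed
    finally show ?thesis .
  qed
  then show ?thesis by blast
qed

lemma fourier_L1_truncation_L2:
  assumes f: "continuous_on UNIV f" "f \<in> L2_space"
  shows "fourier_L1 (truncation f n) \<in> borel_measurable borel" "L2_norm_sq (fourier_L1 (truncation f n)) < \<infinity>"
proof -
  have [measurable]: "f \<in> borel_measurable borel" using f by (simp add: L2_space_def)
  show "fourier_L1 (truncation f n) \<in> borel_measurable borel"
    by (intro fourier_L1_bounded_measurable tame_integrable tame_truncation f)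
  have "L2_norm_sq (fourier_L1 (truncation f n)) = L2_norm_sq (truncation f n)"
    by (intro plancherel_tame tame_truncation f)
  also have "\<dots> \<le> L2_norm_sq f"
    unfolding L2_norm_sq_def by (intro nn_integral_mono) (auto simp: truncation_def indicator_def)
  also have "\<dots> < \<infinity>" using f by (simp add: L2_space_def)
  finally show "L2_norm_sq (fourier_L1 (truncation f n)) < \<infinity>" .
qed

text \<open>
  The transforms of the truncations form a Cauchy sequence by \<open>plancherel_tame\<close>. If \<open>f\<close> is integrable,
  the limit is identified through pointwise convergence; otherwise completeness shows that the choice
  in the definition of \<^const>\<open>fourier\<close> has a candidate.
\<close>

lemma fourier_L2_limit:
  assumes f: "continuous_on UNIV f" "f \<in> L2_space"
  shows "fourier f \<in> L2_space" "(\<lambda>n. L2_dist_sq (fourier_L1 (truncation f n)) (fourier f)) \<longlonglongrightarrow> 0"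
proof -
  note [measurable] = fourier_L1_truncation_L2(1)[OF f]
  have ex: "\<exists>g\<in>L2_space. (\<lambda>n. L2_dist_sq (fourier_L1 (truncation f n)) g) \<longlonglongrightarrow> 0"
    by (intro L2_complete fourier_L1_truncation_L2 f fourier_L1_truncation_cauchy)
  have "fourier f \<in> L2_space \<and> (\<lambda>n. L2_dist_sq (fourier_L1 (truncation f n)) (fourier f)) \<longlonglongrightarrow> 0"
  proof (cases "integrable lborel f")
    case False
    then have "fourier f = (SOME g. g \<in> L2_space \<and> L2_tendsto (\<lambda>n. fourier_L1 (truncation f n)) g sequentially)"
      unfolding fourier_def fourier_L1_truncations by simp
    moreover have "\<exists>g. g \<in> L2_space \<and> L2_tendsto (\<lambda>n. fourier_L1 (truncation f n)) g sequentially"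
      using ex by (auto simp: L2_tendsto_def)
    ultimately have "fourier f \<in> L2_space \<and> L2_tendsto (\<lambda>n. fourier_L1 (truncation f n)) (fourier f) sequentially"
      using someI_ex[of "\<lambda>g. g \<in> L2_space \<and> L2_tendsto (\<lambda>n. fourier_L1 (truncation f n)) g sequentially"] by simp
    then show ?thesis by (simp add: L2_tendsto_def)
  next
    case True
    then have four: "fourier f = fourier_L1 f" unfolding fourier_def fourier_L1_def[abs_def] by simp
    note [measurable] = borel_measurable_integrable[OF True] fourier_L1_bounded_measurable(2)[OF True]
    have lim: "(\<lambda>n. fourier_L1 (truncation f n) w) \<longlonglongrightarrow> fourier_L1 f w" for w
      unfolding fourier_L1_def
    proof (rule integral_dominated_convergence)
      show "integrable lborel (\<lambda>x. cmod (f x))" using True by simp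
      show "AE x in lborel. (\<lambda>n. truncation f n x * cis (- (2 * pi * w * x))) \<longlonglongrightarrow> f x * cis (- (2 * pi * w * x))"
      proof (intro AE_I2 tendsto_eventually)
        fix x
        obtain N :: nat where N: "\<bar>x\<bar> \<le> real N" using real_arch_simple[of "\<bar>x\<bar>"] by (rule exE)
        have "truncation f n x * cis (- (2 * pi * w * x)) = f x * cis (- (2 * pi * w * x))" if "n \<ge> N" for n
          using N that by (auto simp: truncation_def indicator_def)
        then show "eventually (\<lambda>n. truncation f n x * cis (- (2 * pi * w * x)) = f x * cis (- (2 * pi * w * x))) sequentially"
          unfolding eventually_sequentially by blast
      qed
      show "AE x in lborel. norm (truncation f n x * cis (- (2 * pi * w * x))) \<le> cmod (f x)" for n
        by (intro AE_I2) (auto simp: truncation_def indicator_def norm_mult)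
    qed measurable
    show ?thesis
      unfolding four
      using L2_cauchy_limit_of_subsequence[where r="\<lambda>k. k", OF fourier_L1_truncation_L2(1)[OF f] fourier_L1_bounded_measurable(2)[OF True]
          fourier_L1_truncation_L2(2)[OF f] fourier_L1_truncation_cauchy[OF f] order_refl AE_I2[OF lim]]
      by blast
  qed
  then show "fourier f \<in> L2_space" "(\<lambda>n. L2_dist_sq (fourier_L1 (truncation f n)) (fourier f)) \<longlonglongrightarrow> 0"
    by auto
qed

lemma fourier_L1_shift_sum:
  assumes f: "integrable lborel f" and J: "finite J"
  shows "fourier_L1 (\<lambda>t. \<Sum>j\<in>J. c j * f (t + s j)) w = (\<Sum>j\<in>J. c j * cis (2 * pi * s j * w)) * fourier_L1 f w"
proof -
  have sh: "integrable lborel (\<lambda>t. f (t + r))" for r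
    using lborel_integrable_real_affine[OF f, of 1 r] by (simp add: add.commute)
  have one: "(LINT t|lborel. f (t + r) * cis (- (2 * pi * w * t))) = cis (2 * pi * r * w) * fourier_L1 f w" for r
  proof -
    have "fourier_L1 f w = \<bar>1\<bar> *\<^sub>R (LINT t|lborel. f (r + 1 * t) * cis (- (2 * pi * w * (r + 1 * t))))"
      unfolding fourier_L1_def by (rule lborel_integral_real_affine) simp
    also have "\<dots> = (LINT t|lborel. cis (- (2 * pi * r * w)) * (f (t + r) * cis (- (2 * pi * w * t))))"
    proof -
      have "f (r + 1 * t) * cis (- (2 * pi * w * (r + 1 * t))) = cis (- (2 * pi * r * w)) * (f (t + r) * cis (- (2 * pi * w * t)))" for t
      proof -
        have "cis (- (2 * pi * w * (r + 1 * t))) = cis (- (2 * pi * r * w)) * cis (- (2 * pi * w * t))"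
          unfolding cis_mult by (simp add: algebra_simps)
        then show ?thesis by (simp add: add.commute mult_ac)
      qed
      then show ?thesis by simp
    qed
    also have "\<dots> = cis (- (2 * pi * r * w)) * (LINT t|lborel. f (t + r) * cis (- (2 * pi * w * t)))"
      by (rule Bochner_Integration.integral_mult_right_zero)
    finally have "cis (2 * pi * r * w) * fourier_L1 f w = (cis (2 * pi * r * w) * cis (- (2 * pi * r * w))) * (LINT t|lborel. f (t + r) * cis (- (2 * pi * w * t)))"
      by (simp only: mult.assoc)
    then show ?thesis by (simp add: cis_mult)
  qed
  have "fourier_L1 (\<lambda>t. \<Sum>j\<in>J. c j * f (t + s j)) w = (LINT t|lborel. (\<Sum>j\<in>J. c j * (f (t + s j) * cis (- (2 * pi * w) * t))))"
    unfolding fourier_L1_def by (simp add: sum_distrib_right mult.assoc)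
  also have "\<dots> = (\<Sum>j\<in>J. LINT t|lborel. c j * (f (t + s j) * cis (- (2 * pi * w) * t)))"
    by (intro Bochner_Integration.integral_sum Bochner_Integration.integrable_mult_right integrable_mult_cis sh)
  also have "\<dots> = (\<Sum>j\<in>J. c j * (cis (2 * pi * s j * w) * fourier_L1 f w))"
    using one by simp
  finally show ?thesis by (simp add: sum_distrib_right mult.assoc)
qed

text \<open>
  A translation becomes multiplication by an exponential, and both sides are limits along the
  truncations of \<open>f\<close>.
\<close>

lemma plancherel_shifts:
  assumes f: "continuous_on UNIV f" "f \<in> L2_space" and J: "finite J"
  shows "L2_norm_sq (\<lambda>t. \<Sum>j\<in>J. c j * f (t + s j))
    = (\<integral>\<^sup>+w. sq_mod (\<Sum>j\<in>J. c j * cis (2 * pi * s j * w)) * sq_mod (fourier f w) \<partial>lborel)"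
proof -
  have [measurable]: "f \<in> borel_measurable borel" using f by (simp add: L2_space_def)
  have [measurable]: "fourier f \<in> borel_measurable borel" using fourier_L2_limit(1)[OF f] by (simp add: L2_space_def)
  note [measurable] = fourier_L1_truncation_L2(1)[OF f]
  define m where "m w = (\<Sum>j\<in>J. c j * cis (2 * pi * s j * w))" for w
  have [measurable]: "m \<in> borel_measurable borel" unfolding m_def[abs_def] by measurable
  define h where "h t = (\<Sum>j\<in>J. c j * f (t + s j))" for t
  define hn where "hn n t = (\<Sum>j\<in>J. c j * truncation f n (t + s j))" for n t
  have [measurable]: "h \<in> borel_measurable borel" "hn n \<in> borel_measurable borel" for n
    unfolding h_def[abs_def] hn_def[abs_def] by measurable
  have eq: "L2_norm_sq (\<lambda>w. m w * fourier_L1 (truncation f n) w) = L2_norm_sq (hn n)" for n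
  proof -
    have "fourier_L1 (hn n) w = m w * fourier_L1 (truncation f n) w" for w
      unfolding hn_def[abs_def] m_def by (intro fourier_L1_shift_sum tame_integrable tame_truncation f J)
    then have "(\<lambda>w. m w * fourier_L1 (truncation f n) w) = fourier_L1 (hn n)" by (simp add: fun_eq_iff)
    moreover have "tame (hn n)" unfolding hn_def[abs_def] by (intro tame_sum J tame_cmult_shift tame_truncation f)
    ultimately show ?thesis by (simp add: plancherel_tame)
  qed
  have hlim: "(\<lambda>n. L2_dist_sq (hn n) h) \<longlonglongrightarrow> 0"
  proof -
    have "(\<lambda>n. L2_norm_sq (\<lambda>t. \<Sum>j\<in>J. c j * (truncation f n (t + s j) - f (t + s j)))) \<longlonglongrightarrow> 0"
    proof (rule L2_norm_sq_sum_tendsto_0[OF J])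
      fix j
      have "(\<lambda>n. sq_mod (c j) * L2_dist_sq (truncation f n) f) \<longlonglongrightarrow> sq_mod (c j) * 0"
        by (intro ennreal_tendsto_cmult truncation_tendsto f) auto
      then show "(\<lambda>n. L2_norm_sq (\<lambda>t. c j * (truncation f n (t + s j) - f (t + s j)))) \<longlonglongrightarrow> 0"
        by (subst L2_norm_sq_cmult_shift[of "\<lambda>x. truncation f n x - f x" for n]) auto
    qed measurable
    then show ?thesis by (simp add: hn_def h_def right_diff_distrib sum_subtractf)
  qed
  have mlim: "(\<lambda>n. L2_norm_sq (\<lambda>w. m w * fourier_L1 (truncation f n) w - m w * fourier f w)) \<longlonglongrightarrow> 0"
  proof (rule tendsto_sandwich[OF _ _ tendsto_const])
    define K where "K = (\<Sum>j\<in>J. cmod (c j))"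
    have mK: "cmod (m w) \<le> K" for w
      unfolding m_def K_def by (rule order_trans[OF norm_sum]) (simp add: norm_mult)
    have "(\<lambda>n. ennreal (K\<^sup>2) * L2_dist_sq (fourier_L1 (truncation f n)) (fourier f)) \<longlonglongrightarrow> ennreal (K\<^sup>2) * 0"
      by (intro ennreal_tendsto_cmult fourier_L2_limit f) auto
    then show "(\<lambda>n. ennreal (K\<^sup>2) * L2_dist_sq (fourier_L1 (truncation f n)) (fourier f)) \<longlonglongrightarrow> 0" by simp
    have "L2_norm_sq (\<lambda>w. m w * fourier_L1 (truncation f n) w - m w * fourier f w) \<le> ennreal (K\<^sup>2) * L2_dist_sq (fourier_L1 (truncation f n)) (fourier f)" for n
    proof -
      have "L2_norm_sq (\<lambda>w. m w * fourier_L1 (truncation f n) w - m w * fourier f w)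
          \<le> (\<integral>\<^sup>+w. ennreal (K\<^sup>2) * sq_mod (fourier_L1 (truncation f n) w - fourier f w) \<partial>lborel)"
        unfolding L2_norm_sq_def
      proof (rule nn_integral_mono)
        fix w
        have "(cmod (m w))\<^sup>2 * (cmod (fourier_L1 (truncation f n) w - fourier f w))\<^sup>2 \<le> K\<^sup>2 * (cmod (fourier_L1 (truncation f n) w - fourier f w))\<^sup>2"
          by (intro mult_right_mono power_mono mK) auto
        moreover have "(cmod (m w * fourier_L1 (truncation f n) w - m w * fourier f w))\<^sup>2 = (cmod (m w))\<^sup>2 * (cmod (fourier_L1 (truncation f n) w - fourier f w))\<^sup>2"
          by (simp add: right_diff_distrib[symmetric] norm_mult power_mult_distrib)
        ultimately show "sq_mod (m w * fourier_L1 (truncation f n) w - m w * fourier f w) \<le> ennreal (K\<^sup>2) * sq_mod (fourier_L1 (truncation f n) w - fourier f w)"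
          by (simp add: ennreal_mult[symmetric])
      qed
      also have "\<dots> = ennreal (K\<^sup>2) * L2_dist_sq (fourier_L1 (truncation f n)) (fourier f)"
        unfolding L2_norm_sq_def by (rule nn_integral_cmult) measurable
      finally show ?thesis .
    qed
    then show "eventually (\<lambda>n. L2_norm_sq (\<lambda>w. m w * fourier_L1 (truncation f n) w - m w * fourier f w) \<le> ennreal (K\<^sup>2) * L2_dist_sq (fourier_L1 (truncation f n)) (fourier f)) sequentially"
      by simp
  qed simp
  have "L2_norm_sq h = L2_norm_sq (\<lambda>w. m w * fourier f w)"
  proof (rule antisym)
    show "L2_norm_sq h \<le> L2_norm_sq (\<lambda>w. m w * fourier f w)"
      by (rule L2_isometry_limit[OF _ _ _ _ hlim mlim]) (use eq in auto)
    show "L2_norm_sq (\<lambda>w. m w * fourier f w) \<le> L2_norm_sq h"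
      by (rule L2_isometry_limit[OF _ _ _ _ mlim hlim]) (use eq in auto)
  qed
  also have "\<dots> = (\<integral>\<^sup>+w. sq_mod (m w) * sq_mod (fourier f w) \<partial>lborel)"
    unfolding L2_norm_sq_def by (simp add: norm_mult power_mult_distrib ennreal_mult)
  finally show ?thesis unfolding h_def[abs_def] m_def .
qed

section \<open>Weights tested against trigonometric polynomials\<close>

text \<open>
  Continuous approximants of the indicator are cut off near the endpoints, so that they vanish there
  and \<open>trig_poly_dense\<close> applies. Only the two endpoints are lost.
\<close>

lemma trig_poly_approx_indicator:
  assumes L: "L > 0" and E: "E \<in> sets borel"
  obtains F :: "nat \<Rightarrow> int set" and d where "\<And>n. finite (F n)"
    "\<And>n x. x \<in> {0..L} \<Longrightarrow> cmod (trig_sum (F n) (d n) L x) \<le> 2"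
    "AE x in lborel. x \<in> {0..L} \<longrightarrow> (\<lambda>n. \<Sum>m\<in>F n. d n m * cis (2 * pi * of_int m * x / L)) \<longlonglongrightarrow> indicator E x"
proof -
  have "cmod (indicator E x) \<le> 1" for x by (simp add: indicator_def)
  then obtain g :: "nat \<Rightarrow> real \<Rightarrow> complex" where g: "\<And>k. continuous_on UNIV (g k)" "\<And>k x. cmod (g k x) \<le> 1"
    "AE x in lborel. (\<lambda>k. g k x) \<longlonglongrightarrow> indicator E x"
    using bounded_measurable_approx[of "indicator E" 1] E by auto
  define ct where "ct n x = min 1 (max 0 (real n * min x (L - x)))" for n :: nat and x
  define v where "v n x = complex_of_real (ct n x) * g n x" for n x
  have contv: "continuous_on {0..L} (v n)" for n
    unfolding v_def ct_def by (intro continuous_intros continuous_on_subset[OF g(1)]) auto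
  have vb: "v n 0 = v n L" for n using L by (simp add: v_def ct_def)
  have v1: "cmod (v n x) \<le> 1" for n x
  proof -
    have "cmod (v n x) \<le> 1 * 1"
      unfolding v_def norm_mult by (intro mult_mono g) (auto simp: ct_def)
    then show ?thesis by simp
  qed
  have "\<exists>F d. finite F \<and> (\<forall>x\<in>{0..L}. cmod (v n x - (trig_sum F d L x)) < 1 / real (Suc n))" for n
  proof -
    have "1 / real (Suc n) > 0" by simp
    from trig_poly_dense[OF L contv vb this] show ?thesis by metis
  qed
  then obtain F d where Fd: "\<And>n. finite (F n)"
    "\<And>n x. x \<in> {0..L} \<Longrightarrow> cmod (v n x - (trig_sum (F n) (d n) L x)) < 1 / real (Suc n)"
    by metis
  define T where "T n x = (trig_sum (F n) (d n) L x)" for n x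
  have "cmod (T n x) \<le> 2" if "x \<in> {0..L}" for n x
  proof -
    have "cmod (T n x) \<le> cmod (v n x) + cmod (v n x - T n x)"
      by (metis norm_minus_commute norm_triangle_sub add.commute)
    also have "\<dots> \<le> 1 + 1 / real (Suc n)"
      using v1 Fd(2)[OF that, of n] by (intro add_mono) (auto simp: T_def less_imp_le)
    also have "\<dots> \<le> 2" by simp
    finally show ?thesis .
  qed
  moreover have "AE x in lborel. x \<in> {0..L} \<longrightarrow> (\<lambda>n. T n x) \<longlonglongrightarrow> indicator E x"
    using g(3) AE_lborel_singleton[of 0] AE_lborel_singleton[of L]
  proof eventually_elim
    case (elim x)
    show ?case
    proof
      assume x: "x \<in> {0..L}"
      then have x': "min x (L - x) > 0" using elim by auto
      obtain N :: nat where N: "1 / min x (L - x) \<le> real N" using real_arch_simple by blast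
      have "ct n x = 1" if "n \<ge> N" for n
      proof -
        have "1 / min x (L - x) \<le> real n" using N that by simp
        then have "1 \<le> real n * min x (L - x)" using x' by (simp only: pos_divide_le_eq)
        then show ?thesis by (simp add: ct_def)
      qed
      then have "eventually (\<lambda>n. g n x = v n x) sequentially"
        unfolding eventually_sequentially v_def by (intro exI[of _ N]) simp
      then have vlim: "(\<lambda>n. v n x) \<longlonglongrightarrow> indicator E x"
        by (rule Lim_transform_eventually[OF elim(1)])
      have "(\<lambda>n. v n x - T n x) \<longlonglongrightarrow> 0"
      proof (rule Lim_null_comparison)
        show "eventually (\<lambda>n. norm (v n x - T n x) \<le> 1 / real (Suc n)) sequentially"
          using Fd(2)[OF x] by (intro always_eventually) (auto simp: T_def less_imp_le)
        show "(\<lambda>n. 1 / real (Suc n)) \<longlonglongrightarrow> 0"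
          using LIMSEQ_inverse_real_of_nat by (simp add: inverse_eq_divide)
      qed
      from tendsto_diff[OF vlim this] show "(\<lambda>n. T n x) \<longlonglongrightarrow> indicator E x" by simp
    qed
  qed
  ultimately show ?thesis
    unfolding T_def by (rule that[OF Fd(1)])
qed

lemma trig_poly_weight_tendsto:
  fixes T :: "nat \<Rightarrow> real \<Rightarrow> complex" and H :: "real \<Rightarrow> ennreal"
  assumes [measurable]: "H \<in> borel_measurable borel" "\<And>n. T n \<in> borel_measurable borel" "E \<in> sets borel"
    and fin: "(\<integral>\<^sup>+x\<in>{0..L}. H x \<partial>lborel) < \<infinity>"
    and b: "\<And>n x. x \<in> {0..L} \<Longrightarrow> cmod (T n x) \<le> 2"
    and lim: "AE x in lborel. x \<in> {0..L} \<longrightarrow> (\<lambda>n. T n x) \<longlonglongrightarrow> indicator E x"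
  shows "(\<lambda>n. \<integral>\<^sup>+x. sq_mod (T n x) * H x * indicator {0..L} x \<partial>lborel)
    \<longlonglongrightarrow> (\<integral>\<^sup>+x\<in>{0..L}. indicator E x * H x \<partial>lborel)"
proof (rule nn_integral_dominated_convergence[where w="\<lambda>x. 4 * (H x * indicator {0..L} x)"])
  have "(\<integral>\<^sup>+x. 4 * (H x * indicator {0..L} x) \<partial>lborel) = 4 * (\<integral>\<^sup>+x\<in>{0..L}. H x \<partial>lborel)"
    by (rule nn_integral_cmult) measurable
  then show "(\<integral>\<^sup>+x. 4 * (H x * indicator {0..L} x) \<partial>lborel) < \<infinity>"
    using fin by (simp add: ennreal_mult_less_top)
  show "AE x in lborel. sq_mod (T n x) * H x * indicator {0..L} x \<le> 4 * (H x * indicator {0..L} x)" for n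
  proof (rule AE_I2)
    fix x
    show "sq_mod (T n x) * H x * indicator {0..L} x \<le> 4 * (H x * indicator {0..L} x)"
    proof (cases "x \<in> {0..L}")
      case True
      have "(cmod (T n x))\<^sup>2 \<le> 2\<^sup>2" by (intro power_mono b True) auto
      then have "sq_mod (T n x) \<le> ennreal 4" by (intro ennreal_leI) simp
      then show ?thesis using True by (simp add: mult_right_mono)
    qed simp
  qed
  have H: "AE x in lborel. H x * indicator {0..L} x \<noteq> \<infinity>"
    by (rule nn_integral_PInf_AE) (use fin in auto)
  show "AE x in lborel. (\<lambda>n. sq_mod (T n x) * H x * indicator {0..L} x) \<longlonglongrightarrow> indicator E x * H x * indicator {0..L} x"
    using lim H
  proof eventually_elim
    case (elim x)
    show ?case
    proof (cases "x \<in> {0..L}")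
      case True
      then have l: "(\<lambda>n. T n x) \<longlonglongrightarrow> indicator E x" using elim by simp
      have "(\<lambda>n. (cmod (T n x))\<^sup>2) \<longlonglongrightarrow> (cmod (indicator E x))\<^sup>2"
        by (intro tendsto_intros l)
      from tendsto_ennrealI[OF this] have "(\<lambda>n. sq_mod (T n x)) \<longlonglongrightarrow> indicator E x"
        by (cases "x \<in> E") simp_all
      then have "(\<lambda>n. (H x * indicator {0..L} x) * sq_mod (T n x)) \<longlonglongrightarrow> (H x * indicator {0..L} x) * indicator E x"
        using elim by (intro ennreal_tendsto_cmult) (auto simp: less_top)
      then show ?thesis by (simp add: mult_ac)
    qed simp
  qed
qed measurable

lemma AE_not_in_of_nn_integral_le:
  fixes f g :: "'a \<Rightarrow> ennreal"
  assumes [measurable]: "f \<in> borel_measurable M" "g \<in> borel_measurable M" "E \<in> sets M"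
    and less: "\<And>x. x \<in> E \<Longrightarrow> f x < g x"
    and le: "(\<integral>\<^sup>+x\<in>E. g x \<partial>M) \<le> (\<integral>\<^sup>+x\<in>E. f x \<partial>M)"
    and fin: "(\<integral>\<^sup>+x\<in>E. f x \<partial>M) < \<infinity>"
  shows "AE x in M. x \<notin> E"
proof -
  have "(\<integral>\<^sup>+x\<in>E. g x \<partial>M) = (\<integral>\<^sup>+x. f x * indicator E x + (g x - f x) * indicator E x \<partial>M)"
  proof (rule nn_integral_cong)
    fix x
    show "g x * indicator E x = f x * indicator E x + (g x - f x) * indicator E x"
      using less[of x] by (cases "x \<in> E") (auto simp: less_imp_le add_diff_inverse_ennreal)
  qed
  also have "\<dots> = (\<integral>\<^sup>+x\<in>E. f x \<partial>M) + (\<integral>\<^sup>+x\<in>E. (g x - f x) \<partial>M)"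
    by (rule nn_integral_add) measurable
  finally have "(\<integral>\<^sup>+x\<in>E. f x \<partial>M) + (\<integral>\<^sup>+x\<in>E. (g x - f x) \<partial>M) \<le> (\<integral>\<^sup>+x\<in>E. f x \<partial>M) + 0"
    using le by simp
  then have "(\<integral>\<^sup>+x\<in>E. (g x - f x) \<partial>M) \<le> 0"
    using fin by (subst (asm) ennreal_add_left_cancel_le) auto
  then have "AE x in M. (g x - f x) * indicator E x = 0"
    by (subst nn_integral_0_iff_AE[symmetric]) auto
  then show ?thesis
  proof eventually_elim
    case (elim x)
    show ?case
    proof
      assume x: "x \<in> E"
      then have "g x - f x = 0" using elim by simp
      then have "g x \<le> f x" by (simp add: diff_eq_0_iff_ennreal)
      then show False using less[OF x] by simp
    qed
  qed
qed

text \<open>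
  The inequalities pass from \<open>\<bar>m\<bar>\<^sup>2\<close> for trigonometric polynomials \<open>m\<close> to indicator functions by dominated
  convergence. Testing the indicators of \<open>{H < a}\<close> and \<open>{H > b}\<close> shows that these sets are null.
\<close>

lemma weight_bounds_of_trig_poly:
  fixes H :: "real \<Rightarrow> ennreal"
  assumes L: "L > 0" and [measurable]: "H \<in> borel_measurable borel" and ab: "0 \<le> a" "0 \<le> b"
    and lower: "\<And>(F::int set) d. finite F \<Longrightarrow> ennreal a * (\<integral>\<^sup>+x\<in>{0..L}. sq_mod (trig_sum F d L x) \<partial>lborel)
        \<le> (\<integral>\<^sup>+x\<in>{0..L}. sq_mod (trig_sum F d L x) * H x \<partial>lborel)"
    and upper: "\<And>(F::int set) d. finite F \<Longrightarrow> (\<integral>\<^sup>+x\<in>{0..L}. sq_mod (trig_sum F d L x) * H x \<partial>lborel)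
        \<le> ennreal b * (\<integral>\<^sup>+x\<in>{0..L}. sq_mod (trig_sum F d L x) \<partial>lborel)"
  shows "AE x in lborel. x \<in> {0..L} \<longrightarrow> ennreal a \<le> H x \<and> H x \<le> ennreal b"
proof -
  have fin1: "(\<integral>\<^sup>+x\<in>{0..L}. 1 \<partial>lborel) < (\<infinity>::ennreal)"
    using L by simp
  have finH: "(\<integral>\<^sup>+x\<in>{0..L}. H x \<partial>lborel) < \<infinity>"
  proof -
    have "(\<integral>\<^sup>+x\<in>{0..L}. H x \<partial>lborel) \<le> ennreal b * (\<integral>\<^sup>+x. indicator {0..L} x \<partial>lborel)"
      using upper[of "{0}" "\<lambda>_. 1"] by simp
    also have "\<dots> < \<infinity>" using L by (simp add: ennreal_mult_less_top)
    finally show ?thesis .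
  qed
  have sets: "ennreal a * (\<integral>\<^sup>+x\<in>{0..L}. indicator E x \<partial>lborel) \<le> (\<integral>\<^sup>+x\<in>{0..L}. indicator E x * H x \<partial>lborel)
    \<and> (\<integral>\<^sup>+x\<in>{0..L}. indicator E x * H x \<partial>lborel) \<le> ennreal b * (\<integral>\<^sup>+x\<in>{0..L}. indicator E x \<partial>lborel)"
    if E: "E \<in> sets borel" for E
  proof -
    obtain F :: "nat \<Rightarrow> int set" and d where Fd: "\<And>n. finite (F n)"
      "\<And>n x. x \<in> {0..L} \<Longrightarrow> cmod (trig_sum (F n) (d n) L x) \<le> 2"
      "AE x in lborel. x \<in> {0..L} \<longrightarrow> (\<lambda>n. \<Sum>m\<in>F n. d n m * cis (2 * pi * of_int m * x / L)) \<longlonglongrightarrow> indicator E x"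
      using trig_poly_approx_indicator[OF L E] by blast
    define T where "T n x = (trig_sum (F n) (d n) L x)" for n x
    have [measurable]: "T n \<in> borel_measurable borel" for n unfolding T_def[abs_def] by measurable
    note Fd = Fd[folded T_def]
    have l1: "(\<lambda>n. \<integral>\<^sup>+x. sq_mod (T n x) * indicator {0..L} x \<partial>lborel) \<longlonglongrightarrow> (\<integral>\<^sup>+x\<in>{0..L}. indicator E x \<partial>lborel)"
      using trig_poly_weight_tendsto[of "\<lambda>_. 1" T E, OF _ _ E fin1 Fd(2,3)] by simp
    have lH: "(\<lambda>n. \<integral>\<^sup>+x. sq_mod (T n x) * H x * indicator {0..L} x \<partial>lborel) \<longlonglongrightarrow> (\<integral>\<^sup>+x\<in>{0..L}. indicator E x * H x \<partial>lborel)"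
      using trig_poly_weight_tendsto[of H T E, OF _ _ E finH Fd(2,3)] by simp
    have c: "(\<lambda>n. ennreal r * (\<integral>\<^sup>+x\<in>{0..L}. sq_mod (T n x) \<partial>lborel)) \<longlonglongrightarrow> ennreal r * (\<integral>\<^sup>+x\<in>{0..L}. indicator E x \<partial>lborel)" for r
      by (intro ennreal_tendsto_cmult l1) simp
    show ?thesis
      using LIMSEQ_le[OF c lH] LIMSEQ_le[OF lH c] lower upper Fd(1) unfolding T_def by blast
  qed
  define E1 where "E1 = {x \<in> {0..L}. H x < ennreal a}"
  define E2 where "E2 = {x \<in> {0..L}. ennreal b < H x}"
  have [measurable]: "E1 \<in> sets borel" "E2 \<in> sets borel" unfolding E1_def E2_def by measurable
  have i: "indicator E1 x * indicator {0..L} x = (indicator E1 x :: ennreal)" "indicator E2 x * indicator {0..L} x = (indicator E2 x :: ennreal)" for x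
    by (auto simp: E1_def E2_def indicator_def)
  have iH: "indicator E1 x * H x * indicator {0..L} x = H x * indicator E1 x" "indicator E2 x * H x * indicator {0..L} x = H x * indicator E2 x" for x
    by (auto simp: E1_def E2_def indicator_def)
  have "AE x in lborel. x \<notin> E1"
  proof (rule AE_not_in_of_nn_integral_le[where f=H and g="\<lambda>_. ennreal a"])
    show "(\<integral>\<^sup>+x\<in>E1. ennreal a \<partial>lborel) \<le> (\<integral>\<^sup>+x\<in>E1. H x \<partial>lborel)"
      using sets[of E1] unfolding i iH by (simp add: nn_integral_cmult)
    have "(\<integral>\<^sup>+x\<in>E1. H x \<partial>lborel) \<le> (\<integral>\<^sup>+x\<in>{0..L}. H x \<partial>lborel)"
      by (intro nn_integral_mono) (auto simp: E1_def indicator_def)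
    then show "(\<integral>\<^sup>+x\<in>E1. H x \<partial>lborel) < \<infinity>" using finH by (rule le_less_trans)
  qed (auto simp: E1_def)
  moreover have "AE x in lborel. x \<notin> E2"
  proof (rule AE_not_in_of_nn_integral_le[where f="\<lambda>_. ennreal b" and g=H])
    show "(\<integral>\<^sup>+x\<in>E2. H x \<partial>lborel) \<le> (\<integral>\<^sup>+x\<in>E2. ennreal b \<partial>lborel)"
      using sets[of E2] unfolding i iH by (simp add: nn_integral_cmult)
    have "(\<integral>\<^sup>+x\<in>E2. ennreal b \<partial>lborel) \<le> (\<integral>\<^sup>+x\<in>{0..L}. ennreal b \<partial>lborel)"
      by (intro nn_integral_mono) (auto simp: E2_def indicator_def)
    also have "\<dots> < \<infinity>" using L by (simp add: nn_integral_cmult ennreal_mult_less_top)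
    finally show "(\<integral>\<^sup>+x\<in>E2. ennreal b \<partial>lborel) < \<infinity>" .
  qed (auto simp: E2_def)
  ultimately show ?thesis
    by eventually_elim (auto simp: E1_def E2_def not_less)
qed

section \<open>Shift-invariant spaces in the Fourier domain\<close>

lemma fourier_periodization_nn:
  "fourier_periodization \<phi> p w = (\<integral>\<^sup>+l. sq_mod (fourier \<phi> (w + p * of_int l)) \<partial>count_space UNIV)"
  unfolding fourier_periodization_def by (rule infsum_ennreal_eq_nn_integral)

lemma weighted_periodization_nn:
  "weighted_periodization \<phi> p w = (\<integral>\<^sup>+l. ennreal ((w + p * of_int l)\<^sup>2 * (cmod (fourier \<phi> (w + p * of_int l)))\<^sup>2) \<partial>count_space UNIV)"
  unfolding weighted_periodization_def by (rule infsum_ennreal_eq_nn_integral)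

lemma periodization_measurable:
  assumes [measurable]: "fourier \<phi> \<in> borel_measurable borel"
  shows "fourier_periodization \<phi> p \<in> borel_measurable borel" "weighted_periodization \<phi> p \<in> borel_measurable borel"
  unfolding fourier_periodization_nn[abs_def] weighted_periodization_nn[abs_def] by measurable

lemma cis_periodic:
  assumes "\<beta> > 0"
  shows "cis (2 * pi * of_int l * (w + \<beta> * of_int j) / \<beta>) = cis (2 * pi * of_int l * w / \<beta>)"
proof -
  have "2 * pi * of_int l * (w + \<beta> * of_int j) / \<beta> = 2 * pi * of_int l * w / \<beta> + 2 * pi * of_int (l * j)"
    using assms by (simp add: field_simps)
  then show ?thesis
    using cis_multiple_2pi[of "of_int (l * j)"] by (simp add: cis_mult[symmetric])
qed

text \<open>
  The multiplier of a combination of shifts by multiples of \<open>1 / \<beta>\<close> has period \<open>\<beta>\<close>, so it factors out of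
  the sum over \<open>l\<close> when the Plancherel integral is folded onto \<open>[0, \<beta>]\<close>.
\<close>

lemma L2_norm_sq_shift_combination:
  fixes F :: "int set"
  assumes \<phi>: "continuous_on UNIV \<phi>" "\<phi> \<in> L2_space" and \<beta>: "\<beta> > 0" and F: "finite F"
  shows "L2_norm_sq (\<lambda>t. \<Sum>l\<in>F. c l * \<phi> (t + of_int l / \<beta>))
    = (\<integral>\<^sup>+w\<in>{0..\<beta>}. sq_mod (trig_sum F c \<beta> w) * fourier_periodization \<phi> \<beta> w \<partial>lborel)"
proof -
  have [measurable]: "fourier \<phi> \<in> borel_measurable borel" using fourier_L2_limit(1)[OF \<phi>] by (simp add: L2_space_def)
  define m where "m w = (trig_sum F c \<beta> w)" for w
  have [measurable]: "m \<in> borel_measurable borel" unfolding m_def[abs_def] by measurable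
  have mper: "m (w + \<beta> * of_int j) = m w" for w j
    unfolding m_def cis_periodic[OF \<beta>] ..
  have "L2_norm_sq (\<lambda>t. \<Sum>l\<in>F. c l * \<phi> (t + of_int l / \<beta>)) = (\<integral>\<^sup>+w. sq_mod (m w) * sq_mod (fourier \<phi> w) \<partial>lborel)"
    unfolding plancherel_shifts[OF \<phi> F] m_def by (simp add: mult.assoc)
  also have "\<dots> = (\<integral>\<^sup>+w\<in>{0..0 + \<beta>}. (\<integral>\<^sup>+l. sq_mod (m (w + \<beta> * of_int l)) * sq_mod (fourier \<phi> (w + \<beta> * of_int l)) \<partial>count_space UNIV) \<partial>lborel)"
    by (rule nn_integral_periodization[OF _ \<beta>]) measurable
  also have "\<dots> = (\<integral>\<^sup>+w\<in>{0..\<beta>}. sq_mod (m w) * fourier_periodization \<phi> \<beta> w \<partial>lborel)"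
    unfolding mper fourier_periodization_nn by (simp add: nn_integral_cmult)
  finally show ?thesis unfolding m_def .
qed

lemma norm_cis_minus_1_sq_le: "(cmod (cis x - 1))\<^sup>2 \<le> x\<^sup>2"
proof -
  have "(cmod (cis x - 1))\<^sup>2 = (cos x - 1)\<^sup>2 + (sin x)\<^sup>2"
    by (simp add: cmod_power2)
  also have "\<dots> = (cos x)\<^sup>2 + (sin x)\<^sup>2 + 1 - 2 * cos x" by (simp add: power2_eq_square algebra_simps)
  also have "\<dots> = 2 - 2 * cos (2 * (x / 2))" by simp
  also have "\<dots> = 4 * (sin (x / 2))\<^sup>2" unfolding cos_double_sin by simp
  also have "\<dots> \<le> 4 * (x / 2)\<^sup>2"
  proof -
    have "\<bar>sin (x / 2)\<bar> \<le> \<bar>x / 2\<bar>" by (rule abs_sin_x_le_abs_x)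
    then have "(sin (x / 2))\<^sup>2 \<le> (x / 2)\<^sup>2" by (simp only: abs_le_square_iff)
    then show ?thesis by simp
  qed
  also have "\<dots> = x\<^sup>2" by (simp add: power2_eq_square)
  finally show ?thesis .
qed

text \<open>
  A Bernstein-type inequality. The difference is again a combination of translates of \<open>\<phi>\<close>, now with
  the additional factor \<open>cis (2 \<pi> s w) - 1\<close> in the Fourier domain, of modulus at most \<open>2 \<pi> \<bar>s w\<bar>\<close>.
\<close>

lemma L2_norm_sq_shift_combination_difference:
  fixes F :: "int set" and c :: "int \<Rightarrow> complex"
  assumes \<phi>: "continuous_on UNIV \<phi>" "\<phi> \<in> L2_space" and \<beta>: "\<beta> > 0" and F: "finite F"
  defines "g \<equiv> \<lambda>t. \<Sum>l\<in>F. c l * \<phi> (t + of_int l / \<beta>)"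
  shows "L2_norm_sq (\<lambda>t. g (t + s) - g t)
    \<le> ennreal ((2 * pi * s)\<^sup>2) * (\<integral>\<^sup>+w\<in>{0..\<beta>}. sq_mod (trig_sum F c \<beta> w) * weighted_periodization \<phi> \<beta> w \<partial>lborel)"
proof -
  have [measurable]: "fourier \<phi> \<in> borel_measurable borel" using fourier_L2_limit(1)[OF \<phi>] by (simp add: L2_space_def)
  define m where "m w = (trig_sum F c \<beta> w)" for w
  have [measurable]: "m \<in> borel_measurable borel" unfolding m_def[abs_def] by measurable
  have mper: "m (w + \<beta> * of_int j) = m w" for w j
    unfolding m_def cis_periodic[OF \<beta>] ..
  (* Each shift occurs twice, translated by s with sign + and untranslated with sign -. *)
  define c' where "c' = (\<lambda>(l, b). c l * (if b then 1 else -1))"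
  define r where "r = (\<lambda>(l :: int, b). of_int l / \<beta> + (if b then s else 0))"
  have FJ: "finite (F \<times> (UNIV :: bool set))" using F by simp
  have pairs: "(\<Sum>j\<in>F \<times> UNIV. f j) = (\<Sum>l\<in>F. f (l, True) + f (l, False))" for f :: "int \<times> bool \<Rightarrow> complex"
  proof -
    have "(\<Sum>j\<in>F \<times> UNIV. f j) = (\<Sum>l\<in>F. \<Sum>b\<in>UNIV. f (l, b))"
      by (simp add: sum.cartesian_product)
    then show ?thesis by (simp add: UNIV_bool add.commute)
  qed
  have "g (t + s) - g t = (\<Sum>j\<in>F \<times> UNIV. c' j * \<phi> (t + r j))" for t
    unfolding pairs g_def c'_def r_def sum_subtractf[symmetric]
    by (intro sum.cong refl) (simp add: add_ac)
  then have "L2_norm_sq (\<lambda>t. g (t + s) - g t) = L2_norm_sq (\<lambda>t. \<Sum>j\<in>F \<times> UNIV. c' j * \<phi> (t + r j))"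
    by simp
  also have "\<dots> = (\<integral>\<^sup>+w. sq_mod (\<Sum>j\<in>F \<times> UNIV. c' j * cis (2 * pi * r j * w)) * sq_mod (fourier \<phi> w) \<partial>lborel)"
    by (rule plancherel_shifts[OF \<phi> FJ])
  also have "\<dots> \<le> (\<integral>\<^sup>+w. ennreal ((2 * pi * s)\<^sup>2) * (sq_mod (m w) * ennreal (w\<^sup>2 * (cmod (fourier \<phi> w))\<^sup>2)) \<partial>lborel)"
  proof (rule nn_integral_mono)
    fix w
    have "(\<Sum>j\<in>F \<times> UNIV. c' j * cis (2 * pi * r j * w)) = m w * (cis (2 * pi * s * w) - 1)"
    proof -
      have "(\<Sum>j\<in>F \<times> UNIV. c' j * cis (2 * pi * r j * w)) = (\<Sum>l\<in>F. c l * cis (2 * pi * of_int l * w / \<beta>) * (cis (2 * pi * s * w) - 1))"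
        unfolding pairs c'_def r_def
      proof (rule sum.cong[OF refl])
        fix l assume "l \<in> F"
        have "cis (2 * pi * (of_int l / \<beta> + s) * w) = cis (2 * pi * of_int l * w / \<beta>) * cis (2 * pi * s * w)"
          unfolding cis_mult by (simp add: distrib_left distrib_right)
        then show "(case (l, True) of (l, b) \<Rightarrow> c l * (if b then 1 else - 1)) * cis (2 * pi * (case (l, True) of (l, b) \<Rightarrow> of_int l / \<beta> + (if b then s else 0)) * w)
            + (case (l, False) of (l, b) \<Rightarrow> c l * (if b then 1 else - 1)) * cis (2 * pi * (case (l, False) of (l, b) \<Rightarrow> of_int l / \<beta> + (if b then s else 0)) * w)
          = c l * cis (2 * pi * of_int l * w / \<beta>) * (cis (2 * pi * s * w) - 1)"
          by (simp add: algebra_simps)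
      qed
      then show ?thesis unfolding m_def sum_distrib_right .
    qed
    then have "(cmod (\<Sum>j\<in>F \<times> UNIV. c' j * cis (2 * pi * r j * w)))\<^sup>2 = (cmod (m w))\<^sup>2 * (cmod (cis (2 * pi * s * w) - 1))\<^sup>2"
      by (simp add: norm_mult power_mult_distrib)
    also have "\<dots> \<le> (cmod (m w))\<^sup>2 * (2 * pi * s * w)\<^sup>2"
      by (intro mult_left_mono norm_cis_minus_1_sq_le) auto
    finally have "(cmod (\<Sum>j\<in>F \<times> UNIV. c' j * cis (2 * pi * r j * w)))\<^sup>2 * (cmod (fourier \<phi> w))\<^sup>2
      \<le> (cmod (m w))\<^sup>2 * (2 * pi * s * w)\<^sup>2 * (cmod (fourier \<phi> w))\<^sup>2"
      by (rule mult_right_mono) simp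
    also have "\<dots> = (2 * pi * s)\<^sup>2 * ((cmod (m w))\<^sup>2 * (w\<^sup>2 * (cmod (fourier \<phi> w))\<^sup>2))"
      by (simp only: power_mult_distrib mult_ac)
    finally show "sq_mod (\<Sum>j\<in>F \<times> UNIV. c' j * cis (2 * pi * r j * w)) * sq_mod (fourier \<phi> w)
      \<le> ennreal ((2 * pi * s)\<^sup>2) * (sq_mod (m w) * ennreal (w\<^sup>2 * (cmod (fourier \<phi> w))\<^sup>2))"
      by (simp only: ennreal_mult[symmetric] zero_le_power2 mult_nonneg_nonneg ennreal_leI)
  qed
  also have "\<dots> = ennreal ((2 * pi * s)\<^sup>2) * (\<integral>\<^sup>+w. sq_mod (m w) * ennreal (w\<^sup>2 * (cmod (fourier \<phi> w))\<^sup>2) \<partial>lborel)"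
    by (rule nn_integral_cmult) measurable
  also have "(\<integral>\<^sup>+w. sq_mod (m w) * ennreal (w\<^sup>2 * (cmod (fourier \<phi> w))\<^sup>2) \<partial>lborel)
    = (\<integral>\<^sup>+w\<in>{0..0 + \<beta>}. (\<integral>\<^sup>+l. sq_mod (m (w + \<beta> * of_int l)) * ennreal ((w + \<beta> * of_int l)\<^sup>2 * (cmod (fourier \<phi> (w + \<beta> * of_int l)))\<^sup>2) \<partial>count_space UNIV) \<partial>lborel)"
    by (rule nn_integral_periodization[OF _ \<beta>]) measurable
  also have "\<dots> = (\<integral>\<^sup>+w\<in>{0..\<beta>}. sq_mod (m w) * weighted_periodization \<phi> \<beta> w \<partial>lborel)"
    unfolding mper weighted_periodization_nn by (simp add: nn_integral_cmult)
  finally show ?thesis unfolding m_def .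
qed

text \<open>
  In the Fourier domain the Riesz basis inequalities are inequalities between \<open>\<integral> \<bar>m\<bar>\<^sup>2 G\<close> and \<open>\<integral> \<bar>m\<bar>\<^sup>2\<close> over
  \<open>[0, \<beta>]\<close>. The factor \<open>1 / \<beta>\<close> is the normalisation of the exponentials on that interval.
\<close>

lemma stable_generator_periodization_bounds:
  assumes \<phi>: "continuous_on UNIV \<phi>" "\<phi> \<in> L2_space" and \<beta>: "\<beta> > 0" and stable: "stable_generator (1 / \<beta>) \<phi>"
  obtains a b where "0 < a" "0 < b"
    "AE w in lborel. w \<in> {0..\<beta>} \<longrightarrow> ennreal a \<le> fourier_periodization \<phi> \<beta> w \<and> fourier_periodization \<phi> \<beta> w \<le> ennreal b"
proof -
  have [measurable]: "fourier \<phi> \<in> borel_measurable borel" using fourier_L2_limit(1)[OF \<phi>] by (simp add: L2_space_def)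
  obtain a b where ab: "0 < a" "0 < b" and riesz: "\<And>F c. finite F \<Longrightarrow>
      ennreal (a * (\<Sum>i\<in>F. (cmod (c i))\<^sup>2)) \<le> L2_norm_sq (\<lambda>x. \<Sum>i\<in>F. c i * shift_system (1 / \<beta>) \<phi> i x) \<and>
      L2_norm_sq (\<lambda>x. \<Sum>i\<in>F. c i * shift_system (1 / \<beta>) \<phi> i x) \<le> ennreal (b * (\<Sum>i\<in>F. (cmod (c i))\<^sup>2))"
    using stable unfolding stable_generator_def riesz_basis_L2_def by blast
  (* The shift system translates by negative multiples of 1 / \<beta>, hence the reflection of F. *)
  have bounds: "ennreal (a * (\<Sum>l\<in>F. (cmod (d l))\<^sup>2)) \<le> L2_norm_sq (\<lambda>t. \<Sum>l\<in>F. d l * \<phi> (t + of_int l / \<beta>)) \<and>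
      L2_norm_sq (\<lambda>t. \<Sum>l\<in>F. d l * \<phi> (t + of_int l / \<beta>)) \<le> ennreal (b * (\<Sum>l\<in>F. (cmod (d l))\<^sup>2))"
    if F: "finite F" for F d
  proof -
    have "(\<Sum>i\<in>uminus ` F. d (- i) * shift_system (1 / \<beta>) \<phi> i x) = (\<Sum>l\<in>F. d l * \<phi> (x + of_int l / \<beta>))" for x
      by (subst sum.reindex) (auto simp: shift_system_def)
    moreover have "(\<Sum>i\<in>uminus ` F. (cmod (d (- i)))\<^sup>2) = (\<Sum>l\<in>F. (cmod (d l))\<^sup>2)"
      by (subst sum.reindex) auto
    ultimately show ?thesis
      using riesz[of "uminus ` F" "\<lambda>i. d (- i)"] F by simp
  qed
  have conv: "ennreal (r / \<beta>) * (\<integral>\<^sup>+x\<in>{0..\<beta>}. sq_mod (trig_sum F d \<beta> x) \<partial>lborel)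
      = ennreal (r * (\<Sum>m\<in>F. (cmod (d m))\<^sup>2))" if "finite F" "r > 0" for F :: "int set" and d r
    unfolding trig_poly_norm_sq[OF \<beta> that(1)] using \<beta> that
    by (simp add: ennreal_mult[symmetric] sum_nonneg)
  have "AE w in lborel. w \<in> {0..\<beta>} \<longrightarrow> ennreal (a / \<beta>) \<le> fourier_periodization \<phi> \<beta> w \<and> fourier_periodization \<phi> \<beta> w \<le> ennreal (b / \<beta>)"
    by (rule weight_bounds_of_trig_poly[OF \<beta>])
      (use ab \<beta> in \<open>auto simp: periodization_measurable conv L2_norm_sq_shift_combination[OF \<phi> \<beta>, symmetric] bounds\<close>)
  then show ?thesis
    using that[of "a / \<beta>" "b / \<beta>"] ab \<beta> by simp
qed

section \<open>The frame inequality for continuous functions of compact support\<close>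

text \<open>
  With \<open>\<theta> = 2 \<alpha> \<surd>M\<close> one has \<open>2 \<pi> s \<surd>M = s (\<pi> \<theta> / \<alpha>)\<close>, so the bound on translates is the hypothesis of
  \<open>sampling_inequality\<close>.
\<close>

lemma sampling_shift_combination:
  fixes F :: "int set" and c :: "int \<Rightarrow> complex" and x :: real
  assumes \<phi>: "continuous_on UNIV \<phi>" "\<phi> \<in> L2_space" and \<alpha>: "\<alpha> > 0" and \<beta>: "\<beta> > 0" and F: "finite F"
    and M: "0 < M" "2 * \<alpha> * sqrt M < 1" and B: "B < \<infinity>"
    and bounds: "AE w in lborel. w \<in> {0..\<beta>} \<longrightarrow> A \<le> fourier_periodization \<phi> \<beta> w \<and> fourier_periodization \<phi> \<beta> w \<le> B
      \<and> weighted_periodization \<phi> \<beta> w \<le> ennreal M * fourier_periodization \<phi> \<beta> w"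
  defines "S \<equiv> \<integral>\<^sup>+k. sq_mod (\<Sum>l\<in>F. c l * \<phi> (x + \<alpha> * of_int k + of_int l / \<beta>)) \<partial>count_space UNIV"
    and "\<sigma> \<equiv> ennreal (\<beta> * (\<Sum>l\<in>F. (cmod (c l))\<^sup>2))"
  shows "ennreal ((1 - 2 * \<alpha> * sqrt M)\<^sup>2) * (A * \<sigma>) \<le> ennreal \<alpha> * S"
    and "ennreal \<alpha> * S \<le> ennreal ((1 + 2 * \<alpha> * sqrt M)\<^sup>2) * (B * \<sigma>)"
proof -
  have [measurable]: "fourier \<phi> \<in> borel_measurable borel" using fourier_L2_limit(1)[OF \<phi>] by (simp add: L2_space_def)
  note [measurable] = periodization_measurable[OF this]
  define m where "m w = (trig_sum F c \<beta> w)" for w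
  have [measurable]: "m \<in> borel_measurable borel" unfolding m_def[abs_def] by measurable
  define g where "g t = (\<Sum>l\<in>F. c l * \<phi> (t + of_int l / \<beta>))" for t
  define \<theta> where "\<theta> = 2 * \<alpha> * sqrt M"
  have \<theta>: "0 < \<theta>" "\<theta> < 1" using M \<alpha> by (auto simp: \<theta>_def)
  have \<sigma>: "(\<integral>\<^sup>+w\<in>{0..\<beta>}. sq_mod (m w) \<partial>lborel) = \<sigma>"
    unfolding m_def \<sigma>_def by (rule trig_poly_norm_sq[OF \<beta> F])
  have gnorm: "L2_norm_sq g = (\<integral>\<^sup>+w\<in>{0..\<beta>}. sq_mod (m w) * fourier_periodization \<phi> \<beta> w \<partial>lborel)"
    unfolding g_def m_def by (rule L2_norm_sq_shift_combination[OF \<phi> \<beta> F])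
  have cont: "continuous_on UNIV g"
    unfolding g_def by (intro continuous_intros continuous_on_compose2[OF \<phi>(1)]) auto
  have "L2_norm_sq g \<le> (\<integral>\<^sup>+w. B * (sq_mod (m w) * indicator {0..\<beta>} w) \<partial>lborel)"
    unfolding gnorm
  proof (rule nn_integral_mono_AE)
    show "AE w in lborel. sq_mod (m w) * fourier_periodization \<phi> \<beta> w * indicator {0..\<beta>} w \<le> B * (sq_mod (m w) * indicator {0..\<beta>} w)"
      using bounds by eventually_elim (auto simp: indicator_def mult.commute intro!: mult_left_mono mult_right_mono)
  qed
  also have "\<dots> = B * \<sigma>"
    unfolding \<sigma>[symmetric] by (rule nn_integral_cmult) measurable
  finally have gB: "L2_norm_sq g \<le> B * \<sigma>" .
  have "(\<integral>\<^sup>+w. A * (sq_mod (m w) * indicator {0..\<beta>} w) \<partial>lborel) \<le> L2_norm_sq g"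
    unfolding gnorm
  proof (rule nn_integral_mono_AE)
    show "AE w in lborel. A * (sq_mod (m w) * indicator {0..\<beta>} w) \<le> sq_mod (m w) * fourier_periodization \<phi> \<beta> w * indicator {0..\<beta>} w"
      using bounds by eventually_elim (auto simp: indicator_def mult.commute intro!: mult_left_mono mult_right_mono)
  qed
  moreover have "(\<integral>\<^sup>+w. A * (sq_mod (m w) * indicator {0..\<beta>} w) \<partial>lborel) = A * \<sigma>"
    unfolding \<sigma>[symmetric] by (rule nn_integral_cmult) measurable
  ultimately have gA: "A * \<sigma> \<le> L2_norm_sq g" by simp
  have fin: "L2_norm_sq g < \<infinity>"
    using gB B by (auto simp: \<sigma>_def ennreal_mult_less_top intro: le_less_trans)
  have shift: "L2_norm_sq (\<lambda>t. g (t + s) - g t) \<le> ennreal ((s * (pi * \<theta> / \<alpha>))\<^sup>2) * L2_norm_sq g" for s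
  proof -
    have "L2_norm_sq (\<lambda>t. g (t + s) - g t) \<le> ennreal ((2 * pi * s)\<^sup>2) * (\<integral>\<^sup>+w\<in>{0..\<beta>}. sq_mod (m w) * weighted_periodization \<phi> \<beta> w \<partial>lborel)"
      unfolding g_def m_def by (rule L2_norm_sq_shift_combination_difference[OF \<phi> \<beta> F])
    also have "(\<integral>\<^sup>+w\<in>{0..\<beta>}. sq_mod (m w) * weighted_periodization \<phi> \<beta> w \<partial>lborel)
        \<le> (\<integral>\<^sup>+w. ennreal M * (sq_mod (m w) * fourier_periodization \<phi> \<beta> w * indicator {0..\<beta>} w) \<partial>lborel)"
    proof (rule nn_integral_mono_AE)
      show "AE w in lborel. sq_mod (m w) * weighted_periodization \<phi> \<beta> w * indicator {0..\<beta>} w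
          \<le> ennreal M * (sq_mod (m w) * fourier_periodization \<phi> \<beta> w * indicator {0..\<beta>} w)"
        using bounds by eventually_elim
          (auto simp: indicator_def mult.left_commute[of "ennreal M" "ennreal ((cmod _)\<^sup>2)"] intro!: mult_left_mono)
    qed
    also have "\<dots> = ennreal M * L2_norm_sq g"
      unfolding gnorm by (rule nn_integral_cmult) measurable
    finally have "L2_norm_sq (\<lambda>t. g (t + s) - g t) \<le> ennreal ((2 * pi * s)\<^sup>2) * (ennreal M * L2_norm_sq g)"
      by (simp add: mult_left_mono)
    also have "\<dots> = ennreal ((2 * pi * s)\<^sup>2 * M) * L2_norm_sq g"
      using M by (simp add: ennreal_mult mult.assoc)
    also have "(2 * pi * s)\<^sup>2 * M = (s * (pi * \<theta> / \<alpha>))\<^sup>2"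
      using M \<alpha> by (simp add: \<theta>_def power_mult_distrib)
    finally show ?thesis .
  qed
  have Seq: "S = (\<integral>\<^sup>+k. sq_mod (g (x + \<alpha> * of_int k)) \<partial>count_space UNIV)"
    unfolding S_def g_def ..
  note samp = sampling_inequality[OF \<alpha> cont fin \<theta> shift, of x, folded Seq]
  have "ennreal ((1 - \<theta>)\<^sup>2) * (A * \<sigma>) \<le> ennreal ((1 - \<theta>)\<^sup>2) * L2_norm_sq g"
    by (intro mult_left_mono gA) simp
  also have "\<dots> \<le> ennreal \<alpha> * S" by (rule samp(2))
  finally show "ennreal ((1 - 2 * \<alpha> * sqrt M)\<^sup>2) * (A * \<sigma>) \<le> ennreal \<alpha> * S" unfolding \<theta>_def .
  have "ennreal \<alpha> * S \<le> ennreal ((1 + \<theta>)\<^sup>2) * L2_norm_sq g" by (rule samp(1))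
  also have "\<dots> \<le> ennreal ((1 + \<theta>)\<^sup>2) * (B * \<sigma>)" by (intro mult_left_mono gB) simp
  finally show "ennreal \<alpha> * S \<le> ennreal ((1 + 2 * \<alpha> * sqrt M)\<^sup>2) * (B * \<sigma>)" unfolding \<theta>_def .
qed

lemma integral_consecutive_intervals:
  fixes q :: "real \<Rightarrow> complex"
  assumes q: "continuous_on UNIV q" and h: "h > 0"
  shows "integral {a..a + real n * h} q = (\<Sum>j<n. integral {0..h} (\<lambda>x. q (x + (a + real j * h))))"
proof (induction n)
  case (Suc n)
  have i: "q integrable_on {a..b}" for a b
    by (intro integrable_continuous_interval continuous_on_subset[OF q]) auto
  have "integral {a..a + real (Suc n) * h} q = integral {a..a + real n * h} q + integral {a + real n * h..a + real (Suc n) * h} q"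
    using h by (intro Henstock_Kurzweil_Integration.integral_combine[symmetric] i) (auto simp: algebra_simps)
  also have "integral {a + real n * h..a + real (Suc n) * h} q = integral {0..h} (\<lambda>x. q (x + (a + real n * h)))"
    using integral_shift_Icc_real[of 0 h q "a + real n * h"] by (simp add: o_def algebra_simps)
  finally show ?case using Suc by simp
qed simp

text \<open>
  The explicit finite range of \<open>l\<close> keeps the periodization of a continuous function continuous.
\<close>

lemma integral_compact_support_periodized:
  fixes q :: "real \<Rightarrow> complex"
  assumes q: "continuous_on UNIV q" and h: "h > 0" and supp: "\<And>x. \<bar>x\<bar> > R \<Longrightarrow> q x = 0" and N: "R < real N * h"
  shows "(LINT x|lborel. q x) = integral {0..h} (\<lambda>x. \<Sum>l\<in>{- int N..int N}. q (x + of_int l * h))"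
proof -
  have i: "(\<lambda>x. q (x + c)) integrable_on {a..b}" for a b c
    by (intro integrable_continuous_interval continuous_on_compose2[OF q] continuous_intros) auto
  let ?I = "{- (real N * h)..- (real N * h) + real (2 * N + 1) * h}"
  have out: "q x = 0" if "x \<notin> ?I" for x
    using that h N by (intro supp) (auto simp: algebra_simps)
  have "(LINT x|lborel. q x) = (LINT x:?I|lborel. q x)"
    unfolding set_lebesgue_integral_def by (intro Bochner_Integration.integral_cong refl) (use out in \<open>auto simp: indicator_def\<close>)
  also have "\<dots> = integral ?I q"
    by (intro set_borel_integral_eq_integral(2) borel_integrable_atLeastAtMost' continuous_on_subset[OF q]) auto
  also have "\<dots> = (\<Sum>j<2 * N + 1. integral {0..h} (\<lambda>x. q (x + (- (real N * h) + real j * h))))"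
    by (rule integral_consecutive_intervals[OF q h])
  also have "\<dots> = (\<Sum>l\<in>{- int N..int N}. integral {0..h} (\<lambda>x. q (x + of_int l * h)))"
    by (rule sum.reindex_bij_witness[of _ "\<lambda>l. nat (l + int N)" "\<lambda>j. int j - int N"]) (auto simp: algebra_simps)
  also have "\<dots> = integral {0..h} (\<lambda>x. \<Sum>l\<in>{- int N..int N}. q (x + of_int l * h))"
    by (rule Henstock_Kurzweil_Integration.integral_sum[symmetric]) (auto intro: i)
  finally show ?thesis .
qed

text \<open>
  For fixed \<open>k\<close> the coefficients are the Fourier coefficients of the periodization \<open>P k\<close> of
  \<open>f \<cdot> cnj (\<phi> (\<cdot> - \<alpha> k))\<close>, to which Parseval applies in \<open>m\<close>. Replacing \<open>k\<close> by \<open>- k\<close> exhibits the conjugate of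
  \<open>P k\<close> as a combination of shifts of \<open>\<phi>\<close>, sampled at \<open>x + \<alpha> k\<close>.
\<close>

lemma gabor_coefficient_sum:
  assumes \<phi>: "continuous_on UNIV \<phi>" and \<alpha>: "\<alpha> > 0" and \<beta>: "\<beta> > 0"
    and f: "continuous_on UNIV f" and supp: "\<And>x. \<bar>x\<bar> > R \<Longrightarrow> f x = 0" and N: "R < real N / \<beta>"
  shows "(\<integral>\<^sup>+i. sq_mod (L2_inner f (gabor_system \<phi> \<alpha> \<beta> i)) \<partial>count_space UNIV)
    = (\<integral>\<^sup>+x. ennreal (1 / \<beta>) * (\<integral>\<^sup>+k. sq_mod (\<Sum>l\<in>{- int N..int N}. cnj (f (x + of_int l / \<beta>)) * \<phi> (x + \<alpha> * of_int k + of_int l / \<beta>)) \<partial>count_space UNIV)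
        * indicator {0..1 / \<beta>} x \<partial>lborel)"
proof -
  define h where "h = 1 / \<beta>"
  have h: "h > 0" using \<beta> by (simp add: h_def)
  have N': "R < real N * h" using N by (simp add: h_def)
  let ?F = "{- int N..int N}"
  define q where "q k x = f x * cnj (\<phi> (x - \<alpha> * of_int k))" for k :: int and x
  define P where "P k x = (\<Sum>l\<in>?F. q k (x + of_int l * h))" for k x
  have qc: "continuous_on UNIV (q k)" for k
    unfolding q_def by (intro continuous_intros f continuous_on_compose2[OF \<phi>]) auto
  have qs: "q k x = 0" if "\<bar>x\<bar> > R" for k x using supp[OF that] by (simp add: q_def)
  have Pc: "continuous_on A (P k)" for k A
    unfolding P_def by (intro continuous_intros continuous_on_compose2[OF qc]) auto
  have [measurable]: "P k \<in> borel_measurable borel" for k by (rule borel_measurable_continuous_onI[OF Pc])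
  have Pper: "P k 0 = P k h" for k
  proof -
    have "P k h = (\<Sum>l\<in>{- int N + 1..int N + 1}. q k (of_int l * h))"
      unfolding P_def by (rule sum.reindex_bij_witness[of _ "\<lambda>l. l - 1" "\<lambda>l. l + 1"]) (auto simp: algebra_simps)
    also have "\<dots> = (\<Sum>l\<in>{- int N..int N + 1}. q k (of_int l * h))"
    proof (rule sum.mono_neutral_left)
      show "\<forall>l\<in>{- int N..int N + 1} - {- int N + 1..int N + 1}. q k (of_int l * h) = 0"
      proof
        fix l assume "l \<in> {- int N..int N + 1} - {- int N + 1..int N + 1}"
        then have "l = - int N" by auto
        then show "q k (of_int l * h) = 0" using N' h by (intro qs) (auto simp: abs_mult)
      qed
    qed auto
    also have "\<dots> = (\<Sum>l\<in>{- int N..int N}. q k (of_int l * h))"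
    proof (rule sum.mono_neutral_right)
      show "\<forall>l\<in>{- int N..int N + 1} - {- int N..int N}. q k (of_int l * h) = 0"
      proof
        fix l assume "l \<in> {- int N..int N + 1} - {- int N..int N}"
        then have "l = int N + 1" by auto
        then show "q k (of_int l * h) = 0" using N' h by (intro qs) (auto simp: abs_mult algebra_simps)
      qed
    qed auto
    finally show ?thesis by (simp add: P_def)
  qed
  have inner: "L2_inner f (gabor_system \<phi> \<alpha> \<beta> (k, m)) = integral {0..h} (\<lambda>x. P k x * cis (- (2 * pi * of_int m * x / h)))" for k m
  proof -
    define q' where "q' x = q k x * cis (- (2 * pi * of_int m * x / h))" for x
    have q'c: "continuous_on UNIV q'"
      unfolding q'_def using h by (intro continuous_intros qc) auto
    have q's: "q' x = 0" if "\<bar>x\<bar> > R" for x using qs[OF that] by (simp add: q'_def)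
    have "L2_inner f (gabor_system \<phi> \<alpha> \<beta> (k, m)) = (LINT x|lborel. q' x)"
      unfolding L2_inner_def gabor_system_def q'_def q_def h_def
      by (intro Bochner_Integration.integral_cong refl) (simp add: cis_cnj mult_ac)
    also have "\<dots> = integral {0..h} (\<lambda>x. \<Sum>l\<in>?F. q' (x + of_int l * h))"
      by (rule integral_compact_support_periodized[OF q'c h q's N'])
    also have "\<dots> = integral {0..h} (\<lambda>x. P k x * cis (- (2 * pi * of_int m * x / h)))"
    proof -
      have "cis (- (2 * pi * of_int m * (x + of_int l * h) / h)) = cis (- (2 * pi * of_int m * x / h))" for x l
      proof -
        have "cis (2 * pi * of_int (- m) * (x + h * of_int l) / h) = cis (2 * pi * of_int (- m) * x / h)"
          by (rule cis_periodic[OF h])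
        then show ?thesis by (simp add: mult.commute)
      qed
      then show ?thesis unfolding q'_def P_def sum_distrib_right by simp
    qed
    finally show ?thesis .
  qed
  have "(\<integral>\<^sup>+i. sq_mod (L2_inner f (gabor_system \<phi> \<alpha> \<beta> i)) \<partial>count_space UNIV)
     = (\<integral>\<^sup>+k. (\<integral>\<^sup>+m. sq_mod (L2_inner f (gabor_system \<phi> \<alpha> \<beta> (k, m))) \<partial>count_space UNIV) \<partial>count_space UNIV)"
    by (rule nn_integral_fst_count_space[symmetric])
  also have "\<dots> = (\<integral>\<^sup>+k. (\<integral>\<^sup>+x. ennreal h * (sq_mod (P k x) * indicator {0..h} x) \<partial>lborel) \<partial>count_space UNIV)"
    unfolding inner parseval_interval[OF h Pc Pper] by (subst nn_integral_cmult) auto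
  also have "\<dots> = (\<integral>\<^sup>+x. (\<integral>\<^sup>+k. ennreal h * (sq_mod (P k x) * indicator {0..h} x) \<partial>count_space UNIV) \<partial>lborel)"
    by (rule nn_integral_count_space_nn_integral[symmetric]) auto
  also have "\<dots> = (\<integral>\<^sup>+x\<in>{0..h}. ennreal h * (\<integral>\<^sup>+k. sq_mod (P k x) \<partial>count_space UNIV) \<partial>lborel)"
    by (simp add: nn_integral_cmult nn_integral_multc mult.assoc)
  also have "\<dots> = (\<integral>\<^sup>+x. ennreal h * (\<integral>\<^sup>+k. sq_mod (\<Sum>l\<in>?F. cnj (f (x + of_int l / \<beta>)) * \<phi> (x + \<alpha> * of_int k + of_int l / \<beta>)) \<partial>count_space UNIV)
        * indicator {0..h} x \<partial>lborel)"
  proof (rule nn_integral_cong)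
    fix x
    have "(\<integral>\<^sup>+k. sq_mod (P k x) \<partial>count_space UNIV) = (\<integral>\<^sup>+k. sq_mod (P (- k) x) \<partial>count_space UNIV)"
      by (rule nn_integral_bij_count_space[symmetric]) (auto simp: bij_uminus)
    also have "\<dots> = (\<integral>\<^sup>+k. sq_mod (\<Sum>l\<in>?F. cnj (f (x + of_int l / \<beta>)) * \<phi> (x + \<alpha> * of_int k + of_int l / \<beta>)) \<partial>count_space UNIV)"
    proof (rule nn_integral_cong)
      fix k :: int
      have "P (- k) x = cnj (\<Sum>l\<in>?F. cnj (f (x + of_int l / \<beta>)) * \<phi> (x + \<alpha> * of_int k + of_int l / \<beta>))"
        unfolding P_def q_def h_def cnj_sum by (intro sum.cong refl) (simp add: add_ac)
      then show "sq_mod (P (- k) x) = sq_mod (\<Sum>l\<in>?F. cnj (f (x + of_int l / \<beta>)) * \<phi> (x + \<alpha> * of_int k + of_int l / \<beta>))"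
        by (simp only: complex_mod_cnj)
    qed
    finally show "ennreal h * (\<integral>\<^sup>+k. sq_mod (P k x) \<partial>count_space UNIV) * indicator {0..h} x
      = ennreal h * (\<integral>\<^sup>+k. sq_mod (\<Sum>l\<in>?F. cnj (f (x + of_int l / \<beta>)) * \<phi> (x + \<alpha> * of_int k + of_int l / \<beta>)) \<partial>count_space UNIV) * indicator {0..h} x"
      by simp
  qed
  finally show ?thesis unfolding h_def .
qed

lemma L2_norm_sq_compact_support_periodized:
  assumes h: "h > 0" and f: "f \<in> borel_measurable borel" and supp: "\<And>x. \<bar>x\<bar> > R \<Longrightarrow> f x = 0" and N: "R < real N * h"
  shows "L2_norm_sq f = (\<integral>\<^sup>+x\<in>{0..h}. ennreal (\<Sum>l\<in>{- int N..int N}. (cmod (f (x + of_int l * h)))\<^sup>2) \<partial>lborel)"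
proof -
  note [measurable] = f
  have "L2_norm_sq f = (\<integral>\<^sup>+x\<in>{0..0 + h}. (\<integral>\<^sup>+l. sq_mod (f (x + h * of_int l)) \<partial>count_space UNIV) \<partial>lborel)"
    unfolding L2_norm_sq_def by (rule nn_integral_periodization[OF _ h]) measurable
  also have "\<dots> = (\<integral>\<^sup>+x\<in>{0..h}. ennreal (\<Sum>l\<in>{- int N..int N}. (cmod (f (x + of_int l * h)))\<^sup>2) \<partial>lborel)"
  proof (rule nn_integral_cong)
    fix x
    show "(\<integral>\<^sup>+l. sq_mod (f (x + h * of_int l)) \<partial>count_space UNIV) * indicator {0..0 + h} x
      = ennreal (\<Sum>l\<in>{- int N..int N}. (cmod (f (x + of_int l * h)))\<^sup>2) * indicator {0..h} x"
    proof (cases "x \<in> {0..h}")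
      case True
      have z: "f (x + h * of_int l) = 0" if "l \<notin> {- int N..int N}" for l
      proof (rule supp)
        have "l \<ge> int N + 1 \<or> l \<le> - int N - 1" using that by auto
        then show "R < \<bar>x + h * of_int l\<bar>"
        proof
          assume "l \<ge> int N + 1"
          then have "real_of_int l \<ge> real N + 1" by linarith
          then have "h * of_int l \<ge> h * (real N + 1)" using h by (intro mult_left_mono) auto
          then have "R < x + h * of_int l" using N True h by (auto simp: algebra_simps)
          then show ?thesis by linarith
        next
          assume "l \<le> - int N - 1"
          then have "real_of_int l \<le> - (real N + 1)" by linarith
          then have "h * of_int l \<le> h * (- (real N + 1))" using h by (intro mult_left_mono) auto
          then have "x + h * of_int l < - R" using N True h by (auto simp: algebra_simps)
          then show ?thesis by linarith
        qed
      qed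
      have "(\<integral>\<^sup>+l. sq_mod (f (x + h * of_int l)) \<partial>count_space UNIV) = (\<Sum>l\<in>{- int N..int N}. sq_mod (f (x + h * of_int l)))"
      proof (rule nn_integral_count_space')
        fix l assume "l \<notin> {- int N..int N}"
        then show "sq_mod (f (x + h * of_int l)) = 0" using z by simp
      qed auto
      also have "\<dots> = ennreal (\<Sum>l\<in>{- int N..int N}. (cmod (f (x + of_int l * h)))\<^sup>2)"
        by (simp add: sum_ennreal mult.commute)
      finally show ?thesis using True by simp
    qed simp
  qed
  finally show ?thesis .
qed

text \<open>
  Apply \<open>sampling_shift_combination\<close> for each \<open>x\<close> and integrate over \<open>[0, 1 / \<beta>]\<close>; the squared moduli of
  the coefficients \<open>cnj (f (x + l / \<beta>))\<close> integrate to the squared norm of \<open>f\<close>.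
\<close>

lemma frame_inequality_compact_support:
  assumes \<phi>: "continuous_on UNIV \<phi>" "\<phi> \<in> L2_space" and \<alpha>: "\<alpha> > 0" and \<beta>: "\<beta> > 0"
    and M: "0 < M" "2 * \<alpha> * sqrt M < 1" and B: "B < \<infinity>"
    and bounds: "AE w in lborel. w \<in> {0..\<beta>} \<longrightarrow> A \<le> fourier_periodization \<phi> \<beta> w \<and> fourier_periodization \<phi> \<beta> w \<le> B
      \<and> weighted_periodization \<phi> \<beta> w \<le> ennreal M * fourier_periodization \<phi> \<beta> w"
    and f: "continuous_on UNIV f" "\<exists>R. \<forall>x. \<bar>x\<bar> > R \<longrightarrow> f x = 0"
  defines "T \<equiv> \<integral>\<^sup>+i. sq_mod (L2_inner f (gabor_system \<phi> \<alpha> \<beta> i)) \<partial>count_space UNIV"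
  shows "ennreal (1 / \<alpha> * (1 - 2 * \<alpha> * sqrt M)\<^sup>2) * A * L2_norm_sq f \<le> T"
    and "T \<le> ennreal (1 / \<alpha> * (1 + 2 * \<alpha> * sqrt M)\<^sup>2) * B * L2_norm_sq f"
proof -
  have fm [measurable]: "f \<in> borel_measurable borel" using f(1) by (rule borel_measurable_continuous_onI)
  have [measurable]: "\<phi> \<in> borel_measurable borel" using \<phi>(1) by (rule borel_measurable_continuous_onI)
  obtain R where R: "\<And>x. \<bar>x\<bar> > R \<Longrightarrow> f x = 0" using f(2) by blast
  have "\<exists>N :: nat. R * \<beta> < real N" by (rule reals_Archimedean2)
  then obtain N :: nat where "R * \<beta> < real N" by blast
  then have N: "R < real N / \<beta>" using \<beta> by (simp add: pos_less_divide_eq)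
  define S where "S x = (\<integral>\<^sup>+k. sq_mod (\<Sum>l\<in>{- int N..int N}. cnj (f (x + of_int l / \<beta>)) * \<phi> (x + \<alpha> * of_int k + of_int l / \<beta>)) \<partial>count_space UNIV)" for x
  define E where "E x = (\<Sum>l\<in>{- int N..int N}. (cmod (f (x + of_int l / \<beta>)))\<^sup>2)" for x
  have [measurable]: "S \<in> borel_measurable borel" "E \<in> borel_measurable borel"
    unfolding S_def[abs_def] E_def[abs_def] by measurable
  have E0: "E x \<ge> 0" for x unfolding E_def by (intro sum_nonneg) auto
  have T: "T = (\<integral>\<^sup>+x\<in>{0..1 / \<beta>}. ennreal (1 / \<beta>) * S x \<partial>lborel)"
    unfolding T_def S_def by (rule gabor_coefficient_sum[OF \<phi>(1) \<alpha> \<beta> f(1) R N])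
  have f2: "L2_norm_sq f = (\<integral>\<^sup>+x\<in>{0..1 / \<beta>}. ennreal (E x) \<partial>lborel)"
    unfolding E_def using L2_norm_sq_compact_support_periodized[of "1 / \<beta>" f R N] \<beta> R N by simp
  have \<alpha>1: "ennreal (1 / \<alpha> * r) = ennreal (1 / \<alpha>) * ennreal r" if "r \<ge> 0" for r
    using \<alpha> that by (intro ennreal_mult) auto
  have c1: "ennreal (1 / \<alpha>) * (ennreal \<alpha> * y) = y" for y
    using \<alpha> by (simp add: mult.assoc[symmetric] ennreal_mult[symmetric])
  have c2: "ennreal (1 / \<beta>) * ennreal (\<beta> * E x) = ennreal (E x)" for x
    using \<beta> E0[of x] by (simp add: ennreal_mult[symmetric])
  have cn: "(\<Sum>l\<in>{- int N..int N}. (cmod (cnj (f (x + of_int l / \<beta>))))\<^sup>2) = E x" for x by (simp add: E_def)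
  note samp = sampling_shift_combination[OF \<phi> \<alpha> \<beta> finite_atLeastAtMost_int[of "- int N" "int N"] M B bounds, where c="\<lambda>l. cnj (f (x + of_int l / \<beta>))" and x=x for x, unfolded cn, folded S_def]
  show "ennreal (1 / \<alpha> * (1 - 2 * \<alpha> * sqrt M)\<^sup>2) * A * L2_norm_sq f \<le> T"
  proof -
    have "ennreal (1 / \<alpha> * (1 - 2 * \<alpha> * sqrt M)\<^sup>2) * A * L2_norm_sq f
      = (\<integral>\<^sup>+x. ennreal (1 / \<alpha> * (1 - 2 * \<alpha> * sqrt M)\<^sup>2) * A * (ennreal (E x) * indicator {0..1 / \<beta>} x) \<partial>lborel)"
      unfolding f2 by (rule nn_integral_cmult[symmetric]) measurable
    also have "\<dots> \<le> T" unfolding T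
    proof (rule nn_integral_mono)
      fix x
      have "ennreal (1 / \<alpha> * (1 - 2 * \<alpha> * sqrt M)\<^sup>2) * A * ennreal (E x)
        = ennreal (1 / \<beta>) * (ennreal (1 / \<alpha>) * (ennreal ((1 - 2 * \<alpha> * sqrt M)\<^sup>2) * (A * ennreal (\<beta> * E x))))"
        unfolding c2[symmetric] by (subst \<alpha>1) (auto simp: mult_ac)
      also have "\<dots> \<le> ennreal (1 / \<beta>) * (ennreal (1 / \<alpha>) * (ennreal \<alpha> * S x))"
        by (intro mult_left_mono samp(1)) auto
      also have "\<dots> = ennreal (1 / \<beta>) * S x" unfolding c1 ..
      finally show "ennreal (1 / \<alpha> * (1 - 2 * \<alpha> * sqrt M)\<^sup>2) * A * (ennreal (E x) * indicator {0..1 / \<beta>} x) \<le> ennreal (1 / \<beta>) * S x * indicator {0..1 / \<beta>} x"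
        by (auto simp: indicator_def)
    qed
    finally show ?thesis .
  qed
  show "T \<le> ennreal (1 / \<alpha> * (1 + 2 * \<alpha> * sqrt M)\<^sup>2) * B * L2_norm_sq f"
  proof -
    have "T \<le> (\<integral>\<^sup>+x. ennreal (1 / \<alpha> * (1 + 2 * \<alpha> * sqrt M)\<^sup>2) * B * (ennreal (E x) * indicator {0..1 / \<beta>} x) \<partial>lborel)"
      unfolding T
    proof (rule nn_integral_mono)
      fix x
      have "ennreal (1 / \<beta>) * S x = ennreal (1 / \<beta>) * (ennreal (1 / \<alpha>) * (ennreal \<alpha> * S x))" unfolding c1 ..
      also have "\<dots> \<le> ennreal (1 / \<beta>) * (ennreal (1 / \<alpha>) * (ennreal ((1 + 2 * \<alpha> * sqrt M)\<^sup>2) * (B * ennreal (\<beta> * E x))))"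
        by (intro mult_left_mono samp(2)) auto
      also have "\<dots> = ennreal (1 / \<alpha> * (1 + 2 * \<alpha> * sqrt M)\<^sup>2) * B * ennreal (E x)"
        unfolding c2[symmetric] by (subst \<alpha>1) (auto simp: mult_ac)
      finally show "ennreal (1 / \<beta>) * S x * indicator {0..1 / \<beta>} x \<le> ennreal (1 / \<alpha> * (1 + 2 * \<alpha> * sqrt M)\<^sup>2) * B * (ennreal (E x) * indicator {0..1 / \<beta>} x)"
        by (auto simp: indicator_def)
    qed
    also have "\<dots> = ennreal (1 / \<alpha> * (1 + 2 * \<alpha> * sqrt M)\<^sup>2) * B * L2_norm_sq f"
      unfolding f2 by (rule nn_integral_cmult) measurable
    finally show ?thesis .
  qed
qed

section \<open>Passage to all square-integrable functions\<close>

lemma L2_inner_integrable: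
  assumes "f \<in> L2_space" "g \<in> L2_space"
  shows "integrable lborel (\<lambda>x. f x * cnj (g x))"
proof (rule integrableI_bounded)
  have [measurable]: "f \<in> borel_measurable borel" "g \<in> borel_measurable borel" using assms by (auto simp: L2_space_def)
  show "(\<lambda>x. f x * cnj (g x)) \<in> borel_measurable lborel" by measurable
  have "(\<integral>\<^sup>+x. ennreal (cmod (f x * cnj (g x))) \<partial>lborel) \<le> (\<integral>\<^sup>+x. sq_mod (f x) + sq_mod (g x) \<partial>lborel)"
  proof (rule nn_integral_mono)
    fix x
    have "cmod (f x * cnj (g x)) \<le> (cmod (f x))\<^sup>2 + (cmod (g x))\<^sup>2"
    proof -
      have "2 * cmod (f x) * cmod (g x) \<le> (cmod (f x))\<^sup>2 + (cmod (g x))\<^sup>2" by (rule sum_squares_bound)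
      moreover have "0 \<le> cmod (f x) * cmod (g x)" by simp
      ultimately show ?thesis unfolding norm_mult complex_mod_cnj by linarith
    qed
    then show "ennreal (cmod (f x * cnj (g x))) \<le> sq_mod (f x) + sq_mod (g x)"
      by (simp add: ennreal_plus[symmetric] del: ennreal_plus)
  qed
  also have "\<dots> = L2_norm_sq f + L2_norm_sq g" unfolding L2_norm_sq_def by (rule nn_integral_add) measurable
  also have "\<dots> < \<infinity>" using assms by (simp add: L2_space_def)
  finally show "(\<integral>\<^sup>+x. ennreal (norm (f x * cnj (g x))) \<partial>lborel) < \<infinity>" .
qed

lemma L2_inner_cauchy_schwarz:
  assumes "f \<in> L2_space" "g \<in> L2_space"
  shows "sq_mod (L2_inner f g) \<le> L2_norm_sq f * L2_norm_sq g"
proof -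
  have [measurable]: "f \<in> borel_measurable borel" "g \<in> borel_measurable borel" using assms by (auto simp: L2_space_def)
  have "ennreal (cmod (L2_inner f g)) \<le> (\<integral>\<^sup>+x. ennreal (cmod (f x * cnj (g x))) \<partial>lborel)"
    unfolding L2_inner_def by (rule integral_norm_bound_ennreal[OF L2_inner_integrable[OF assms]])
  also have "\<dots> = (\<integral>\<^sup>+x. ennreal (cmod (f x)) * ennreal (cmod (g x)) \<partial>lborel)"
    by (simp add: norm_mult ennreal_mult)
  finally have "(ennreal (cmod (L2_inner f g)))\<^sup>2 \<le> (\<integral>\<^sup>+x. ennreal (cmod (f x)) * ennreal (cmod (g x)) \<partial>lborel)\<^sup>2"
    by (rule power_mono) simp
  also have "\<dots> \<le> (\<integral>\<^sup>+x. (ennreal (cmod (f x)))\<^sup>2 \<partial>lborel) * (\<integral>\<^sup>+x. (ennreal (cmod (g x)))\<^sup>2 \<partial>lborel)"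
    by (rule Cauchy_Schwarz_nn_integral) measurable
  finally show ?thesis by (simp add: L2_norm_sq_def ennreal_power)
qed

lemma L2_space_diff:
  assumes "f \<in> L2_space" "g \<in> L2_space"
  shows "(\<lambda>x. f x - g x) \<in> L2_space"
proof -
  have [measurable]: "f \<in> borel_measurable borel" "g \<in> borel_measurable borel" using assms by (auto simp: L2_space_def)
  have "L2_dist_sq f g \<le> 2 * L2_norm_sq (\<lambda>x. f x - 0) + 2 * L2_norm_sq (\<lambda>x. 0 - g x)"
    by (rule L2_norm_sq_triangle) measurable
  also have "\<dots> < \<infinity>" using assms by (simp add: L2_space_def L2_norm_sq_commute[of "\<lambda>_. 0" g, simplified] ennreal_mult_less_top)
  finally show ?thesis by (simp add: L2_space_def)
qed

lemma L2_inner_diff: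
  assumes "f \<in> L2_space" "g \<in> L2_space" "e \<in> L2_space"
  shows "L2_inner (\<lambda>x. f x - g x) e = L2_inner f e - L2_inner g e"
  unfolding L2_inner_def left_diff_distrib
  by (intro Bochner_Integration.integral_diff L2_inner_integrable assms)

lemma compact_support_in_L2:
  assumes f: "continuous_on UNIV f" "\<exists>R. \<forall>x. \<bar>x\<bar> > R \<longrightarrow> f x = 0"
  shows "f \<in> L2_space"
proof -
  obtain R where R: "\<And>x. \<bar>x\<bar> > R \<Longrightarrow> f x = 0" using f(2) by blast
  have fm: "f \<in> borel_measurable borel" using f(1) by (rule borel_measurable_continuous_onI)
  have "(\<integral>\<^sup>+x. sq_mod (f x) \<partial>lborel) = (\<integral>\<^sup>+x\<in>{-R..R}. sq_mod (f x) \<partial>lborel)"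
    using R by (intro nn_integral_cong) (auto simp: indicator_def not_le)
  also have "\<dots> = ennreal (integral {-R..R} (\<lambda>x. (cmod (f x))\<^sup>2))"
    by (intro nn_integral_Icc_continuous continuous_intros continuous_on_subset[OF f(1)]) auto
  also have "\<dots> < \<infinity>" by simp
  finally show ?thesis using fm by (simp add: L2_space_def L2_norm_sq_def)
qed

text \<open>
  The upper bound passes to the limit by Fatou's lemma, since each coefficient is continuous in \<open>f\<close>.
  The upper bound for \<open>f - u\<^sub>n\<close> then controls the change of the sum of squares, which gives the lower
  bound.
\<close>

lemma frame_inequality_dense:
  fixes e :: "'i::countable \<Rightarrow> real \<Rightarrow> complex"
  assumes e: "range e \<subseteq> L2_space" and B: "B < \<infinity>"
    and cs: "\<And>f. continuous_on UNIV f \<Longrightarrow> \<exists>R. \<forall>x. \<bar>x\<bar> > R \<longrightarrow> f x = 0 \<Longrightarrow>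
      A * L2_norm_sq f \<le> (\<integral>\<^sup>+i. sq_mod (L2_inner f (e i)) \<partial>count_space UNIV) \<and>
      (\<integral>\<^sup>+i. sq_mod (L2_inner f (e i)) \<partial>count_space UNIV) \<le> B * L2_norm_sq f"
    and A: "A < \<infinity>" and f: "f \<in> L2_space"
  shows "A * L2_norm_sq f \<le> (\<integral>\<^sup>+i. sq_mod (L2_inner f (e i)) \<partial>count_space UNIV)"
    and "(\<integral>\<^sup>+i. sq_mod (L2_inner f (e i)) \<partial>count_space UNIV) \<le> B * L2_norm_sq f"
proof -
  define T where "T f = (\<integral>\<^sup>+i. sq_mod (L2_inner f (e i)) \<partial>count_space UNIV)" for f
  have eL: "e i \<in> L2_space" for i using e by auto
  have upper: "T f \<le> B * L2_norm_sq f" if f: "f \<in> L2_space" for f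
  proof -
    obtain u :: "nat \<Rightarrow> real \<Rightarrow> complex" where u: "\<And>n. continuous_on UNIV (u n)" "\<And>n. \<exists>R. \<forall>x. \<bar>x\<bar> > R \<longrightarrow> u n x = 0"
      and lim: "(\<lambda>n. L2_dist_sq f (u n)) \<longlonglongrightarrow> 0"
      using L2_dense_compact_support[OF f] by blast
    have uL: "u n \<in> L2_space" for n by (rule compact_support_in_L2[OF u])
    have [measurable]: "f \<in> borel_measurable borel" "u n \<in> borel_measurable borel" for n
      using f uL by (auto simp: L2_space_def)
    have inner: "(\<lambda>n. L2_inner (u n) (e i)) \<longlonglongrightarrow> L2_inner f (e i)" for i
    proof -
      have "(\<lambda>n. sq_mod (L2_inner f (e i) - L2_inner (u n) (e i))) \<longlonglongrightarrow> 0"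
      proof (rule tendsto_sandwich[OF _ _ tendsto_const])
        have "(\<lambda>n. L2_norm_sq (e i) * L2_dist_sq f (u n)) \<longlonglongrightarrow> L2_norm_sq (e i) * 0"
          using eL[of i] by (intro ennreal_tendsto_cmult lim) (simp add: L2_space_def)
        then show "(\<lambda>n. L2_norm_sq (e i) * L2_dist_sq f (u n)) \<longlonglongrightarrow> 0" by simp
        show "eventually (\<lambda>n. sq_mod (L2_inner f (e i) - L2_inner (u n) (e i)) \<le> L2_norm_sq (e i) * L2_dist_sq f (u n)) sequentially"
          using L2_inner_cauchy_schwarz[OF L2_space_diff[OF f uL] eL]
          by (intro always_eventually) (simp add: L2_inner_diff[OF f uL eL] mult.commute)
      qed simp
      then have "(\<lambda>n. (cmod (L2_inner f (e i) - L2_inner (u n) (e i)))\<^sup>2) \<longlonglongrightarrow> 0"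
        using tendsto_ennreal_iff[of "\<lambda>n. (cmod (L2_inner f (e i) - L2_inner (u n) (e i)))\<^sup>2" sequentially 0] by simp
      then have "(\<lambda>n. sqrt ((cmod (L2_inner f (e i) - L2_inner (u n) (e i)))\<^sup>2)) \<longlonglongrightarrow> sqrt 0"
        by (rule tendsto_real_sqrt)
      then have "(\<lambda>n. L2_inner f (e i) - L2_inner (u n) (e i)) \<longlonglongrightarrow> 0"
        by (simp add: tendsto_norm_zero_iff)
      from tendsto_diff[OF tendsto_const[of "L2_inner f (e i)"] this] show ?thesis by simp
    qed
    have "T f = (\<integral>\<^sup>+i. liminf (\<lambda>n. sq_mod (L2_inner (u n) (e i))) \<partial>count_space UNIV)"
      unfolding T_def by (intro nn_integral_cong lim_imp_Liminf[symmetric] tendsto_ennrealI tendsto_intros inner) auto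
    also have "\<dots> \<le> liminf (\<lambda>n. T (u n))"
      unfolding T_def by (rule nn_integral_liminf) simp
    also have "\<dots> \<le> liminf (\<lambda>n. B * L2_norm_sq (u n))"
      using cs[OF u] by (intro Liminf_mono always_eventually) (simp add: T_def)
    finally have Tl: "T f \<le> liminf (\<lambda>n. B * L2_norm_sq (u n))" .
    show ?thesis
    proof (rule ennreal_le_of_slack)
      fix \<eta> :: real assume \<eta>: "\<eta> > 0"
      have "B * L2_norm_sq (u n) \<le> B * (ennreal (1 + \<eta>) * L2_norm_sq f + ennreal (1 + 1 / \<eta>) * L2_dist_sq f (u n))" for n
      proof (rule mult_left_mono)
        show "L2_norm_sq (u n) \<le> ennreal (1 + \<eta>) * L2_norm_sq f + ennreal (1 + 1 / \<eta>) * L2_dist_sq f (u n)"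
          unfolding L2_norm_sq_commute[of f] unfolding L2_norm_sq_def by (rule nn_integral_norm_sq_le) (use \<eta> in auto)
      qed simp
      then have "liminf (\<lambda>n. B * L2_norm_sq (u n)) \<le> liminf (\<lambda>n. B * (ennreal (1 + \<eta>) * L2_norm_sq f + ennreal (1 + 1 / \<eta>) * L2_dist_sq f (u n)))"
        by (intro Liminf_mono always_eventually) simp
      also have "\<dots> = B * (ennreal (1 + \<eta>) * L2_norm_sq f + ennreal (1 + 1 / \<eta>) * 0)"
      proof (rule lim_imp_Liminf)
        show "(\<lambda>n. B * (ennreal (1 + \<eta>) * L2_norm_sq f + ennreal (1 + 1 / \<eta>) * L2_dist_sq f (u n)))
          \<longlonglongrightarrow> B * (ennreal (1 + \<eta>) * L2_norm_sq f + ennreal (1 + 1 / \<eta>) * 0)"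
          using B by (intro ennreal_tendsto_cmult tendsto_add tendsto_const lim) auto
      qed simp
      also have "\<dots> = ennreal (1 + \<eta>) * (B * L2_norm_sq f)" by (simp add: mult.left_commute)
      finally show "T f \<le> ennreal (1 + \<eta>) * (B * L2_norm_sq f)" using Tl by simp
    qed
  qed
  then show "(\<integral>\<^sup>+i. sq_mod (L2_inner f (e i)) \<partial>count_space UNIV) \<le> B * L2_norm_sq f"
    using f by (simp add: T_def)
  obtain u :: "nat \<Rightarrow> real \<Rightarrow> complex" where u: "\<And>n. continuous_on UNIV (u n)" "\<And>n. \<exists>R. \<forall>x. \<bar>x\<bar> > R \<longrightarrow> u n x = 0"
    and lim: "(\<lambda>n. L2_dist_sq f (u n)) \<longlonglongrightarrow> 0"
    using L2_dense_compact_support[OF f] by blast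
  have uL: "u n \<in> L2_space" for n by (rule compact_support_in_L2[OF u])
  have [measurable]: "f \<in> borel_measurable borel" "u n \<in> borel_measurable borel" for n
    using f uL by (auto simp: L2_space_def)
  have two: "A * L2_norm_sq f \<le> ennreal (1 + \<eta>) * (ennreal (1 + \<eta>) * T f)" if \<eta>: "\<eta> > 0" for \<eta>
  proof (rule LIMSEQ_le_const)
    let ?z = "\<lambda>n. L2_dist_sq f (u n)"
    let ?R = "\<lambda>n. ennreal (1 + \<eta>) * (ennreal (1 + \<eta>) * T f + ennreal (1 + 1 / \<eta>) * (B * ?z n)) + ennreal (1 + 1 / \<eta>) * (A * ?z n)"
    have "?R \<longlonglongrightarrow> ennreal (1 + \<eta>) * (ennreal (1 + \<eta>) * T f + ennreal (1 + 1 / \<eta>) * (B * 0)) + ennreal (1 + 1 / \<eta>) * (A * 0)"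
      using A B by (intro ennreal_tendsto_cmult tendsto_add tendsto_const lim) auto
    then show "?R \<longlonglongrightarrow> ennreal (1 + \<eta>) * (ennreal (1 + \<eta>) * T f)" by simp
    have "A * L2_norm_sq f \<le> ?R n" for n
    proof -
      have "L2_norm_sq f \<le> ennreal (1 + \<eta>) * L2_norm_sq (u n) + ennreal (1 + 1 / \<eta>) * ?z n"
        unfolding L2_norm_sq_def by (rule nn_integral_norm_sq_le) (use \<eta> in auto)
      then have "A * L2_norm_sq f \<le> A * (ennreal (1 + \<eta>) * L2_norm_sq (u n) + ennreal (1 + 1 / \<eta>) * ?z n)"
        by (rule mult_left_mono) simp
      also have "\<dots> = ennreal (1 + \<eta>) * (A * L2_norm_sq (u n)) + ennreal (1 + 1 / \<eta>) * (A * ?z n)"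
        by (simp add: distrib_left mult_ac)
      also have "A * L2_norm_sq (u n) \<le> T (u n)" using cs[OF u] by (simp add: T_def)
      also have "T (u n) \<le> ennreal (1 + \<eta>) * T f + ennreal (1 + 1 / \<eta>) * (\<integral>\<^sup>+i. sq_mod (L2_inner (u n) (e i) - L2_inner f (e i)) \<partial>count_space UNIV)"
        unfolding T_def by (rule nn_integral_norm_sq_le) (use \<eta> in auto)
      also have "(\<integral>\<^sup>+i. sq_mod (L2_inner (u n) (e i) - L2_inner f (e i)) \<partial>count_space UNIV) = T (\<lambda>x. f x - u n x)"
        unfolding T_def L2_inner_diff[OF f uL eL] by (simp add: norm_minus_commute)
      also have "T (\<lambda>x. f x - u n x) \<le> B * ?z n" by (rule upper[OF L2_space_diff[OF f uL]])
      finally show ?thesis by (simp add: mult_left_mono add_left_mono add_right_mono)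
    qed
    then show "\<exists>N. \<forall>n\<ge>N. A * L2_norm_sq f \<le> ?R n" by blast
  qed
  show "A * L2_norm_sq f \<le> (\<integral>\<^sup>+i. sq_mod (L2_inner f (e i)) \<partial>count_space UNIV)"
    unfolding T_def[symmetric]
  proof (rule ennreal_le_of_slack)
    fix \<eta> :: real assume \<eta>: "\<eta> > 0"
    (* Two approximations each cost a factor 1 + d. *)
    define d where "d = sqrt (1 + \<eta>) - 1"
    have d: "d > 0" "(1 + d) * (1 + d) = 1 + \<eta>" using \<eta> by (auto simp: d_def)
    have "ennreal (1 + d) * ennreal (1 + d) = ennreal (1 + \<eta>)"
      using d by (subst ennreal_mult[symmetric]) auto
    then show "A * L2_norm_sq f \<le> ennreal (1 + \<eta>) * T f"
      using two[OF d(1)] by (simp only: mult.assoc[symmetric])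
  qed
qed

section \<open>The frame bounds\<close>

text \<open>
  Each level below the lower limit is exceeded almost everywhere; countably many levels approach it.
\<close>

lemma essinf_AE:
  assumes "f \<in> borel_measurable M"
  shows "AE x in M. essinf M f \<le> f x"
proof (cases "essinf M f = 0")
  case False
  then have pos: "0 < essinf M f" by (simp add: zero_less_iff_neq_zero)
  obtain c where c: "\<And>n. c n < essinf M f" "c \<longlonglongrightarrow> essinf M f"
    using approx_from_below_dense_linorder[OF pos] by blast
  have "AE x in M. c n < f x" for n
    using c(1)[of n] assms by (intro less_LiminfD) (simp add: essinf_def)
  then have "AE x in M. \<forall>n. c n < f x" by (simp add: AE_all_countable)
  then show ?thesis
  proof eventually_elim
    case (elim x)
    then show ?case
      by (intro LIMSEQ_le_const2[OF c(2)]) (auto intro: less_imp_le)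
  qed
qed simp

lemma essinf_greatest:
  assumes "f \<in> borel_measurable M" "AE x in M. c \<le> f x"
  shows "c \<le> essinf M f"
  using assms by (simp add: essinf_def Liminf_bounded)

theorem theorem2p4:
  fixes \<alpha> \<beta> :: real and \<phi> :: "real \<Rightarrow> complex"
  assumes "\<alpha> > 0" and "\<beta> > 0"
    and "\<phi> \<in> class_A"
    and "stable_generator (1 / \<beta>) \<phi>"
    and "\<alpha> < 1 / (2 * sqrt (M_const \<phi> (1 / \<beta>)))"
  shows "frame_with_bounds (gabor_system \<phi> \<alpha> \<beta>)
           (1 / \<alpha> * (1 - 2 * \<alpha> * sqrt (M_const \<phi> (1 / \<beta>)))\<^sup>2 *
              enn2real (essinf (restrict_space lborel {0..\<beta>}) (fourier_periodization \<phi> \<beta>)))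
           (1 / \<alpha> * (1 + 2 * \<alpha> * sqrt (M_const \<phi> (1 / \<beta>)))\<^sup>2 *
              enn2real (esssup (restrict_space lborel {0..\<beta>}) (fourier_periodization \<phi> \<beta>)))"
proof -
  note \<alpha> = assms(1) and \<beta> = assms(2)
  have cont: "continuous_on UNIV \<phi>" using assms(3) by (simp add: class_A_def)
  have "shift_system (1 / \<beta>) \<phi> 0 \<in> L2_space"
    using assms(4) unfolding stable_generator_def riesz_basis_L2_def by blast
  then have L2: "\<phi> \<in> L2_space" by (simp add: shift_system_def)
  have [measurable]: "\<phi> \<in> borel_measurable borel" using L2 by (simp add: L2_space_def)
  have [measurable]: "fourier \<phi> \<in> borel_measurable borel" using fourier_L2_limit(1)[OF cont L2] by (simp add: L2_space_def)
  note [measurable] = periodization_measurable[OF this]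
  let ?\<mu> = "restrict_space lborel {0..\<beta>}"
  let ?G = "fourier_periodization \<phi> \<beta>"
  let ?W = "weighted_periodization \<phi> \<beta>"
  define M where "M = M_const \<phi> (1 / \<beta>)"
  define A0 where "A0 = essinf ?\<mu> ?G"
  define B0 where "B0 = esssup ?\<mu> ?G"
  have AE_iff: "(AE w in ?\<mu>. P w) \<longleftrightarrow> (AE w in lborel. w \<in> {0..\<beta>} \<longrightarrow> P w)" for P
    by (rule AE_restrict_space_iff) simp
  have Gm: "?G \<in> borel_measurable ?\<mu>" by (intro measurable_restrict_space1) measurable
  obtain a b where ab: "0 < a" "0 < b" and Gab: "AE w in lborel. w \<in> {0..\<beta>} \<longrightarrow> ennreal a \<le> ?G w \<and> ?G w \<le> ennreal b"
    using stable_generator_periodization_bounds[OF cont L2 \<beta> assms(4)] by blast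
  have aA0: "ennreal a \<le> A0"
    unfolding A0_def by (rule essinf_greatest[OF Gm]) (use Gab in \<open>auto simp: AE_iff elim: eventually_mono\<close>)
  have B0b: "B0 \<le> ennreal b"
    unfolding B0_def by (rule esssup_I[OF Gm]) (use Gab in \<open>auto simp: AE_iff elim: eventually_mono\<close>)
  have GA0: "AE w in lborel. w \<in> {0..\<beta>} \<longrightarrow> A0 \<le> ?G w"
    using essinf_AE[OF Gm] unfolding A0_def AE_iff .
  have GB0: "AE w in lborel. w \<in> {0..\<beta>} \<longrightarrow> ?G w \<le> B0"
    using esssup_AE[where M="?\<mu>" and f="?G"] unfolding B0_def AE_iff .
  have A0B0: "A0 \<le> B0"
  proof (rule ccontr)
    assume "\<not> A0 \<le> B0"
    have "AE w in lborel. w \<notin> {0..\<beta>}"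
      using GA0 GB0 by eventually_elim (use \<open>\<not> A0 \<le> B0\<close> order_trans in blast)
    then have "emeasure lborel {0..\<beta>} = 0"
      by (subst (asm) AE_iff_measurable[OF _ refl]) (auto simp: atLeastAtMost_def atLeast_def atMost_def Int_def)
    then show False using \<beta> by simp
  qed
  (* If M were 0, the bound on \<alpha> would read \<alpha> < 0, since division by zero yields 0. As the conversion of an
     infinite essential supremum is also 0, this shows as well that the supremum is finite. *)
  have sM: "sqrt M > 0"
  proof (rule ccontr)
    assume "\<not> sqrt M > 0"
    then have "M = 0" by (simp add: M_def M_const_def order_antisym[OF _ enn2real_nonneg])
    then show False using assms(1,5) by (simp add: M_def)
  qed
  then have M0: "M > 0" by simp
  have small: "2 * \<alpha> * sqrt M < 1"
    using assms(5) sM by (simp add: M_def[symmetric] field_simps)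
  have Meq: "esssup ?\<mu> (B_ratio \<phi> (1 / \<beta>)) = ennreal M"
  proof -
    have "M = enn2real (esssup ?\<mu> (B_ratio \<phi> (1 / \<beta>)))" by (simp add: M_def M_const_def)
    then show ?thesis using M0 by (cases "esssup ?\<mu> (B_ratio \<phi> (1 / \<beta>))") auto
  qed
  have "AE w in lborel. w \<in> {0..\<beta>} \<longrightarrow> ?W w / ?G w \<le> ennreal M"
    using esssup_AE[where M="?\<mu>" and f="B_ratio \<phi> (1 / \<beta>)"] unfolding Meq AE_iff by (simp add: B_ratio_def)
  then have bounds: "AE w in lborel. w \<in> {0..\<beta>} \<longrightarrow> A0 \<le> ?G w \<and> ?G w \<le> B0 \<and> ?W w \<le> ennreal M * ?G w"
    using GA0 GB0 Gab
  proof eventually_elim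
    case (elim w)
    show ?case
    proof
      assume w: "w \<in> {0..\<beta>}"
      have G0: "?G w \<noteq> 0" "?G w \<noteq> top" using elim w ab by (auto simp: top_unique)
      have "?W w = ?W w / ?G w * ?G w"
        using G0 by (metis ennreal_divide_times ennreal_times_divide mult_divide_eq_ennreal)
      also have "\<dots> \<le> ennreal M * ?G w" using elim w by (intro mult_right_mono) auto
      finally show "A0 \<le> ?G w \<and> ?G w \<le> B0 \<and> ?W w \<le> ennreal M * ?G w" using elim w by blast
    qed
  qed
  have "B0 < \<infinity>" by (rule le_less_trans[OF B0b]) simp
  with A0B0 have fin: "B0 < \<infinity>" "A0 < \<infinity>" by (auto intro: le_less_trans)
  define rA where "rA = 1 / \<alpha> * (1 - 2 * \<alpha> * sqrt M)\<^sup>2"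
  define rB where "rB = 1 / \<alpha> * (1 + 2 * \<alpha> * sqrt M)\<^sup>2"
  have "1 + 2 * \<alpha> * sqrt M > 0" using \<alpha> sM by (simp add: add_pos_pos)
  then have r: "rA > 0" "rB > 0" using \<alpha> small by (auto simp: rA_def rB_def)
  have A0r: "A0 = ennreal (enn2real A0)" "B0 = ennreal (enn2real B0)" using fin by auto
  have pos: "enn2real A0 > 0" "enn2real B0 > 0"
  proof -
    have "0 < A0" using aA0 ab by (metis ennreal_less_zero_iff less_le_trans)
    then show "enn2real A0 > 0" "enn2real B0 > 0"
      using fin A0B0 by (auto simp: enn2real_positive_iff intro: less_le_trans)
  qed
  have range: "range (gabor_system \<phi> \<alpha> \<beta>) \<subseteq> L2_space"
  proof clarify
    fix k m
    have "L2_norm_sq (gabor_system \<phi> \<alpha> \<beta> (k, m)) = L2_norm_sq (\<lambda>x. 1 * \<phi> (x + (- \<alpha> * of_int k)))"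
      unfolding L2_norm_sq_def gabor_system_def by (simp add: norm_mult)
    also have "\<dots> = L2_norm_sq \<phi>" by (subst L2_norm_sq_cmult_shift) auto
    also have "\<dots> < \<infinity>" using L2 by (simp add: L2_space_def)
    finally show "gabor_system \<phi> \<alpha> \<beta> (k, m) \<in> L2_space"
      unfolding L2_space_def gabor_system_def by simp
  qed
  have cs: "(ennreal rA * A0) * L2_norm_sq f \<le> (\<integral>\<^sup>+i. sq_mod (L2_inner f (gabor_system \<phi> \<alpha> \<beta> i)) \<partial>count_space UNIV) \<and>
      (\<integral>\<^sup>+i. sq_mod (L2_inner f (gabor_system \<phi> \<alpha> \<beta> i)) \<partial>count_space UNIV) \<le> (ennreal rB * B0) * L2_norm_sq f"
    if "continuous_on UNIV f" "\<exists>R. \<forall>x. \<bar>x\<bar> > R \<longrightarrow> f x = 0" for f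
    unfolding rA_def rB_def
    using frame_inequality_compact_support[OF cont L2 \<alpha> \<beta> M0 small fin(1) bounds that] by simp
  have fin': "ennreal rA * A0 < \<infinity>" "ennreal rB * B0 < \<infinity>" using fin by (auto simp: ennreal_mult_less_top)
  have eq: "ennreal (rA * enn2real A0) = ennreal rA * A0" "ennreal (rB * enn2real B0) = ennreal rB * B0"
    using r A0r by (metis ennreal_mult enn2real_nonneg less_imp_le)+
  have "frame_with_bounds (gabor_system \<phi> \<alpha> \<beta>) (rA * enn2real A0) (rB * enn2real B0)"
    unfolding frame_with_bounds_def eq infsum_ennreal_eq_nn_integral
    using range r pos frame_inequality_dense[OF range fin'(2) cs fin'(1)] by auto
  then show ?thesis unfolding rA_def rB_def A0_def B0_def M_def .
qed

end
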